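(* Consider the discrete (finite-alphabet) compound secret-key generation model described in the context, with capacity region $\mathcal{R}_{\rm G}$ for the generated-secret (GS) model and $\mathcal{R}_{\rm C}$ for the chosen-secret (CS) model. Then $$\mathcal{R}_{\rm G}\supseteq \bigcup_{P_{V|U},\,P_{U|\tilde{\mathbf X}}}\Big\{(R_S,R_J,R_L)\in\mathbb{R}_+^3:\ \text{(i), (ii-G), (iii) below hold}\Big\},$$ $$\mathcal{R}_{\rm C}\supseteq \bigcup_{P_{V|U},\,P_{U|\tilde{\mathbf X}}}\Big\{(R_S,R_J,R_L)\in\mathbb{R}_+^3:\ \text{(i), (ii-C), (iii) below hold}\Big\},$$ where (i) $R_S\le \min_{k}I(\mathbf Y_k;U|V)-\max_{l}I(\mathbf Z_l;U|V)$, (ii-G) $R_J\ge \max_k I(\tilde{\mathbf X};U|V,\mathbf Y_k)+\max_k I(\tilde{\mathbf X};V|\mathbf Y_k)$, (ii-C) $R_J\ge \max_k I(\tilde{\mathbf X};U|V,\mathbf Y_k)+\max_k I(\tilde{\mathbf X};V|\mathbf Y_k)+\min_{k}I(\mathbf Y_k;U|V)-\max_{l}I(\mathbf Z_l;U|V)$, (iii) $R_L\ge \max_k I(\tilde{\mathbf X};U|V,\mathbf Y_k)+\max_k I(\tilde{\mathbf X};V|\mathbf Y_k)-I(\tilde{\mathbf X};U|X)+\min_k I(\mathbf Y_k;V)-\min_l I(\mathbf Z_l;V)$. Here minima and maxima are over $k\in\mathcal K$ and $l\in\mathcal L$, the auxiliary random variables $V,U$ satisfy the Markov chain $V-U-\tilde{\mathbf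 X}-X-(\mathbf Y_k,\mathbf Z_l)$ for all $k\in\mathcal K$, $l\in\mathcal L$, and their alphabets satisfy $|\mathcal V|\le|\tilde{\boldsymbol{\mathcal X}}|+6$ and $|\mathcal U|\le(|\tilde{\boldsymbol{\mathcal X}}|+2(|\mathcal K|+|\mathcal L|)+1)(|\tilde{\boldsymbol{\mathcal X}}|+|\mathcal K|+|\mathcal L|+1)$.
   Context: **Source and channels.** $\mathcal K,\mathcal L$ are finite nonempty sets of channel states. $X^n=(X_1,\dots,X_n)$ (source identifier) is i.i.d. according to $P_X$ on a finite alphabet. The encoder observes $\tilde{\mathbf X}^n$ (vector-valued symbols in a finite alphabet $\tilde{\boldsymbol{\mathcal X}}$), and in state $(k,l)\in\mathcal K\times\mathcal L$ the decoder observes $\mathbf Y_k^n$ and the eavesdropper observes $\mathbf Z_l^n$ (vector-valued symbols in finite alphabets $\boldsymbol{\mathcal Y}_k$, $\boldsymbol{\mathcal Z}_l$). The joint law is $P_{\tilde{\mathbf X}^nX^n\mathbf Y_k^n\mathbf Z_l^n}=\prod_{t=1}^nP_{\tilde{\mathbf X}_t|X_t}P_{X_t}P_{\mathbf Y_{k,t}\mathbf Z_{l,t}|X_t}$, the single-letter laws $P_{\tilde{\mathbf X}|X}$, $P_{\mathbf Y_k\mathbf Z_l|X}$ being given. Logarithms are base 2. The notation $A-B-C$ denotes a Markov chain. **Strategies.** $\mathcal S=[1:2^{nR_S}]$, $\mathcal J=[1:2^{nR_J}]$, where $[a:b]=[\lfloor a\rfloor,\lceil b\rceil]\cap\mathbb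 N$. GS model: an encoder $e:\tilde{\boldsymbol{\mathcal X}}^n\to\mathcal J\times\mathcal S$ produces helper data and secret key $(J,S)=e(\tilde{\mathbf X}^n)$; a decoder $d:\boldsymbol{\mathcal Y}_k^n\times\mathcal J\to\mathcal S$ (encoder and decoder do not know the state $(k,l)$) produces $\hat S_k=d(\mathbf Y_k^n,J)$. CS model: $S$ is uniform on $\mathcal S$ and independent of $(\tilde{\mathbf X}^n,X^n,\mathbf Y_k^n,\mathbf Z_l^n)$; an encoder $e:\tilde{\boldsymbol{\mathcal X}}^n\times\mathcal S\to\mathcal J$ produces $J=e(\tilde{\mathbf X}^n,S)$; a decoder $d:\boldsymbol{\mathcal Y}_k^n\times\mathcal J\to\mathcal S$ (encoder and decoder do not know the state $(k,l)$) produces $\hat S_k=d(\mathbf Y_k^n,J)$. **Achievability.** $(R_S,R_J,R_L)\in\mathbb R_+^3$ is achievable for the GS model if for all sufficiently small $\delta>0$ and all large enough $n$ there exist an encoder and a decoder such that (1) $\max_{k}\mathbb P\{\hat S_k\ne S\}\le\delta$; (2) $H(S)+n\delta\ge\log|\mathcal S|\ge n(R_S-\delta)$; (3) $\log|\mathcal J|\le n(R_J+\delta)$; (4) $\max_{l}I(S;J,\mathbf Z_l^n)\le n\delta$; (5) $\max_{l}I(X^n;J|\mathbf Z_l^n)\le n(R_L+\delta)$. It is achievable for the CS model if the same holds (with CS strategies) with (2) replaced by $\log|\mathcal S|\ge n(R_S-\delta)$. The capacity regions $\mathcal R_{\rm G}$ and $\mathcal R_{\rm C}$ are the closures of the sets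 of achievable tuples for the GS and CS models. *)

theory Defs
  imports "HOL-Probability.Probability"
begin

section \<open>Information measures of discrete random variables, in bits\<close>

text \<open>
  Random variables are functions on a probability space given by a pmf. All value types used below
  are countable and all pmfs have finite support. The alphabets passed to the
  library functions are whole types: a letter of probability zero does not contribute.
\<close>

definition ent :: "'w pmf \<Rightarrow> ('w \<Rightarrow> 'a) \<Rightarrow> real"  (\<open>H[_]'(_')\<close>) where
  "H[p](A) = prob_space.entropy (measure_pmf p) 2 (count_space UNIV) A"

definition mut_inf :: "'w pmf \<Rightarrow> ('w \<Rightarrow> 'a) \<Rightarrow> ('w \<Rightarrow> 'b) \<Rightarrow> real"  (\<open>I[_]'(_ ; _')\<close>) where
  "I[p](A ; B) =
     prob_space.mutual_information (measure_pmf p) 2 (count_space UNIV) (count_space UNIV) A B"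

definition cond_mut_inf :: "'w pmf \<Rightarrow> ('w \<Rightarrow> 'a) \<Rightarrow> ('w \<Rightarrow> 'b) \<Rightarrow> ('w \<Rightarrow> 'c) \<Rightarrow> real"
    (\<open>I[_]'(_ ; _ | _')\<close>) where
  "I[p](A ; B | C) =
     prob_space.conditional_mutual_information (measure_pmf p) 2
       (count_space UNIV) (count_space UNIV) (count_space UNIV) A B C"


section \<open>The compound model\<close>

text \<open>
  The alphabets are arbitrary finite types; in particular their letters may be vectors. The
  state sets are the types \<open>'k\<close> and \<open>'l\<close>, finite and nonempty. The alphabet of the decoder's
  observation may depend on the state \<open>k\<close>: \<open>'y\<close> is the union of these alphabets, and \<open>P_Y M k x\<close>
  gives probability zero to the letters that do not occur in state \<open>k\<close>. The same holds for \<open>'z\<close>.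

  \<open>P_Y M k\<close> and \<open>P_Z M l\<close> are the marginals of the kernels \<open>P_YZ M k l\<close>. That they are marginals
  for all pairs \<open>(k, l)\<close> says that the law of the decoder's observation depends only on \<open>k\<close>, and
  the law of the eavesdropper's observation only on \<open>l\<close>.
\<close>

record ('x, 'xt, 'y, 'z, 'k, 'l) compound_model =
  P_X  :: "'x pmf"
  P_Xt :: "'x \<Rightarrow> 'xt pmf"
  P_YZ :: "'k \<Rightarrow> 'l \<Rightarrow> 'x \<Rightarrow> ('y \<times> 'z) pmf"
  P_Y  :: "'k \<Rightarrow> 'x \<Rightarrow> 'y pmf"
  P_Z  :: "'l \<Rightarrow> 'x \<Rightarrow> 'z pmf"

definition compound_source :: "('x, 'xt, 'y, 'z, 'k, 'l) compound_model \<Rightarrow> bool" where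
  "compound_source M \<longleftrightarrow>
     (\<forall>k l x. map_pmf fst (P_YZ M k l x) = P_Y M k x \<and> map_pmf snd (P_YZ M k l x) = P_Z M l x)"

definition letter_law ::
  "('x, 'xt, 'y, 'z, 'k, 'l) compound_model \<Rightarrow> 'k \<Rightarrow> 'l \<Rightarrow> ('xt \<times> 'x \<times> 'y \<times> 'z) pmf" where
  "letter_law M k l = do {
     x \<leftarrow> P_X M;
     xt \<leftarrow> P_Xt M x;
     (y, z) \<leftarrow> P_YZ M k l x;
     return_pmf (xt, x, y, z)
   }"

definition seq_law ::
  "('x, 'xt, 'y, 'z, 'k, 'l) compound_model \<Rightarrow> nat \<Rightarrow> 'k \<Rightarrow> 'l
     \<Rightarrow> ('xt list \<times> 'x list \<times> 'y list \<times> 'z list) pmf" where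
  "seq_law M n k l =
     map_pmf (\<lambda>w. (map (\<lambda>(xt, x, y, z). xt) w, map (\<lambda>(xt, x, y, z). x) w,
                   map (\<lambda>(xt, x, y, z). y) w, map (\<lambda>(xt, x, y, z). z) w))
       (replicate_pmf n (letter_law M k l))"


section \<open>Strategies\<close>

text \<open>The set \<open>[1 : 2\<^sup>n\<^sup>R]\<close>, where \<open>[a : b]\<close> is the set of naturals from \<open>\<lfloor>a\<rfloor>\<close> to \<open>\<lceil>b\<rceil>\<close>.\<close>

definition idx_set :: "nat \<Rightarrow> real \<Rightarrow> nat set" where
  "idx_set n R = {1..nat \<lceil>2 powr (real n * R)\<rceil>}"

definition gs_encoder :: "nat \<Rightarrow> real \<Rightarrow> real \<Rightarrow> ('xt list \<Rightarrow> nat \<times> nat) \<Rightarrow> bool" where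
  "gs_encoder n R_S R_J e \<longleftrightarrow> (\<forall>xt. length xt = n \<longrightarrow> e xt \<in> idx_set n R_J \<times> idx_set n R_S)"

definition cs_encoder :: "nat \<Rightarrow> real \<Rightarrow> real \<Rightarrow> ('xt list \<times> nat \<Rightarrow> nat) \<Rightarrow> bool" where
  "cs_encoder n R_S R_J e \<longleftrightarrow>
     (\<forall>xt s. length xt = n \<longrightarrow> s \<in> idx_set n R_S \<longrightarrow> e (xt, s) \<in> idx_set n R_J)"

definition key_decoder :: "nat \<Rightarrow> real \<Rightarrow> real \<Rightarrow> ('y list \<times> nat \<Rightarrow> nat) \<Rightarrow> bool" where
  "key_decoder n R_S R_J d \<longleftrightarrow>
     (\<forall>y j. length y = n \<longrightarrow> j \<in> idx_set n R_J \<longrightarrow> d (y, j) \<in> idx_set n R_S)"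

text \<open>
  The joint law of the key \<open>S\<close>, its estimate \<open>S'\<^sub>k\<close>, the helper data \<open>J\<close>, and the sequences
  \<open>X\<^sup>n\<close> and \<open>Z\<^sub>l\<^sup>n\<close> in state \<open>(k, l)\<close>.
\<close>

type_synonym ('x, 'z) code_outcome = "nat \<times> nat \<times> nat \<times> 'x list \<times> 'z list"

definition gs_law ::
  "('x, 'xt, 'y, 'z, 'k, 'l) compound_model \<Rightarrow> nat \<Rightarrow> ('xt list \<Rightarrow> nat \<times> nat)
     \<Rightarrow> ('y list \<times> nat \<Rightarrow> nat) \<Rightarrow> 'k \<Rightarrow> 'l \<Rightarrow> ('x, 'z) code_outcome pmf" where
  "gs_law M n e d k l = do {
     (xt, x, y, z) \<leftarrow> seq_law M n k l;
     let (j, s) = e xt;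
     return_pmf (s, d (y, j), j, x, z)
   }"

definition cs_law ::
  "('x, 'xt, 'y, 'z, 'k, 'l) compound_model \<Rightarrow> nat \<Rightarrow> real \<Rightarrow> ('xt list \<times> nat \<Rightarrow> nat)
     \<Rightarrow> ('y list \<times> nat \<Rightarrow> nat) \<Rightarrow> 'k \<Rightarrow> 'l \<Rightarrow> ('x, 'z) code_outcome pmf" where
  "cs_law M n R_S e d k l = do {
     s \<leftarrow> pmf_of_set (idx_set n R_S);
     (xt, x, y, z) \<leftarrow> seq_law M n k l;
     let j = e (xt, s);
     return_pmf (s, d (y, j), j, x, z)
   }"

definition key :: "('x, 'z) code_outcome \<Rightarrow> nat" where
  "key = (\<lambda>(s, s', j, x, z). s)"

definition key_est :: "('x, 'z) code_outcome \<Rightarrow> nat" where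
  "key_est = (\<lambda>(s, s', j, x, z). s')"

definition helper :: "('x, 'z) code_outcome \<Rightarrow> nat" where
  "helper = (\<lambda>(s, s', j, x, z). j)"

definition src_seq :: "('x, 'z) code_outcome \<Rightarrow> 'x list" where
  "src_seq = (\<lambda>(s, s', j, x, z). x)"

definition eve_seq :: "('x, 'z) code_outcome \<Rightarrow> 'z list" where
  "eve_seq = (\<lambda>(s, s', j, x, z). z)"


section \<open>Achievability and capacity regions\<close>

text \<open>
  A bound on a maximum over the states is stated as the same bound in every state. The law of
  \<open>(S, S'\<^sub>k)\<close> does not depend on \<open>l\<close>, the law of \<open>(S, J, X\<^sup>n, Z\<^sub>l\<^sup>n)\<close> does not
  depend on \<open>k\<close>, and the law of \<open>S\<close> depends on neither.
\<close>

definition gs_code_ok ::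
  "('x, 'xt, 'y, 'z, 'k, 'l) compound_model \<Rightarrow> nat \<Rightarrow> real \<Rightarrow> real \<times> real \<times> real
     \<Rightarrow> ('xt list \<Rightarrow> nat \<times> nat) \<Rightarrow> ('y list \<times> nat \<Rightarrow> nat) \<Rightarrow> bool" where
  "gs_code_ok M n \<delta> = (\<lambda>(R_S, R_J, R_L) e d.
     gs_encoder n R_S R_J e \<and> key_decoder n R_S R_J d \<and>
     (\<forall>k l. let P = gs_law M n e d k l in
        measure_pmf.prob P {\<omega>. key_est \<omega> \<noteq> key \<omega>} \<le> \<delta> \<and>
        H[P](key) + real n * \<delta> \<ge> log 2 (card (idx_set n R_S)) \<and>
        log 2 (card (idx_set n R_S)) \<ge> real n * (R_S - \<delta>) \<and>
        log 2 (card (idx_set n R_J)) \<le> real n * (R_J + \<delta>) \<and>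
        I[P](key ; (\<lambda>\<omega>. (helper \<omega>, eve_seq \<omega>))) \<le> real n * \<delta> \<and>
        I[P](src_seq ; helper | eve_seq) \<le> real n * (R_L + \<delta>)))"

definition cs_code_ok ::
  "('x, 'xt, 'y, 'z, 'k, 'l) compound_model \<Rightarrow> nat \<Rightarrow> real \<Rightarrow> real \<times> real \<times> real
     \<Rightarrow> ('xt list \<times> nat \<Rightarrow> nat) \<Rightarrow> ('y list \<times> nat \<Rightarrow> nat) \<Rightarrow> bool" where
  "cs_code_ok M n \<delta> = (\<lambda>(R_S, R_J, R_L) e d.
     cs_encoder n R_S R_J e \<and> key_decoder n R_S R_J d \<and>
     (\<forall>k l. let P = cs_law M n R_S e d k l in
        measure_pmf.prob P {\<omega>. key_est \<omega> \<noteq> key \<omega>} \<le> \<delta> \<and>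
        log 2 (card (idx_set n R_S)) \<ge> real n * (R_S - \<delta>) \<and>
        log 2 (card (idx_set n R_J)) \<le> real n * (R_J + \<delta>) \<and>
        I[P](key ; (\<lambda>\<omega>. (helper \<omega>, eve_seq \<omega>))) \<le> real n * \<delta> \<and>
        I[P](src_seq ; helper | eve_seq) \<le> real n * (R_L + \<delta>)))"

definition rate_triples :: "(real \<times> real \<times> real) set" where
  "rate_triples = {(R_S, R_J, R_L). 0 \<le> R_S \<and> 0 \<le> R_J \<and> 0 \<le> R_L}"

definition gs_capacity_region ::
  "('x, 'xt, 'y, 'z, 'k, 'l) compound_model \<Rightarrow> (real \<times> real \<times> real) set" where
  "gs_capacity_region M = closure {R \<in> rate_triples.
     \<forall>\<^sub>F \<delta> in at_right 0. \<forall>\<^sub>F n in sequentially. \<exists>e d. gs_code_ok M n \<delta> R e d}"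

definition cs_capacity_region ::
  "('x, 'xt, 'y, 'z, 'k, 'l) compound_model \<Rightarrow> (real \<times> real \<times> real) set" where
  "cs_capacity_region M = closure {R \<in> rate_triples.
     \<forall>\<^sub>F \<delta> in at_right 0. \<forall>\<^sub>F n in sequentially. \<exists>e d. cs_code_ok M n \<delta> R e d}"


section \<open>Auxiliary random variables\<close>

text \<open>
  The alphabets of \<open>V\<close> and \<open>U\<close> are finite sets of naturals, which is no restriction on
  finite alphabets. \<open>PV u\<close> matters only for letters \<open>u\<close> of \<open>U\<close>.
\<close>

definition aux_kernels :: "nat \<Rightarrow> nat \<Rightarrow> (nat \<Rightarrow> nat pmf) \<Rightarrow> ('xt \<Rightarrow> nat pmf) \<Rightarrow> bool" where
  "aux_kernels cV cU PV PU \<longleftrightarrow>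
     (\<exists>\<V> \<U>. finite \<V> \<and> card \<V> \<le> cV \<and> finite \<U> \<and> card \<U> \<le> cU \<and>
        (\<forall>xt. set_pmf (PU xt) \<subseteq> \<U>) \<and> (\<forall>u\<in>\<U>. set_pmf (PV u) \<subseteq> \<V>))"

text \<open>
  The joint law of \<open>(V, U, Xt, X, O)\<close> with the Markov chain \<open>V - U - Xt - X - O\<close>, where
  \<open>O\<close> is the output of the channel \<open>Q\<close> and stands for \<open>Y\<^sub>k\<close> or \<open>Z\<^sub>l\<close>.
\<close>

definition aux_law ::
  "('x, 'xt, 'y, 'z, 'k, 'l) compound_model \<Rightarrow> (nat \<Rightarrow> nat pmf) \<Rightarrow> ('xt \<Rightarrow> nat pmf)
     \<Rightarrow> ('x \<Rightarrow> 'o pmf) \<Rightarrow> (nat \<times> nat \<times> 'xt \<times> 'x \<times> 'o) pmf" where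
  "aux_law M PV PU Q = do {
     x \<leftarrow> P_X M;
     xt \<leftarrow> P_Xt M x;
     u \<leftarrow> PU xt;
     v \<leftarrow> PV u;
     ob \<leftarrow> Q x;
     return_pmf (v, u, xt, x, ob)
   }"

definition rv_V :: "nat \<times> nat \<times> 'xt \<times> 'x \<times> 'o \<Rightarrow> nat" where
  "rv_V = (\<lambda>(v, u, xt, x, ob). v)"

definition rv_U :: "nat \<times> nat \<times> 'xt \<times> 'x \<times> 'o \<Rightarrow> nat" where
  "rv_U = (\<lambda>(v, u, xt, x, ob). u)"

definition rv_Xt :: "nat \<times> nat \<times> 'xt \<times> 'x \<times> 'o \<Rightarrow> 'xt" where
  "rv_Xt = (\<lambda>(v, u, xt, x, ob). xt)"

definition rv_X :: "nat \<times> nat \<times> 'xt \<times> 'x \<times> 'o \<Rightarrow> 'x" where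
  "rv_X = (\<lambda>(v, u, xt, x, ob). x)"

definition rv_O :: "nat \<times> nat \<times> 'xt \<times> 'x \<times> 'o \<Rightarrow> 'o" where
  "rv_O = (\<lambda>(v, u, xt, x, ob). ob)"


section \<open>The rate bounds\<close>

definition key_rate ::
  "('x, 'xt, 'y, 'z, 'k::finite, 'l::finite) compound_model \<Rightarrow> (nat \<Rightarrow> nat pmf)
     \<Rightarrow> ('xt \<Rightarrow> nat pmf) \<Rightarrow> real" where
  "key_rate M PV PU =
     (MIN k. I[aux_law M PV PU (P_Y M k)](rv_O ; rv_U | rv_V)) -
     (MAX l. I[aux_law M PV PU (P_Z M l)](rv_O ; rv_U | rv_V))"

definition helper_rate ::
  "('x, 'xt, 'y, 'z, 'k::finite, 'l::finite) compound_model \<Rightarrow> (nat \<Rightarrow> nat pmf)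
     \<Rightarrow> ('xt \<Rightarrow> nat pmf) \<Rightarrow> real" where
  "helper_rate M PV PU =
     (MAX k. I[aux_law M PV PU (P_Y M k)](rv_Xt ; rv_U | (\<lambda>\<omega>. (rv_V \<omega>, rv_O \<omega>)))) +
     (MAX k. I[aux_law M PV PU (P_Y M k)](rv_Xt ; rv_V | rv_O))"

text \<open>\<open>I(Xt; U | X)\<close> involves no channel output, so a constant one is used.\<close>

definition leakage_rate ::
  "('x, 'xt, 'y, 'z, 'k::finite, 'l::finite) compound_model \<Rightarrow> (nat \<Rightarrow> nat pmf)
     \<Rightarrow> ('xt \<Rightarrow> nat pmf) \<Rightarrow> real" where
  "leakage_rate M PV PU =
     helper_rate M PV PU -
     I[aux_law M PV PU (\<lambda>x. return_pmf ())](rv_Xt ; rv_U | rv_X) +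
     (MIN k. I[aux_law M PV PU (P_Y M k)](rv_O ; rv_V)) -
     (MIN l. I[aux_law M PV PU (P_Z M l)](rv_O ; rv_V))"

end

theory Submission
  imports Defs
begin

text \<open>
  The auxiliary variables are not functions of the encoder's observation, so the proof has two levels.
  On blocks of \<open>m\<close> letters, a superposition covering code assigns to \<open>Xt\<^sup>m\<close> the index \<open>A\<close> of a
  \<open>V\<close>-codeword and the index \<open>B\<close> (which includes \<open>A\<close>) of a \<open>U\<close>-codeword, jointly typical with
  \<open>Xt\<^sup>m\<close>. Bounds on the numbers of codewords and cross entropies along them give
  \<open>H(A | O\<^sup>m) = m I(Xt; V | O)\<close> and \<open>H(B | O\<^sup>m) = m I(Xt; U, V | O)\<close> up to \<open>m \<epsilon>\<close>, for \<open>O\<close> each of \<open>Y\<^sub>k\<close>,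
  \<open>Z\<^sub>l\<close> and \<open>(X, Z\<^sub>l)\<close>.

  Over \<open>N\<close> independent blocks, \<open>A\<^sup>N\<close> and \<open>B\<^sup>N\<close> are functions of the observation with independent letters.
  The helper data are hashes of \<open>A\<^sup>N\<close> and of \<open>B\<^sup>N\<close>, just long enough for a decoder that looks for a
  sequence typical in some state; the key is a further hash of \<open>B\<^sup>N\<close>. Secrecy and the
  leakage bound follow from Fano's inequality: the key, the helper data and few further hash bits
  determine \<open>B\<^sup>N\<close> for the eavesdropper, and \<open>X\<^sup>n\<close> and the helper data determine it too.
  In the chosen-secret model the generated key serves as a one-time pad. Passing to the closure
  provides the slack in the rate of the helper data.
\<close>


section \<open>Entropies of finitely supported random variables\<close>

text \<open>A codeword is typical with \<open>Xt\<^sup>m\<close> by construction, but not with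
  \<open>Y\<^sub>k\<close>, \<open>Z\<^sub>l\<close> or \<open>X\<close>, which the encoder does not
  see. What survives is an average: given \<open>Xt\<^sup>m\<close>, the mean cost of describing an
  observation along the codeword is a sum of letter functions of the codeword and
  \<open>Xt\<^sup>m\<close>, and typicality controls such sums. So the block code is analysed by
  cross entropies in expectation, not by joint typicality with the observations. The covering uses
  only the joint law with \<open>Xt\<close>, which is the same in all states; one encoder serves
  them all. The hashes are sized for the decoders \<open>Y\<^sub>k\<close>, yet the leakage bound
  needs them to suffice for \<open>(X, Z\<^sub>l)\<close>. They do, because
  \<open>(X, Z\<^sub>l)\<close> is worth as much as \<open>(X, Y\<^sub>k)\<close> for
  \<open>V\<close> and \<open>U\<close>. Comparing \<open>Y\<^sub>k\<close> with
  \<open>Z\<^sub>l\<close> rests on \<open>I(Xt; V | O) + I(O; V) = I(Xt; V)\<close> and its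
  analogue for \<open>U\<close> given \<open>V\<close>; the right sides are free of the state, which
  turns the minima and maxima of the rate bounds into inequalities in each state.\<close>

text \<open>
  The entropy of \<open>A\<close> depends only on the level sets of \<open>A\<close>, so that values of any type are admitted
  and tuples can be rearranged at will.
\<close>

definition sh :: "'w pmf \<Rightarrow> ('w \<Rightarrow> 'a) \<Rightarrow> real" where
  "sh p A = measure_pmf.expectation p (\<lambda>\<omega>. - log 2 (measure_pmf.prob p {\<omega>'. A \<omega>' = A \<omega>}))"

text \<open>The chain rule is taken as the definition of conditional entropy. Relations between
  information quantities then unfold to linear arithmetic over joint entropies.\<close>

definition shc :: "'w pmf \<Rightarrow> ('w \<Rightarrow> 'a) \<Rightarrow> ('w \<Rightarrow> 'c) \<Rightarrow> real" where
  "shc p A C = sh p (\<lambda>\<omega>. (A \<omega>, C \<omega>)) - sh p C"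

text \<open>\<open>A\<close> is a function of \<open>B\<close> on the support. As an inclusion of
  kernels the relation needs no witness function.\<close>

definition det_by :: "'w pmf \<Rightarrow> ('w \<Rightarrow> 'a) \<Rightarrow> ('w \<Rightarrow> 'b) \<Rightarrow> bool" where
  "det_by p A B \<longleftrightarrow> (\<forall>\<omega>\<in>set_pmf p. \<forall>\<omega>'\<in>set_pmf p. B \<omega> = B \<omega>' \<longrightarrow> A \<omega> = A \<omega>')"

lemma prob_level_pos:
  assumes "\<omega> \<in> set_pmf p"
  shows "measure_pmf.prob p {\<omega>'. A \<omega>' = A \<omega>} > 0"
proof -
  have "0 < pmf p \<omega>" using assms by (simp add: pmf_positive)
  also have "\<dots> = measure_pmf.prob p {\<omega>}" by (simp add: measure_pmf_single)
  also have "\<dots> \<le> measure_pmf.prob p {\<omega>'. A \<omega>' = A \<omega>}"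
    by (rule measure_pmf.finite_measure_mono) auto
  finally show ?thesis .
qed

lemma prob_mono_supp:
  assumes "\<And>\<omega>. \<omega> \<in> set_pmf p \<Longrightarrow> \<omega> \<in> S \<Longrightarrow> \<omega> \<in> T"
  shows "measure_pmf.prob p S \<le> measure_pmf.prob p T"
proof -
  have "measure_pmf.prob p S = measure_pmf.prob p (S \<inter> set_pmf p)" by (simp add: measure_Int_set_pmf)
  also have "\<dots> \<le> measure_pmf.prob p T" by (rule measure_pmf.finite_measure_mono) (use assms in auto)
  finally show ?thesis .
qed

lemma expectation_mono_supp:
  assumes "finite (set_pmf p)" "\<And>\<omega>. \<omega> \<in> set_pmf p \<Longrightarrow> f \<omega> \<le> (g \<omega> :: real)"
  shows "measure_pmf.expectation p f \<le> measure_pmf.expectation p g"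
proof (rule integral_mono_AE)
  show "AE \<omega> in measure_pmf p. f \<omega> \<le> g \<omega>" unfolding AE_measure_pmf_iff using assms(2) by blast
qed (rule integrable_measure_pmf_finite[OF assms(1)])+

lemma expectation_cong_supp:
  assumes "\<And>\<omega>. \<omega> \<in> set_pmf p \<Longrightarrow> f \<omega> = (g \<omega> :: real)"
  shows "measure_pmf.expectation p f = measure_pmf.expectation p g"
proof (rule integral_cong_AE)
  show "AE \<omega> in measure_pmf p. f \<omega> = g \<omega>" unfolding AE_measure_pmf_iff using assms by blast
qed simp_all

text \<open>Up to null outcomes a level set of \<open>B\<close> lies within a level set of
  \<open>A\<close>, so the surprisal of \<open>B\<close> dominates pointwise.\<close>

lemma sh_mono:
  assumes "finite (set_pmf p)" "det_by p A B"
  shows "sh p A \<le> sh p B"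
  unfolding sh_def
proof (rule expectation_mono_supp[OF assms(1)])
  fix \<omega> assume w: "\<omega> \<in> set_pmf p"
  have "measure_pmf.prob p {\<omega>'. B \<omega>' = B \<omega>} \<le> measure_pmf.prob p {\<omega>'. A \<omega>' = A \<omega>}"
    by (rule prob_mono_supp) (use assms(2) w in \<open>unfold det_by_def mem_Collect_eq, blast\<close>)
  then show "- log 2 (measure_pmf.prob p {\<omega>'. A \<omega>' = A \<omega>}) \<le> - log 2 (measure_pmf.prob p {\<omega>'. B \<omega>' = B \<omega>})"
    using prob_level_pos[OF w, of B] by simp
qed

lemma sh_eq:
  assumes "finite (set_pmf p)" "det_by p A B" "det_by p B A"
  shows "sh p A = sh p B"
  by (rule antisym) (rule sh_mono; fact)+

lemma shc_eq:
  assumes "finite (set_pmf p)" "det_by p A (\<lambda>\<omega>. (B \<omega>, C \<omega>))" "det_by p B (\<lambda>\<omega>. (A \<omega>, D \<omega>))"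
     "det_by p C D" "det_by p D C"
  shows "shc p A C = shc p B D"
proof -
  have "sh p (\<lambda>\<omega>. (A \<omega>, C \<omega>)) = sh p (\<lambda>\<omega>. (B \<omega>, D \<omega>))"
    by (rule sh_eq[OF assms(1)]) (use assms(2-5) in \<open>unfold det_by_def prod.inject, blast+\<close>)
  moreover have "sh p C = sh p D" by (rule sh_eq) fact+
  ultimately show ?thesis by (simp add: shc_def)
qed

lemma sh_map: "sh (map_pmf f p) A = sh p (\<lambda>\<omega>. A (f \<omega>))"
  unfolding sh_def by (simp add: vimage_def)

lemma shc_map: "shc (map_pmf f p) A C = shc p (\<lambda>\<omega>. A (f \<omega>)) (\<lambda>\<omega>. C (f \<omega>))"
  unfolding shc_def by (simp add: sh_map)

lemma sh_const: "sh p (\<lambda>\<omega>. c) = 0"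
  unfolding sh_def by simp

lemma shc_const: "finite (set_pmf p) \<Longrightarrow> shc p A (\<lambda>\<omega>. c) = sh p A"
  unfolding shc_def by (simp add: sh_const) (rule sh_eq, auto simp: det_by_def)

text \<open>Dividing by the probability of the level turns the law of \<open>A\<close> into counting
  measure on its attained values. Gibbs' inequality, Markov's inequality and conditional means all
  reduce to sums of this form.\<close>

lemma expectation_sum_level:
  assumes fin: "finite (set_pmf p)"
  shows "measure_pmf.expectation p (\<lambda>\<omega>. f (A \<omega>) / measure_pmf.prob p {\<omega>'. A \<omega>' = A \<omega>})
           = (\<Sum>a\<in>A ` set_pmf p. f a :: real)"
proof -
  have "measure_pmf.expectation p (\<lambda>\<omega>. f (A \<omega>) / measure_pmf.prob p {\<omega>'. A \<omega>' = A \<omega>})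
      = (\<Sum>\<omega>\<in>set_pmf p. pmf p \<omega> * (f (A \<omega>) / measure_pmf.prob p {\<omega>'. A \<omega>' = A \<omega>}))"
    by (subst integral_measure_pmf[OF fin]) (auto simp: mult.commute)
  also have "\<dots> = (\<Sum>a\<in>A ` set_pmf p. \<Sum>\<omega>\<in>{\<omega>\<in>set_pmf p. A \<omega> = a}. pmf p \<omega> * (f (A \<omega>) / measure_pmf.prob p {\<omega>'. A \<omega>' = A \<omega>}))"
    by (rule sum.image_gen[OF fin])
  also have "\<dots> = (\<Sum>a\<in>A ` set_pmf p. f a)"
  proof (rule sum.cong[OF refl])
    fix a assume "a \<in> A ` set_pmf p"
    then obtain w where w: "w \<in> set_pmf p" "a = A w" by auto
    have pos: "measure_pmf.prob p {\<omega>'. A \<omega>' = a} > 0" using prob_level_pos[OF w(1), of A] w by simp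
    have "measure_pmf.prob p {\<omega>'. A \<omega>' = a} = measure_pmf.prob p ({\<omega>'. A \<omega>' = a} \<inter> set_pmf p)"
      by (simp add: measure_Int_set_pmf)
    also have "{\<omega>'. A \<omega>' = a} \<inter> set_pmf p = {\<omega>\<in>set_pmf p. A \<omega> = a}" by auto
    also have "measure_pmf.prob p \<dots> = (\<Sum>\<omega>\<in>{\<omega>\<in>set_pmf p. A \<omega> = a}. pmf p \<omega>)"
      by (rule measure_measure_pmf_finite) (use fin in auto)
    finally have e: "(\<Sum>\<omega>\<in>{\<omega>\<in>set_pmf p. A \<omega> = a}. pmf p \<omega>) = measure_pmf.prob p {\<omega>'. A \<omega>' = a}" by simp
    have "(\<Sum>\<omega>\<in>{\<omega>\<in>set_pmf p. A \<omega> = a}. pmf p \<omega> * (f (A \<omega>) / measure_pmf.prob p {\<omega>'. A \<omega>' = A \<omega>}))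
        = (\<Sum>\<omega>\<in>{\<omega>\<in>set_pmf p. A \<omega> = a}. pmf p \<omega>) * (f a / measure_pmf.prob p {\<omega>'. A \<omega>' = a})"
      unfolding sum_distrib_right by (rule sum.cong) auto
    also have "\<dots> = f a" using pos unfolding e by simp
    finally show "(\<Sum>\<omega>\<in>{\<omega>\<in>set_pmf p. A \<omega> = a}. pmf p \<omega> * (f (A \<omega>) / measure_pmf.prob p {\<omega>'. A \<omega>' = A \<omega>})) = f a" .
  qed
  finally show ?thesis .
qed

lemma shc_expectation:
  assumes fin: "finite (set_pmf p)"
  shows "shc p A C = measure_pmf.expectation p (\<lambda>\<omega>. - log 2 (measure_pmf.prob p {\<omega>'. A \<omega>' = A \<omega> \<and> C \<omega>' = C \<omega>} / measure_pmf.prob p {\<omega>'. C \<omega>' = C \<omega>}))"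
proof -
  have "shc p A C = measure_pmf.expectation p (\<lambda>\<omega>. - log 2 (measure_pmf.prob p {\<omega>'. A \<omega>' = A \<omega> \<and> C \<omega>' = C \<omega>}) - (- log 2 (measure_pmf.prob p {\<omega>'. C \<omega>' = C \<omega>})))"
    unfolding shc_def sh_def
    by (subst Bochner_Integration.integral_diff) (auto simp: integrable_measure_pmf_finite fin)
  also have "\<dots> = measure_pmf.expectation p (\<lambda>\<omega>. - log 2 (measure_pmf.prob p {\<omega>'. A \<omega>' = A \<omega> \<and> C \<omega>' = C \<omega>} / measure_pmf.prob p {\<omega>'. C \<omega>' = C \<omega>}))"
  proof (rule expectation_cong_supp)
    fix \<omega> assume w: "\<omega> \<in> set_pmf p"
    have a: "measure_pmf.prob p {\<omega>'. A \<omega>' = A \<omega> \<and> C \<omega>' = C \<omega>} > 0"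
      using prob_level_pos[OF w, of "\<lambda>\<omega>. (A \<omega>, C \<omega>)"] by simp
    show "- log 2 (measure_pmf.prob p {\<omega>'. A \<omega>' = A \<omega> \<and> C \<omega>' = C \<omega>}) - (- log 2 (measure_pmf.prob p {\<omega>'. C \<omega>' = C \<omega>})) =
       - log 2 (measure_pmf.prob p {\<omega>'. A \<omega>' = A \<omega> \<and> C \<omega>' = C \<omega>} / measure_pmf.prob p {\<omega>'. C \<omega>' = C \<omega>})"
      using a prob_level_pos[OF w, of C] by (simp add: log_divide)
  qed
  finally show ?thesis .
qed

text \<open>All upper bounds on conditional entropies are instances of this one, for a suitable kernel \<open>q\<close>.\<close>

lemma shc_le_cross_entropy:
  assumes fin: "finite (set_pmf p)"
    and pos: "\<And>\<omega>. \<omega> \<in> set_pmf p \<Longrightarrow> 0 < q (A \<omega>) (C \<omega>)"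
    and nonneg: "\<And>a c. 0 \<le> q a c"
    and sub: "\<And>c. c \<in> C ` set_pmf p \<Longrightarrow> (\<Sum>a\<in>A ` set_pmf p. q a c) \<le> (1::real)"
  shows "shc p A C \<le> measure_pmf.expectation p (\<lambda>\<omega>. - log 2 (q (A \<omega>) (C \<omega>)))"
proof -
  define P2 where "P2 = (\<lambda>\<omega>. measure_pmf.prob p {\<omega>'. (A \<omega>', C \<omega>') = (A \<omega>, C \<omega>)})"
  define P1 where "P1 = (\<lambda>c. measure_pmf.prob p {\<omega>'. C \<omega>' = c})"
  \<comment> \<open>The ratio of the comparison kernel to the true conditional probability of
    \<open>A\<close> given \<open>C\<close>. Gibbs' inequality is \<open>ln r \<le> r - 1\<close>
    averaged, so it remains to see that \<open>r\<close> has mean at most 1.\<close>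
  define r where "r = (\<lambda>\<omega>. q (A \<omega>) (C \<omega>) * P1 (C \<omega>) / P2 \<omega>)"
  have int: "integrable (measure_pmf p) (f :: _ \<Rightarrow> real)" for f
    using fin by (rule integrable_measure_pmf_finite)
  have P2pos: "P2 \<omega> > 0" if "\<omega> \<in> set_pmf p" for \<omega>
    unfolding P2_def using prob_level_pos[OF that, of "\<lambda>\<omega>. (A \<omega>, C \<omega>)"] by simp
  have P1pos: "P1 (C \<omega>) > 0" if "\<omega> \<in> set_pmf p" for \<omega>
    unfolding P1_def using prob_level_pos[OF that, of C] by simp
  have "shc p A C - measure_pmf.expectation p (\<lambda>\<omega>. - log 2 (q (A \<omega>) (C \<omega>)))
      = measure_pmf.expectation p (\<lambda>\<omega>. - log 2 (P2 \<omega>) - (- log 2 (P1 (C \<omega>))) - (- log 2 (q (A \<omega>) (C \<omega>))))"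
    unfolding shc_def sh_def P2_def P1_def by (simp only: Bochner_Integration.integral_diff[OF int int])
  also have "\<dots> \<le> measure_pmf.expectation p (\<lambda>\<omega>. (r \<omega> - 1) / ln 2)"
  proof (rule expectation_mono_supp[OF fin])
    fix \<omega> assume w: "\<omega> \<in> set_pmf p"
    have rpos: "r \<omega> > 0" unfolding r_def using P2pos[OF w] P1pos[OF w] pos[OF w] by simp
    have "- log 2 (P2 \<omega>) - (- log 2 (P1 (C \<omega>))) - (- log 2 (q (A \<omega>) (C \<omega>))) = log 2 (r \<omega>)"
      unfolding r_def using P2pos[OF w] P1pos[OF w] pos[OF w] by (simp add: log_divide log_mult)
    also have "\<dots> = ln (r \<omega>) / ln 2" by (simp add: log_def)
    also have "\<dots> \<le> (r \<omega> - 1) / ln 2" using ln_le_minus_one[OF rpos] by (simp add: divide_right_mono)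
    finally show "- log 2 (P2 \<omega>) - (- log 2 (P1 (C \<omega>))) - (- log 2 (q (A \<omega>) (C \<omega>))) \<le> (r \<omega> - 1) / ln 2" .
  qed
  also have "\<dots> = (measure_pmf.expectation p r - 1) / ln 2"
    by (simp add: Bochner_Integration.integral_diff[OF int int])
  also have "\<dots> \<le> 0"
  proof -
    have "measure_pmf.expectation p r = (\<Sum>(a,c)\<in>(\<lambda>\<omega>. (A \<omega>, C \<omega>)) ` set_pmf p. q a c * P1 c)"
      unfolding r_def P2_def
      using expectation_sum_level[OF fin, of "\<lambda>(a,c). q a c * P1 c" "\<lambda>\<omega>. (A \<omega>, C \<omega>)"] by (simp add: case_prod_unfold)
    \<comment> \<open>Passing from the attained pairs to the full rectangle completes the inner sum
      over \<open>a\<close>, so that \<open>sub\<close> applies for each \<open>c\<close>.\<close>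
    also have "\<dots> \<le> (\<Sum>(a,c)\<in>A ` set_pmf p \<times> C ` set_pmf p. q a c * P1 c)"
      by (rule sum_mono2) (use fin nonneg in \<open>auto simp: P1_def\<close>)
    also have "\<dots> = (\<Sum>c\<in>C ` set_pmf p. (\<Sum>a\<in>A ` set_pmf p. q a c) * P1 c)"
      by (subst sum.cartesian_product[symmetric], subst sum.swap) (simp add: sum_distrib_right)
    also have "\<dots> \<le> (\<Sum>c\<in>C ` set_pmf p. 1 * P1 c)"
      by (intro sum_mono mult_right_mono sub) (auto simp: P1_def)
    also have "\<dots> = measure_pmf.expectation p (\<lambda>\<omega>. P1 (C \<omega>) / measure_pmf.prob p {\<omega>'. C \<omega>' = C \<omega>})"
      by (subst expectation_sum_level[OF fin]) simp
    also have "\<dots> = measure_pmf.expectation p (\<lambda>\<omega>. 1)"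
    proof (rule expectation_cong_supp)
      fix \<omega> assume "\<omega> \<in> set_pmf p"
      then show "P1 (C \<omega>) / measure_pmf.prob p {\<omega>'. C \<omega>' = C \<omega>} = 1"
        using P1pos[of \<omega>] by (simp add: P1_def)
    qed
    finally have "measure_pmf.expectation p r \<le> 1" by simp
    then show ?thesis by (simp add: divide_nonpos_nonneg)
  qed
  finally show ?thesis by simp
qed

text \<open>The conditional law of \<open>A\<close> given \<open>B\<close> is an admissible kernel
  for \<open>C\<close>, because \<open>C\<close> determines \<open>B\<close>; its cross entropy is
  the entropy given \<open>B\<close>.\<close>

lemma shc_mono_cond:
  assumes fin: "finite (set_pmf p)" and det: "det_by p B C"
  shows "shc p A C \<le> shc p A B"
proof -
  have bex: "\<exists>b. \<forall>\<omega>\<in>set_pmf p. C \<omega> = c \<longrightarrow> B \<omega> = b" for c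
    using det unfolding det_by_def by metis
  then obtain b where b: "\<And>\<omega>. \<omega> \<in> set_pmf p \<Longrightarrow> B \<omega> = b (C \<omega>)" by metis
  define q where "q = (\<lambda>a c. measure_pmf.prob p {\<omega>'. A \<omega>' = a \<and> B \<omega>' = b c} / measure_pmf.prob p {\<omega>'. B \<omega>' = b c})"
  have "shc p A C \<le> measure_pmf.expectation p (\<lambda>\<omega>. - log 2 (q (A \<omega>) (C \<omega>)))"
  proof (rule shc_le_cross_entropy[OF fin])
    fix \<omega> assume w: "\<omega> \<in> set_pmf p"
    show "0 < q (A \<omega>) (C \<omega>)" unfolding q_def b[OF w, symmetric]
      using prob_level_pos[OF w, of "\<lambda>\<omega>. (A \<omega>, B \<omega>)"] prob_level_pos[OF w, of B] by simp
  next
    fix c assume "c \<in> C ` set_pmf p"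
    have "(\<Sum>a\<in>A ` set_pmf p. measure_pmf.prob p {\<omega>'. A \<omega>' = a \<and> B \<omega>' = b c}) =
         measure_pmf.prob p (\<Union>a\<in>A ` set_pmf p. {\<omega>'. A \<omega>' = a \<and> B \<omega>' = b c})"
      by (rule measure_pmf.finite_measure_finite_Union[symmetric]) (use fin in \<open>auto simp: disjoint_family_on_def\<close>)
    also have "\<dots> \<le> measure_pmf.prob p {\<omega>'. B \<omega>' = b c}"
      by (rule measure_pmf.finite_measure_mono) auto
    finally show "(\<Sum>a\<in>A ` set_pmf p. q a c) \<le> 1"
      unfolding q_def sum_divide_distrib[symmetric]
      by (cases "measure_pmf.prob p {\<omega>'. B \<omega>' = b c} = 0") (simp_all add: less_le)
  qed (auto simp: q_def)
  also have "\<dots> = shc p A B"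
    unfolding shc_expectation[OF fin] by (rule expectation_cong_supp) (simp add: q_def b)
  finally show ?thesis .
qed

lemma shc_nonneg: "finite (set_pmf p) \<Longrightarrow> 0 \<le> shc p A C"
  unfolding shc_def by (simp add: sh_mono det_by_def)

lemma shc_le_log_card:
  assumes fin: "finite (set_pmf p)" and S: "finite S" "A ` set_pmf p \<subseteq> S"
  shows "shc p A C \<le> log 2 (card S)"
proof -
  have ne: "S \<noteq> {}" using S(2) set_pmf_not_empty[of p] by auto
  have "shc p A C \<le> measure_pmf.expectation p (\<lambda>\<omega>. - log 2 ((\<lambda>a c. 1 / real (card S)) (A \<omega>) (C \<omega>)))"
  proof (rule shc_le_cross_entropy[OF fin])
    fix c
    have "card (A ` set_pmf p) \<le> card S" by (rule card_mono) (use S in auto)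
    then show "(\<Sum>a\<in>A ` set_pmf p. 1 / real (card S)) \<le> 1"
      using ne S by (simp add: card_gt_0_iff)
  qed (use ne S in \<open>auto simp: card_gt_0_iff\<close>)
  also have "\<dots> = log 2 (card S)" using ne S by (simp add: log_divide)
  finally show ?thesis .
qed

text \<open>The comparison kernel puts half of its mass on the guess \<open>d c\<close> and spreads
  the other half uniformly over \<open>S\<close>: a right guess costs at most one bit, a wrong one
  \<open>1 + log 2 (card S)\<close> bits.\<close>

lemma fano:
  assumes fin: "finite (set_pmf p)" and S: "finite S" "A ` set_pmf p \<subseteq> S"
    and err: "measure_pmf.prob p {\<omega>. d (C \<omega>) \<noteq> A \<omega>} \<le> e"
  shows "shc p A C \<le> 1 + e * log 2 (card S)"
proof -
  have ne: "S \<noteq> {}" using S(2) set_pmf_not_empty[of p] by auto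
  define s where "s = real (card S)"
  have s: "s \<ge> 1" unfolding s_def using ne S(1) by (simp add: Suc_le_eq card_gt_0_iff)
  define q where "q = (\<lambda>a c. (if a = d c then 1/2 else 0) + 1/2 * (1/s))"
  have "shc p A C \<le> measure_pmf.expectation p (\<lambda>\<omega>. - log 2 (q (A \<omega>) (C \<omega>)))"
  proof (rule shc_le_cross_entropy[OF fin])
    fix c
    have "(\<Sum>a\<in>A ` set_pmf p. q a c) \<le> (\<Sum>a\<in>S. q a c)"
      by (rule sum_mono2) (use S s in \<open>auto simp: q_def\<close>)
    also have "\<dots> = (\<Sum>a\<in>S. if a = d c then 1/2 else 0) + 1/2"
      unfolding q_def sum.distrib using s by (simp add: s_def)
    also have "(\<Sum>a\<in>S. if a = d c then 1/2 else 0) \<le> (1/2::real)"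
      using S(1) by simp
    finally show "(\<Sum>a\<in>A ` set_pmf p. q a c) \<le> 1" by simp
  qed (use s in \<open>auto simp: q_def add_pos_pos\<close>)
  also have "\<dots> \<le> measure_pmf.expectation p (\<lambda>\<omega>. 1 + indicat_real {\<omega>. d (C \<omega>) \<noteq> A \<omega>} \<omega> * log 2 s)"
  proof (rule expectation_mono_supp[OF fin])
    fix \<omega>
    show "- log 2 (q (A \<omega>) (C \<omega>)) \<le> 1 + indicat_real {\<omega>. d (C \<omega>) \<noteq> A \<omega>} \<omega> * log 2 s"
    proof (cases "d (C \<omega>) = A \<omega>")
      case True
      have "log 2 (1/2) \<le> log 2 (1/2 + 1/2*(1/s))" using s by (subst log_le_cancel_iff) (auto simp: add_pos_pos)
      moreover have "log 2 (1/2) = - 1" by (simp add: log_divide)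
      ultimately show ?thesis using True by (simp add: q_def)
    next
      case False
      have "log 2 (1/2*(1/s)) = - 1 - log 2 s" using s by (simp add: log_divide log_mult)
      then show ?thesis using False by (simp add: q_def)
    qed
  qed
  also have "\<dots> = 1 + measure_pmf.prob p {\<omega>. d (C \<omega>) \<noteq> A \<omega>} * log 2 s"
    by (subst Bochner_Integration.integral_add) (auto simp: integrable_measure_pmf_finite fin)
  also have "\<dots> \<le> 1 + e * log 2 s"
    using err s by (simp add: mult_right_mono)
  finally show ?thesis by (simp add: s_def)
qed

section \<open>Agreement with the information measures of the library\<close>

lemma measure_pmf_pair:
  fixes a :: "'a::countable pmf" and b :: "'b::countable pmf"
  shows "measure_pmf a \<Otimes>\<^sub>M measure_pmf b = measure_pmf (pair_pmf a b)"
proof (rule measure_eqI_countable[of _ UNIV])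
  show "sets (measure_pmf a \<Otimes>\<^sub>M measure_pmf b) = Pow UNIV"
    using sets_pair_measure_cong[of "measure_pmf a" "count_space UNIV" "measure_pmf b" "count_space UNIV"]
    unfolding pair_measure_countable[OF countableI_type countableI_type] by simp
  fix x :: "'a \<times> 'b"
  obtain u v where x: "x = (u, v)" by force
  have "emeasure (measure_pmf a \<Otimes>\<^sub>M measure_pmf b) ({u} \<times> {v}) = emeasure (measure_pmf a) {u} * emeasure (measure_pmf b) {v}"
    by (rule measure_pmf.emeasure_pair_measure_Times) auto
  then show "emeasure (measure_pmf a \<Otimes>\<^sub>M measure_pmf b) {x} = emeasure (measure_pmf (pair_pmf a b)) {x}"
    by (simp add: x emeasure_pmf_single pmf_pair ennreal_mult)
qed auto

lemma integral_count_space_pmf: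
  "(\<integral>x. pmf q x * f x \<partial>count_space UNIV) = measure_pmf.expectation q (f :: _ \<Rightarrow> real)"
  unfolding measure_pmf_eq_density by (subst integral_density) auto

lemma KL_divergence_pmf:
  fixes a b :: "'a::countable pmf"
  assumes "set_pmf b \<subseteq> set_pmf a"
  shows "KL_divergence 2 (measure_pmf a) (measure_pmf b)
           = measure_pmf.expectation b (\<lambda>x. log 2 (pmf b x / pmf a x))"
proof -
  interpret sigma_finite_measure "count_space (UNIV :: 'a set)"
    by (rule sigma_finite_measure_count_space)
  have "KL_divergence 2 (measure_pmf a) (measure_pmf b) = (\<integral>x. pmf b x * log 2 (pmf b x / pmf a x) \<partial>count_space UNIV)"
    unfolding measure_pmf_eq_density
    by (rule KL_density_density) (use assms in \<open>auto simp: AE_count_space set_pmf_eq\<close>)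
  also have "\<dots> = measure_pmf.expectation b (\<lambda>x. log 2 (pmf b x / pmf a x))"
    by (rule integral_count_space_pmf)
  finally show ?thesis .
qed

lemma pmf_map_eq_prob: "pmf (map_pmf A p) a = measure_pmf.prob p {\<omega>. A \<omega> = a}"
  by (simp add: pmf_map vimage_def)

lemma ent_eq_sh:
  fixes A :: "'w \<Rightarrow> 'a::countable"
  shows "H[p](A) = sh p A"
proof -
  interpret sigma_finite_measure "count_space (UNIV :: 'a set)"
    by (rule sigma_finite_measure_count_space)
  have "H[p](A) = - KL_divergence 2 (count_space UNIV) (measure_pmf (map_pmf A p))"
    unfolding ent_def prob_space.entropy_def[OF measure_pmf.prob_space_axioms] map_pmf_rep_eq ..
  also have "\<dots> = - (\<integral>x. pmf (map_pmf A p) x * log 2 (pmf (map_pmf A p) x) \<partial>count_space UNIV)"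
    unfolding measure_pmf_eq_density by (subst KL_density) auto
  also have "\<dots> = - measure_pmf.expectation (map_pmf A p) (\<lambda>x. log 2 (pmf (map_pmf A p) x))"
    by (simp add: integral_count_space_pmf)
  also have "\<dots> = sh p A"
    unfolding sh_def by (simp add: pmf_map_eq_prob)
  finally show ?thesis .
qed

lemma mut_inf_eq_sh:
  fixes A :: "'w \<Rightarrow> 'a::countable" and B :: "'w \<Rightarrow> 'b::countable"
  assumes fin: "finite (set_pmf p)"
  shows "I[p](A ; B) = sh p A - shc p A B"
proof -
  let ?q = "map_pmf (\<lambda>\<omega>. (A \<omega>, B \<omega>)) p"
  have "I[p](A ; B) = KL_divergence 2 (measure_pmf (pair_pmf (map_pmf A p) (map_pmf B p))) (measure_pmf ?q)"
    unfolding mut_inf_def prob_space.mutual_information_def[OF measure_pmf.prob_space_axioms] map_pmf_rep_eq measure_pmf_pair[symmetric]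
    by (simp add: pair_measure_countable[OF countableI_type countableI_type])
  also have "\<dots> = measure_pmf.expectation ?q (\<lambda>x. log 2 (pmf ?q x / pmf (pair_pmf (map_pmf A p) (map_pmf B p)) x))"
    by (rule KL_divergence_pmf) auto
  also have "\<dots> = measure_pmf.expectation p (\<lambda>\<omega>. - log 2 (measure_pmf.prob p {\<omega>'. A \<omega>' = A \<omega>})
        + - log 2 (measure_pmf.prob p {\<omega>'. B \<omega>' = B \<omega>}) - - log 2 (measure_pmf.prob p {\<omega>'. (A \<omega>', B \<omega>') = (A \<omega>, B \<omega>)}))"
    unfolding integral_map_pmf
  proof (rule expectation_cong_supp)
    fix \<omega> assume w: "\<omega> \<in> set_pmf p"
    show "log 2 (pmf ?q (A \<omega>, B \<omega>) / pmf (pair_pmf (map_pmf A p) (map_pmf B p)) (A \<omega>, B \<omega>)) =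
        - log 2 (measure_pmf.prob p {\<omega>'. A \<omega>' = A \<omega>})
        + - log 2 (measure_pmf.prob p {\<omega>'. B \<omega>' = B \<omega>}) - - log 2 (measure_pmf.prob p {\<omega>'. (A \<omega>', B \<omega>') = (A \<omega>, B \<omega>)})"
      unfolding pmf_pair pmf_map_eq_prob
      using prob_level_pos[OF w, of A] prob_level_pos[OF w, of B] prob_level_pos[OF w, of "\<lambda>\<omega>. (A \<omega>, B \<omega>)"]
      by (simp add: log_divide log_mult)
  qed
  also have "\<dots> = sh p A - shc p A B"
    unfolding shc_def sh_def
    by (simp only: Bochner_Integration.integral_diff Bochner_Integration.integral_add integrable_measure_pmf_finite[OF fin])
  finally show ?thesis .
qed

text \<open>The library sets \<open>I(A; B | C) = I(A; (B, C)) - I(A; C)\<close>, where the entropy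
  of \<open>A\<close> cancels.\<close>

lemma cond_mut_inf_eq_shc:
  fixes A :: "'w \<Rightarrow> 'a::countable" and B :: "'w \<Rightarrow> 'b::countable" and C :: "'w \<Rightarrow> 'c::countable"
  assumes fin: "finite (set_pmf p)"
  shows "I[p](A ; B | C) = shc p A C - shc p A (\<lambda>\<omega>. (B \<omega>, C \<omega>))"
  unfolding cond_mut_inf_def prob_space.conditional_mutual_information_def[OF measure_pmf.prob_space_axioms]
  using mut_inf_eq_sh[OF fin, of A "\<lambda>\<omega>. (B \<omega>, C \<omega>)"] mut_inf_eq_sh[OF fin, of A C]
  by (simp add: mut_inf_def pair_measure_countable[OF countableI_type countableI_type])

section \<open>Sequences of independent letters\<close>

lemma expectation_bind_finite:
  assumes "finite (set_pmf p)" "\<And>x. x \<in> set_pmf p \<Longrightarrow> finite (set_pmf (f x))"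
  shows "measure_pmf.expectation (p \<bind> f) h = measure_pmf.expectation p (\<lambda>x. measure_pmf.expectation (f x) h :: real)"
  by (subst pmf_expectation_bind[OF assms(1) assms(2) subset_refl])
     (auto simp: integral_measure_pmf[OF assms(1)])

lemma finite_set_replicate_pmf: "finite (set_pmf p) \<Longrightarrow> finite (set_pmf (replicate_pmf n p))"
  by (induction n) auto

lemma length_replicate_pmf: "xs \<in> set_pmf (replicate_pmf n p) \<Longrightarrow> length xs = n"
  by (simp add: set_replicate_pmf)

lemma replicate_pmf_Suc_pair: "replicate_pmf (Suc n) p = map_pmf (\<lambda>(x, xs). x # xs) (pair_pmf p (replicate_pmf n p))"
  by (simp add: pair_pmf_def map_bind_pmf)

lemma map_replicate_pmf: "map_pmf (map f) (replicate_pmf n p) = replicate_pmf n (map_pmf f p)"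
proof (induction n)
  case (Suc n)
  have "map_pmf (map f) (replicate_pmf (Suc n) p) =
      do {x \<leftarrow> p; xs \<leftarrow> map_pmf (map f) (replicate_pmf n p); return_pmf (f x # xs)}"
    by (simp add: map_bind_pmf bind_map_pmf)
  then show ?case by (simp add: Suc.IH bind_map_pmf)
qed simp

lemma expectation_replicate_Suc:
  assumes "finite (set_pmf p)"
  shows "measure_pmf.expectation (replicate_pmf (Suc n) p) F =
    (measure_pmf.expectation p (\<lambda>x. measure_pmf.expectation (replicate_pmf n p) (\<lambda>xs. F (x # xs))) :: real)"
  using assms by (simp add: expectation_bind_finite finite_set_replicate_pmf)

lemma pmf_replicate_pmf:
  "length xs = n \<Longrightarrow> pmf (replicate_pmf n p) xs = (\<Prod>i<n. pmf p (xs ! i))"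
proof (induction n arbitrary: xs)
  case (Suc n)
  then obtain y ys where xs: "xs = y # ys" "length ys = n" by (cases xs) auto
  have "pmf (replicate_pmf (Suc n) p) xs = pmf (map_pmf (\<lambda>(x, xs). x # xs) (pair_pmf p (replicate_pmf n p))) ((\<lambda>(x, xs). x # xs) (y, ys))"
    unfolding replicate_pmf_Suc_pair xs by simp
  also have "\<dots> = pmf p y * pmf (replicate_pmf n p) ys"
    by (subst pmf_map_inj') (auto simp: inj_on_def pmf_pair)
  finally show ?case using Suc.IH[OF xs(2)] by (simp add: xs(1) prod.lessThan_Suc_shift del: prod.lessThan_Suc replicate_pmf.simps)
qed simp

lemma prob_map_replicate_pmf:
  "length as = n \<Longrightarrow> measure_pmf.prob (replicate_pmf n p) {ws. map A ws = as} = (\<Prod>i<n. measure_pmf.prob p {\<omega>. A \<omega> = as ! i})"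
  by (simp add: pmf_map_eq_prob[symmetric] map_replicate_pmf pmf_replicate_pmf)

lemma expectation_replicate_sum:
  assumes "finite (set_pmf p)"
  shows "measure_pmf.expectation (replicate_pmf n p) (\<lambda>ws. \<Sum>i<n. f (ws ! i)) = real n * measure_pmf.expectation p f"
proof (induction n)
  case (Suc n)
  have "measure_pmf.expectation (replicate_pmf (Suc n) p) (\<lambda>ws. \<Sum>i<Suc n. f (ws ! i)) =
    measure_pmf.expectation p (\<lambda>x. measure_pmf.expectation (replicate_pmf n p) (\<lambda>xs. f x + (\<Sum>i<n. f (xs ! i))))"
    by (subst expectation_replicate_Suc[OF assms]) (simp add: sum.lessThan_Suc_shift del: sum.lessThan_Suc)
  also have "\<dots> = measure_pmf.expectation p (\<lambda>x. f x + real n * measure_pmf.expectation p f)"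
    by (simp add: integrable_measure_pmf_finite assms finite_set_replicate_pmf Suc.IH)
  also have "\<dots> = real (Suc n) * measure_pmf.expectation p f"
    by (simp add: integrable_measure_pmf_finite assms algebra_simps)
  finally show ?case .
qed simp

lemma sh_replicate:
  assumes "finite (set_pmf p)"
  shows "sh (replicate_pmf n p) (map A) = real n * sh p A"
proof -
  have "sh (replicate_pmf n p) (map A) = measure_pmf.expectation (replicate_pmf n p)
      (\<lambda>ws. \<Sum>i<n. - log 2 (measure_pmf.prob p {\<omega>'. A \<omega>' = A (ws ! i)}))"
    unfolding sh_def
  proof (rule expectation_cong_supp)
    fix ws assume "ws \<in> set_pmf (replicate_pmf n p)"
    then have l: "length ws = n" and s: "\<And>i. i < n \<Longrightarrow> ws ! i \<in> set_pmf p" by (auto simp: set_replicate_pmf)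
    have "- log 2 (measure_pmf.prob (replicate_pmf n p) {\<omega>'. map A \<omega>' = map A ws})
        = - log 2 (\<Prod>i<n. measure_pmf.prob p {\<omega>. A \<omega> = A (ws ! i)})"
      using l by (simp add: prob_map_replicate_pmf)
    also have "\<dots> = - (\<Sum>i<n. log 2 (measure_pmf.prob p {\<omega>. A \<omega> = A (ws ! i)}))"
    proof -
      have "measure_pmf.prob p {\<omega>. A \<omega> = A (ws ! i)} > 0" if "i < n" for i
        by (rule prob_level_pos[OF s[OF that]])
      then show ?thesis unfolding log_def by (subst ln_prod) (auto simp: sum_divide_distrib less_le)
    qed
    finally show "- log 2 (measure_pmf.prob (replicate_pmf n p) {\<omega>'. map A \<omega>' = map A ws})
       = (\<Sum>i<n. - log 2 (measure_pmf.prob p {\<omega>'. A \<omega>' = A (ws ! i)}))" by (simp add: sum_negf)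
  qed
  also have "\<dots> = real n * sh p A" unfolding sh_def by (rule expectation_replicate_sum[OF assms])
  finally show ?thesis .
qed

lemma map_eq_map_iff_pair: "map (\<lambda>\<omega>. (A \<omega>, C \<omega>)) xs = map (\<lambda>\<omega>. (A \<omega>, C \<omega>)) ys \<longleftrightarrow> map A xs = map A ys \<and> map C xs = map C ys"
  by (auto simp: list_eq_iff_nth_eq)

text \<open>The everyday form of \<open>sh_eq\<close>: the kernels agree on the whole type, so no
  finite support is asked for. It rearranges and shortens tuples.\<close>

lemma sh_kernel_eq:
  assumes "\<And>\<omega> \<omega>'. A \<omega> = A \<omega>' \<longleftrightarrow> B \<omega> = B \<omega>'"
  shows "sh p A = sh p B"
  unfolding sh_def assms ..

lemma shc_replicate:
  assumes "finite (set_pmf p)"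
  shows "shc (replicate_pmf n p) (map A) (map C) = real n * shc p A C"
proof -
  have "sh (replicate_pmf n p) (\<lambda>\<omega>. (map A \<omega>, map C \<omega>)) = sh (replicate_pmf n p) (map (\<lambda>\<omega>. (A \<omega>, C \<omega>)))"
    by (rule sh_kernel_eq) (simp add: map_eq_map_iff_pair)
  then show ?thesis by (simp add: shc_def sh_replicate assms algebra_simps)
qed

section \<open>Weak law of large numbers\<close>

lemma variance_replicate:
  assumes fin: "finite (set_pmf p)" and mean: "measure_pmf.expectation p f = 0"
  shows "measure_pmf.expectation (replicate_pmf n p) (\<lambda>ws. (\<Sum>i<n. f (ws ! i))\<^sup>2) = real n * measure_pmf.expectation p (\<lambda>\<omega>. (f \<omega>)\<^sup>2)"
proof (induction n)
  case (Suc n)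
  have int: "integrable (measure_pmf (replicate_pmf n p)) (h :: _ \<Rightarrow> real)" for h n
    by (simp add: integrable_measure_pmf_finite fin finite_set_replicate_pmf)
  have int1: "integrable (measure_pmf p) (h :: _ \<Rightarrow> real)" for h
    by (simp add: integrable_measure_pmf_finite fin)
  have "measure_pmf.expectation (replicate_pmf (Suc n) p) (\<lambda>ws. (\<Sum>i<Suc n. f (ws ! i))\<^sup>2) =
    measure_pmf.expectation p (\<lambda>x. measure_pmf.expectation (replicate_pmf n p)
       (\<lambda>xs. (f x)\<^sup>2 + 2 * f x * (\<Sum>i<n. f (xs ! i)) + (\<Sum>i<n. f (xs ! i))\<^sup>2))"
    by (subst expectation_replicate_Suc[OF fin])
       (simp add: sum.lessThan_Suc_shift power2_sum algebra_simps del: sum.lessThan_Suc)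
  \<comment> \<open>The mixed term factors by independence; it vanishes since \<open>f\<close> has
    mean zero.\<close>
  also have "\<dots> = measure_pmf.expectation p (\<lambda>x. (f x)\<^sup>2 + 2 * f x * (real n * measure_pmf.expectation p f) + real n * measure_pmf.expectation p (\<lambda>\<omega>. (f \<omega>)\<^sup>2))"
    by (simp only: Bochner_Integration.integral_add[OF int int] Bochner_Integration.integral_mult_right_zero expectation_replicate_sum[OF fin] Suc.IH) simp
  also have "\<dots> = real (Suc n) * measure_pmf.expectation p (\<lambda>\<omega>. (f \<omega>)\<^sup>2)"
    by (simp add: mean int1 algebra_simps)
  finally show ?case .
qed simp

text \<open>Chebyshev's inequality for the centred sum.\<close>

lemma prob_deviation_replicate:
  assumes fin: "finite (set_pmf p)" and e: "e > 0" and n: "n > 0"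
  shows "measure_pmf.prob (replicate_pmf n p) {ws. \<bar>(\<Sum>i<n. f (ws ! i)) - real n * measure_pmf.expectation p f\<bar> > real n * e}
    \<le> measure_pmf.expectation p (\<lambda>\<omega>. (f \<omega> - measure_pmf.expectation p f)\<^sup>2) / (real n * e\<^sup>2)"
proof -
  define h where "h = (\<lambda>\<omega>. f \<omega> - measure_pmf.expectation p f)"
  let ?P = "replicate_pmf n p"
  have h0: "measure_pmf.expectation p h = 0" unfolding h_def by (simp add: integrable_measure_pmf_finite fin)
  have fin': "finite (set_pmf ?P)" by (simp add: fin finite_set_replicate_pmf)
  have pos: "(real n * e)\<^sup>2 > 0" using e n by simp
  let ?S = "{ws. \<bar>(\<Sum>i<n. f (ws ! i)) - real n * measure_pmf.expectation p f\<bar> > real n * e}"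
  have "(real n * e)\<^sup>2 * measure_pmf.prob ?P ?S = measure_pmf.expectation ?P (\<lambda>ws. (real n * e)\<^sup>2 * indicat_real ?S ws)"
    by simp
  also have "\<dots> \<le> measure_pmf.expectation ?P (\<lambda>ws. (\<Sum>i<n. h (ws ! i))\<^sup>2)"
  proof (rule expectation_mono_supp[OF fin'])
    fix ws
    have eq: "(\<Sum>i<n. h (ws ! i)) = (\<Sum>i<n. f (ws ! i)) - real n * measure_pmf.expectation p f"
      unfolding h_def by (simp add: sum_subtractf)
    show "(real n * e)\<^sup>2 * indicat_real ?S ws \<le> (\<Sum>i<n. h (ws ! i))\<^sup>2"
    proof (cases "ws \<in> ?S")
      case True
      then have "\<bar>real n * e\<bar> \<le> \<bar>(\<Sum>i<n. h (ws ! i))\<bar>" unfolding eq using e n by simp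
      then have "(real n * e)\<^sup>2 \<le> (\<Sum>i<n. h (ws ! i))\<^sup>2" by (simp only: abs_le_square_iff)
      then show ?thesis using True by simp
    qed simp
  qed
  also have "\<dots> = real n * measure_pmf.expectation p (\<lambda>\<omega>. (h \<omega>)\<^sup>2)" by (rule variance_replicate[OF fin h0])
  finally have "measure_pmf.prob ?P ?S \<le> real n * measure_pmf.expectation p (\<lambda>\<omega>. (h \<omega>)\<^sup>2) / (real n * e)\<^sup>2"
    using pos by (simp add: field_simps)
  also have "\<dots> = measure_pmf.expectation p (\<lambda>\<omega>. (h \<omega>)\<^sup>2) / (real n * e\<^sup>2)"
    using n e by (simp add: power2_eq_square)
  finally show ?thesis unfolding h_def .
qed

lemma weak_law_large_numbers:
  assumes fin: "finite (set_pmf p)" and e: "e > 0" and d: "d > 0"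
  shows "\<forall>\<^sub>F n in sequentially. measure_pmf.prob (replicate_pmf n p)
     {ws. \<bar>(\<Sum>i<n. f (ws ! i)) - real n * measure_pmf.expectation p f\<bar> > real n * e} \<le> d"
proof -
  define V where "V = measure_pmf.expectation p (\<lambda>\<omega>. (f \<omega> - measure_pmf.expectation p f)\<^sup>2)"
  obtain n0 :: nat where n0: "real n0 \<ge> V / (e\<^sup>2 * d)" using real_arch_simple by blast
  show ?thesis
  proof (rule eventually_sequentiallyI[of "max n0 1"])
    fix n assume n: "n \<ge> max n0 1"
    have "V / (e\<^sup>2 * d) \<le> real n" using n0 n by linarith
    then have "V \<le> d * (real n * e\<^sup>2)" using e d by (simp add: field_simps)
    then have "V / (real n * e\<^sup>2) \<le> d" using e n by (subst divide_le_eq) auto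
    then show "measure_pmf.prob (replicate_pmf n p)
     {ws. \<bar>(\<Sum>i<n. f (ws ! i)) - real n * measure_pmf.expectation p f\<bar> > real n * e} \<le> d"
      using prob_deviation_replicate[OF fin e, of n f] n unfolding V_def by auto
  qed
qed

lemma concat_replicate_pmf:
  "map_pmf concat (replicate_pmf N (replicate_pmf m p)) = replicate_pmf (N * m) p"
proof (induction N)
  case (Suc N)
  have "map_pmf concat (replicate_pmf (Suc N) (replicate_pmf m p)) =
     do {xs \<leftarrow> replicate_pmf m p; ys \<leftarrow> map_pmf concat (replicate_pmf N (replicate_pmf m p)); return_pmf (xs @ ys)}"
    by (simp add: map_bind_pmf bind_map_pmf)
  then show ?case by (simp add: Suc.IH replicate_pmf_distrib)
qed simp

section \<open>Conditional means along sequences\<close>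

definition cond_mean :: "'w pmf \<Rightarrow> ('w \<Rightarrow> 'x) \<Rightarrow> ('w \<Rightarrow> real) \<Rightarrow> 'x \<Rightarrow> real" where
  "cond_mean p X f x = measure_pmf.expectation p (\<lambda>\<omega>. f \<omega> * indicat_real {\<omega>. X \<omega> = x} \<omega>) / measure_pmf.prob p {\<omega>. X \<omega> = x}"

text \<open>The tower property. \<open>f\<close> may take the value of \<open>X\<close> as a
  parameter, which is constant on each level of \<open>X\<close>.\<close>

lemma expectation_cond_mean:
  assumes fin: "finite (set_pmf p)"
  shows "measure_pmf.expectation p (\<lambda>\<omega>. f (X \<omega>) \<omega>) = measure_pmf.expectation p (\<lambda>\<omega>. cond_mean p X (f (X \<omega>)) (X \<omega>))"
proof -
  have "measure_pmf.expectation p (\<lambda>\<omega>. cond_mean p X (f (X \<omega>)) (X \<omega>)) =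
     (\<Sum>x\<in>X ` set_pmf p. measure_pmf.expectation p (\<lambda>\<omega>. f x \<omega> * indicat_real {\<omega>. X \<omega> = x} \<omega>))"
    unfolding cond_mean_def
    by (rule expectation_sum_level[OF fin, of "\<lambda>x. measure_pmf.expectation p (\<lambda>\<omega>. f x \<omega> * indicat_real {\<omega>. X \<omega> = x} \<omega>)" X])
  also have "\<dots> = measure_pmf.expectation p (\<lambda>\<omega>. \<Sum>x\<in>X ` set_pmf p. f x \<omega> * indicat_real {\<omega>. X \<omega> = x} \<omega>)"
    by (subst Bochner_Integration.integral_sum) (auto simp: integrable_measure_pmf_finite fin)
  also have "\<dots> = measure_pmf.expectation p (\<lambda>\<omega>. f (X \<omega>) \<omega>)"
  proof (rule expectation_cong_supp)
    fix \<omega> assume w: "\<omega> \<in> set_pmf p"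
    have "(\<Sum>x\<in>X ` set_pmf p. f x \<omega> * indicat_real {\<omega>. X \<omega> = x} \<omega>) = (\<Sum>x\<in>X ` set_pmf p. if x = X \<omega> then f x \<omega> else 0)"
      by (rule sum.cong) (auto simp: indicator_def)
    also have "\<dots> = f (X \<omega>) \<omega>" using w fin by simp
    finally show "(\<Sum>x\<in>X ` set_pmf p. f x \<omega> * indicat_real {\<omega>. X \<omega> = x} \<omega>) = f (X \<omega>) \<omega>" .
  qed
  finally show ?thesis by simp
qed

text \<open>The parameter of the letter function may depend on the whole sequence \<open>X\<^sup>n\<close>, but on nothing else.\<close>

lemma expectation_replicate_cond_mean:
  assumes fin: "finite (set_pmf p)"
  shows "measure_pmf.expectation (replicate_pmf n p) (\<lambda>ws. \<Sum>i<n. f (F (map X ws) i) (ws ! i))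
       = measure_pmf.expectation (replicate_pmf n p) (\<lambda>ws. \<Sum>i<n. cond_mean p X (f (F (map X ws) i)) (X (ws ! i)))"
proof (induction n arbitrary: F)
  case (Suc n)
  have int: "integrable (measure_pmf (replicate_pmf n p)) (h :: _ \<Rightarrow> real)" for h n
    by (simp add: integrable_measure_pmf_finite fin finite_set_replicate_pmf)
  have int1: "integrable (measure_pmf p) (h :: _ \<Rightarrow> real)" for h
    by (simp add: integrable_measure_pmf_finite fin)
  define \<phi> where "\<phi> = (\<lambda>(c, \<omega>). cond_mean p X (f c) (X \<omega>))"
  let ?E = "measure_pmf.expectation (replicate_pmf n p)" and ?E1 = "measure_pmf.expectation p"
  have swap: "?E1 (\<lambda>x. ?E (h x)) = ?E (\<lambda>xs. ?E1 (\<lambda>x. h x xs))" for h :: "_ \<Rightarrow> _ \<Rightarrow> real"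
    using fin finite_set_replicate_pmf[OF fin, of n]
    by (simp add: integral_measure_pmf sum_distrib_left) (subst sum.swap, simp add: mult_ac)
  \<comment> \<open>The parameter of the first letter depends on the later letters too. Fubini fixes
    those first; then the tower property applies to the first letter alone.\<close>
  have first: "?E1 (\<lambda>x. ?E (\<lambda>xs. f (F (X x # map X xs) 0) x)) = ?E1 (\<lambda>x. ?E (\<lambda>xs. \<phi> (F (X x # map X xs) 0, x)))"
    unfolding swap \<phi>_def prod.case
    by (subst expectation_cond_mean[OF fin, where X = X and f = "\<lambda>x. f (F (x # map X _) 0)"]) simp
  have second: "?E (\<lambda>xs. \<Sum>i<n. f (F (X x # map X xs) (Suc i)) (xs ! i)) = ?E (\<lambda>xs. \<Sum>i<n. \<phi> (F (X x # map X xs) (Suc i), xs ! i))" for x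
    unfolding \<phi>_def prod.case by (rule Suc.IH)
  have "measure_pmf.expectation (replicate_pmf (Suc n) p) (\<lambda>ws. \<Sum>i<Suc n. f (F (map X ws) i) (ws ! i)) =
     ?E1 (\<lambda>x. ?E (\<lambda>xs. f (F (X x # map X xs) 0) x)) + ?E1 (\<lambda>x. ?E (\<lambda>xs. \<Sum>i<n. f (F (X x # map X xs) (Suc i)) (xs ! i)))"
    by (subst expectation_replicate_Suc[OF fin])
       (simp add: sum.lessThan_Suc_shift int int1 del: sum.lessThan_Suc)
  also have "\<dots> = ?E1 (\<lambda>x. ?E (\<lambda>xs. \<phi> (F (X x # map X xs) 0, x))) + ?E1 (\<lambda>x. ?E (\<lambda>xs. \<Sum>i<n. \<phi> (F (X x # map X xs) (Suc i), xs ! i)))"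
    unfolding first second ..
  also have "\<dots> = measure_pmf.expectation (replicate_pmf (Suc n) p) (\<lambda>ws. \<Sum>i<Suc n. \<phi> (F (map X ws) i, ws ! i))"
    by (subst expectation_replicate_Suc[OF fin])
       (simp add: sum.lessThan_Suc_shift int int1 del: sum.lessThan_Suc)
  finally show ?case unfolding \<phi>_def prod.case .
qed simp

section \<open>Superposition covering\<close>

text \<open>Each codeword is chosen to cover at least the average share of what is still uncovered.\<close>

lemma greedy_covering:
  fixes q :: "'v \<Rightarrow> real" and \<mu> :: "'x \<Rightarrow> real"
  assumes X: "finite X" "\<And>x. x \<in> X \<Longrightarrow> \<mu> x \<ge> 0"
    and V: "finite V" "V \<noteq> {}" "\<And>v. v \<in> V \<Longrightarrow> q v \<ge> 0" "(\<Sum>v\<in>V. q v) \<le> 1"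
    and hit: "\<And>x. x \<in> X \<Longrightarrow> p \<le> (\<Sum>v\<in>{v\<in>V. R x v}. q v)" and p: "0 \<le> p" "p \<le> 1"
  shows "\<exists>c. (\<forall>i. c i \<in> V) \<and> (\<Sum>x\<in>{x\<in>X. \<forall>i<M::nat. \<not> R x (c i)}. \<mu> x) \<le> (1 - p) ^ M * (\<Sum>x\<in>X. \<mu> x)"
proof (induction M)
  case 0
  obtain v where "v \<in> V" using V(2) by auto
  then show ?case by (intro exI[of _ "\<lambda>_. v"]) simp
next
  case (Suc M)
  then obtain c where c: "\<And>i. c i \<in> V"
    "(\<Sum>x\<in>{x\<in>X. \<forall>i<M. \<not> R x (c i)}. \<mu> x) \<le> (1 - p) ^ M * (\<Sum>x\<in>X. \<mu> x)" by blast
  define Y where "Y = {x\<in>X. \<forall>i<M. \<not> R x (c i)}"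
  have Y: "finite Y" "Y \<subseteq> X" unfolding Y_def using X by auto
  define f where "f = (\<lambda>v. \<Sum>x\<in>{x\<in>Y. R x v}. \<mu> x)"
  have f0: "f v \<ge> 0" for v unfolding f_def by (rule sum_nonneg) (use X Y in auto)
  have "Max (f ` V) \<in> f ` V" using V(1,2) by simp
  then obtain v where v: "v \<in> V" "\<And>w. w \<in> V \<Longrightarrow> f w \<le> f v"
    using V(1) by (auto simp: eq_commute)
  \<comment> \<open>Double counting: the mass newly covered by a codeword, averaged with weights
    \<open>q\<close>, is at least \<open>p\<close> times the uncovered mass. As \<open>q\<close> has
    total mass at most 1, the best codeword \<open>v\<close> does no worse than this
    average.\<close>
  have "p * (\<Sum>x\<in>Y. \<mu> x) = (\<Sum>x\<in>Y. \<mu> x * p)" by (simp add: sum_distrib_left mult.commute)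
  also have "\<dots> \<le> (\<Sum>x\<in>Y. \<mu> x * (\<Sum>w\<in>{w\<in>V. R x w}. q w))"
    by (rule sum_mono) (rule mult_left_mono, use hit X Y in auto)
  also have "\<dots> = (\<Sum>x\<in>Y. \<Sum>w\<in>V. if R x w then q w * \<mu> x else 0)"
    by (rule sum.cong) (auto simp: sum_distrib_left sum.inter_filter[OF V(1)] mult.commute intro!: sum.cong)
  also have "\<dots> = (\<Sum>w\<in>V. q w * f w)"
    unfolding f_def sum_distrib_left sum.inter_filter[OF Y(1)] by (subst sum.swap) (auto intro!: sum.cong)
  also have "\<dots> \<le> (\<Sum>w\<in>V. q w * f v)"
    by (rule sum_mono) (rule mult_left_mono, use v V in auto)
  also have "\<dots> = (\<Sum>w\<in>V. q w) * f v" by (simp add: sum_distrib_right)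
  also have "\<dots> \<le> 1 * f v" by (rule mult_right_mono) (use V f0 in auto)
  finally have fv: "p * (\<Sum>x\<in>Y. \<mu> x) \<le> f v" by simp
  define c' where "c' = c(M := v)"
  have Z: "{x\<in>X. \<forall>i<Suc M. \<not> R x (c' i)} = Y - {x\<in>Y. R x v}"
    unfolding Y_def c'_def by (auto simp: less_Suc_eq)
  have "(\<Sum>x\<in>{x\<in>X. \<forall>i<Suc M. \<not> R x (c' i)}. \<mu> x) = (\<Sum>x\<in>Y. \<mu> x) - f v"
    unfolding Z f_def by (rule sum_diff) (use Y in auto)
  also have "\<dots> \<le> (1 - p) * (\<Sum>x\<in>Y. \<mu> x)" using fv by (simp add: algebra_simps)
  also have "\<dots> \<le> (1 - p) * ((1 - p) ^ M * (\<Sum>x\<in>X. \<mu> x))"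
    by (rule mult_left_mono) (use c(2) p in \<open>auto simp: Y_def\<close>)
  finally show ?case using c(1) v(1) by (intro exI[of _ c']) (auto simp: c'_def)
qed

text \<open>Uses \<open>1 - p \<le> exp (- p)\<close>. An empty \<open>X\<close> is treated apart,
  since \<open>p \<le> 1\<close> is read off from some \<open>x\<close>.\<close>

lemma greedy_covering_exp:
  fixes q :: "'v \<Rightarrow> real" and \<mu> :: "'x \<Rightarrow> real"
  assumes X: "finite X" "\<And>x. x \<in> X \<Longrightarrow> \<mu> x \<ge> 0"
    and V: "finite V" "V \<noteq> {}" "\<And>v. v \<in> V \<Longrightarrow> q v \<ge> 0" "(\<Sum>v\<in>V. q v) \<le> 1"
    and hit: "\<And>x. x \<in> X \<Longrightarrow> p \<le> (\<Sum>v\<in>{v\<in>V. R x v}. q v)" and p: "0 \<le> p"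
  shows "\<exists>c. (\<forall>i. c i \<in> V) \<and> (\<Sum>x\<in>{x\<in>X. \<forall>i<M::nat. \<not> R x (c i)}. \<mu> x) \<le> exp (- (real M * p)) * (\<Sum>x\<in>X. \<mu> x)"
proof (cases "X = {}")
  case True
  then show ?thesis using V(2) by (auto intro!: exI[of _ "\<lambda>_. SOME v. v \<in> V"] some_in_eq[THEN iffD2])
next
  case False
  then obtain x where x: "x \<in> X" by auto
  have "p \<le> (\<Sum>v\<in>{v\<in>V. R x v}. q v)" by (rule hit[OF x])
  also have "\<dots> \<le> (\<Sum>v\<in>V. q v)" by (rule sum_mono2) (use V in auto)
  finally have p1: "p \<le> 1" using V(4) by simp
  obtain c where c: "\<And>i. c i \<in> V" "(\<Sum>x\<in>{x\<in>X. \<forall>i<M::nat. \<not> R x (c i)}. \<mu> x) \<le> (1 - p) ^ M * (\<Sum>x\<in>X. \<mu> x)"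
    using greedy_covering[of X \<mu> V q p R M, OF X V hit p p1] by blast
  have "(1 - p) ^ M \<le> exp (- p) ^ M"
    by (rule power_mono) (use exp_ge_add_one_self[of "-p"] p1 in auto)
  also have "\<dots> = exp (- (real M * p))" by (simp add: exp_of_nat_mult[symmetric])
  finally have "(1 - p) ^ M * (\<Sum>x\<in>X. \<mu> x) \<le> exp (- (real M * p)) * (\<Sum>x\<in>X. \<mu> x)"
    by (rule mult_right_mono) (use X in \<open>auto intro: sum_nonneg\<close>)
  with c show ?thesis by (intro exI[of _ c]) auto
qed

lemma sum_prob_levels:
  assumes fin: "finite (set_pmf p)"
  shows "(\<Sum>a\<in>{a\<in>A ` set_pmf p. K a}. measure_pmf.prob p {\<omega>. A \<omega> = a \<and> E \<omega>}) = measure_pmf.prob p {\<omega>. K (A \<omega>) \<and> E \<omega>}"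
proof -
  have "(\<Sum>a\<in>{a\<in>A ` set_pmf p. K a}. measure_pmf.prob p {\<omega>. A \<omega> = a \<and> E \<omega>}) =
     measure_pmf.prob p (\<Union>a\<in>{a\<in>A ` set_pmf p. K a}. {\<omega>. A \<omega> = a \<and> E \<omega>})"
    by (rule measure_pmf.finite_measure_finite_Union[symmetric]) (use fin in \<open>auto simp: disjoint_family_on_def\<close>)
  also have "\<dots> = measure_pmf.prob p {\<omega>. K (A \<omega>) \<and> E \<omega>}"
    by (rule antisym; rule prob_mono_supp) auto
  finally show ?thesis .
qed

text \<open>Markov's inequality: the conditional probability of failure given \<open>C\<close>
  exceeds 1/2 with probability at most twice its mean.\<close>

lemma prob_conditional_small:
  assumes fin: "finite (set_pmf p)"
  shows "measure_pmf.prob p {\<omega>. measure_pmf.prob p {\<omega>'. C \<omega>' = C \<omega> \<and> E \<omega>'} < 1/2 * measure_pmf.prob p {\<omega>'. C \<omega>' = C \<omega>}}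
      \<le> 2 * measure_pmf.prob p {\<omega>. \<not> E \<omega>}" (is "measure_pmf.prob p ?S \<le> _")
proof -
  let ?r = "\<lambda>\<omega>. measure_pmf.prob p {\<omega>'. C \<omega>' = C \<omega> \<and> \<not> E \<omega>'} / measure_pmf.prob p {\<omega>'. C \<omega>' = C \<omega>}"
  have "measure_pmf.prob p ?S = measure_pmf.expectation p (indicat_real ?S)" by simp
  also have "\<dots> \<le> measure_pmf.expectation p (\<lambda>\<omega>. 2 * ?r \<omega>)"
  proof (rule expectation_mono_supp[OF fin])
    fix \<omega> assume w: "\<omega> \<in> set_pmf p"
    have pos: "measure_pmf.prob p {\<omega>'. C \<omega>' = C \<omega>} > 0" by (rule prob_level_pos[OF w])
    have "measure_pmf.prob p {\<omega>'. C \<omega>' = C \<omega>} = measure_pmf.prob p ({\<omega>'. C \<omega>' = C \<omega> \<and> E \<omega>'} \<union> {\<omega>'. C \<omega>' = C \<omega> \<and> \<not> E \<omega>'})"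
      by (rule arg_cong[where f = "measure_pmf.prob p"]) auto
    also have "\<dots> = measure_pmf.prob p {\<omega>'. C \<omega>' = C \<omega> \<and> E \<omega>'} + measure_pmf.prob p {\<omega>'. C \<omega>' = C \<omega> \<and> \<not> E \<omega>'}"
      by (rule measure_pmf.finite_measure_Union) auto
    finally show "indicat_real ?S \<omega> \<le> 2 * ?r \<omega>"
      using pos by (auto simp: indicator_def field_simps)
  qed
  also have "\<dots> = 2 * measure_pmf.expectation p ?r" by (rule integral_mult_right_zero)
  also have "\<dots> = 2 * (\<Sum>c\<in>C ` set_pmf p. measure_pmf.prob p {\<omega>'. C \<omega>' = c \<and> \<not> E \<omega>'})"
    using expectation_sum_level[OF fin, of "\<lambda>c. measure_pmf.prob p {\<omega>'. C \<omega>' = c \<and> \<not> E \<omega>'}" C] by simp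
  also have "\<dots> = 2 * measure_pmf.prob p {\<omega>. \<not> E \<omega>}"
    using sum_prob_levels[OF fin, where A = C and K = "\<lambda>_. True" and E = "\<lambda>\<omega>. \<not> E \<omega>"] by simp
  finally show ?thesis .
qed

text \<open>By \<open>dens1\<close>, a value of \<open>V\<close> drawn independently of
  \<open>x\<close> is a good partner of most \<open>x\<close> with probability at least
  \<open>1 / (2 * g1)\<close>; by \<open>dens2\<close> the same holds, with \<open>g2\<close>, for
  \<open>U\<close> drawn given the centre. Greedy covering is applied to the centres
  \<open>cv\<close> and then, for each centre, to its satellites \<open>cu\<close>. The factor 4 is
  Markov's inequality at level 1/2 applied twice, because a centre must leave enough typical
  satellites.\<close>

lemma superposition_covering:
  fixes V :: "'w \<Rightarrow> 'v" and U :: "'w \<Rightarrow> 'u" and X :: "'w \<Rightarrow> 'x" and M1 M2 :: nat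
  assumes fin: "finite (set_pmf p)" and g: "g1 > 0" "g2 > 0"
    and dens1: "\<And>\<omega>. \<omega> \<in> set_pmf p \<Longrightarrow> T (V \<omega>) (U \<omega>) (X \<omega>) \<Longrightarrow>
       measure_pmf.prob p {\<omega>'. V \<omega>' = V \<omega> \<and> X \<omega>' = X \<omega>} \<le>
         g1 * (measure_pmf.prob p {\<omega>'. V \<omega>' = V \<omega>} * measure_pmf.prob p {\<omega>'. X \<omega>' = X \<omega>})"
    and dens2: "\<And>\<omega>. \<omega> \<in> set_pmf p \<Longrightarrow> T (V \<omega>) (U \<omega>) (X \<omega>) \<Longrightarrow>
       measure_pmf.prob p {\<omega>'. U \<omega>' = U \<omega> \<and> V \<omega>' = V \<omega> \<and> X \<omega>' = X \<omega>} * measure_pmf.prob p {\<omega>'. V \<omega>' = V \<omega>} \<le>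
         g2 * (measure_pmf.prob p {\<omega>'. U \<omega>' = U \<omega> \<and> V \<omega>' = V \<omega>} * measure_pmf.prob p {\<omega>'. V \<omega>' = V \<omega> \<and> X \<omega>' = X \<omega>})"
  shows "\<exists>cv cu \<alpha> \<beta> G. (\<forall>x\<in>G. \<alpha> x < M1 \<and> \<beta> x < M2 \<and>
       (\<exists>\<omega>\<in>set_pmf p. V \<omega> = cv (\<alpha> x) \<and> U \<omega> = cu (\<alpha> x) (\<beta> x) \<and> X \<omega> = x \<and> T (cv (\<alpha> x)) (cu (\<alpha> x) (\<beta> x)) x)) \<and>
     measure_pmf.prob p {\<omega>. X \<omega> \<notin> G} \<le> 4 * measure_pmf.prob p {\<omega>. \<not> T (V \<omega>) (U \<omega>) (X \<omega>)}
        + exp (- (real M1 / (2 * g1))) + exp (- (real M2 / (2 * g2)))"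
proof -
  let ?W = "set_pmf p"
  let ?P = "measure_pmf.prob p"
  define E where "E = (\<lambda>\<omega>. T (V \<omega>) (U \<omega>) (X \<omega>))"
  \<comment> \<open>\<open>G1 v x\<close> says that typicality keeps conditional probability at
    least 1/2 once \<open>v\<close> and \<open>x\<close> are fixed, so that a satellite can still be
    found. \<open>Xg\<close> asks the same of \<open>x\<close> with respect to \<open>G1\<close>.
    Positivity provides an outcome that witnesses \<open>G1\<close>.\<close>
  define G1 where "G1 = (\<lambda>v x. ?P {\<omega>. V \<omega> = v \<and> X \<omega> = x \<and> E \<omega>} \<ge> 1/2 * ?P {\<omega>. V \<omega> = v \<and> X \<omega> = x} \<and> ?P {\<omega>. V \<omega> = v \<and> X \<omega> = x} > 0)"
  define Xg where "Xg = {x\<in>X ` ?W. ?P {\<omega>. X \<omega> = x \<and> G1 (V \<omega>) x} \<ge> 1/2 * ?P {\<omega>. X \<omega> = x}}"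
  define \<mu> where "\<mu> = (\<lambda>x. ?P {\<omega>. X \<omega> = x})"
  have G1D: "\<exists>\<omega>\<in>?W. V \<omega> = v \<and> X \<omega> = x \<and> E \<omega>" if "G1 v x" for v x
  proof (rule ccontr)
    assume a: "\<not> ?thesis"
    have "?P {\<omega>. V \<omega> = v \<and> X \<omega> = x \<and> E \<omega>} \<le> ?P {}"
      by (rule prob_mono_supp) (use a in auto)
    with that show False unfolding G1_def by simp
  qed
  have b1: "?P {\<omega>. \<not> G1 (V \<omega>) (X \<omega>)} \<le> 2 * ?P {\<omega>. \<not> E \<omega>}"
  proof -
    have "?P {\<omega>. \<not> G1 (V \<omega>) (X \<omega>)} \<le> ?P {\<omega>. ?P {\<omega>'. (V \<omega>', X \<omega>') = (V \<omega>, X \<omega>) \<and> E \<omega>'} < 1/2 * ?P {\<omega>'. (V \<omega>', X \<omega>') = (V \<omega>, X \<omega>)}}"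
    proof (rule prob_mono_supp)
      fix \<omega> assume w: "\<omega> \<in> ?W" "\<omega> \<in> {\<omega>. \<not> G1 (V \<omega>) (X \<omega>)}"
      then show "\<omega> \<in> {\<omega>. ?P {\<omega>'. (V \<omega>', X \<omega>') = (V \<omega>, X \<omega>) \<and> E \<omega>'} < 1/2 * ?P {\<omega>'. (V \<omega>', X \<omega>') = (V \<omega>, X \<omega>)}}"
        using prob_level_pos[OF w(1), of "\<lambda>\<omega>. (V \<omega>, X \<omega>)"] by (simp add: G1_def conj_assoc not_le)
    qed
    also have "\<dots> \<le> 2 * ?P {\<omega>. \<not> E \<omega>}"
      using prob_conditional_small[OF fin, of "\<lambda>\<omega>. (V \<omega>, X \<omega>)" E] by simp
    finally show ?thesis .
  qed
  have b2: "?P {\<omega>. X \<omega> \<notin> Xg} \<le> 4 * ?P {\<omega>. \<not> E \<omega>}"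
  proof -
    have "?P {\<omega>. X \<omega> \<notin> Xg} \<le> ?P {\<omega>. ?P {\<omega>'. X \<omega>' = X \<omega> \<and> G1 (V \<omega>') (X \<omega>')} < 1/2 * ?P {\<omega>'. X \<omega>' = X \<omega>}}"
    proof (rule prob_mono_supp)
      fix \<omega> assume w: "\<omega> \<in> ?W" "\<omega> \<in> {\<omega>. X \<omega> \<notin> Xg}"
      have "{\<omega>'. X \<omega>' = X \<omega> \<and> G1 (V \<omega>') (X \<omega>')} = {\<omega>'. X \<omega>' = X \<omega> \<and> G1 (V \<omega>') (X \<omega>)}" by auto
      then show "\<omega> \<in> {\<omega>. ?P {\<omega>'. X \<omega>' = X \<omega> \<and> G1 (V \<omega>') (X \<omega>')} < 1/2 * ?P {\<omega>'. X \<omega>' = X \<omega>}}"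
        using w by (simp add: Xg_def not_le)
    qed
    also have "\<dots> \<le> 2 * ?P {\<omega>. \<not> G1 (V \<omega>) (X \<omega>)}"
      by (rule prob_conditional_small[OF fin])
    finally show ?thesis using b1 by simp
  qed
  have musum: "(\<Sum>x\<in>A. \<mu> x) = ?P {\<omega>. X \<omega> \<in> A}" if "A \<subseteq> X ` ?W" for A
  proof -
    have "A = {x\<in>X ` ?W. x \<in> A}" using that by auto
    then show ?thesis using sum_prob_levels[OF fin, where A = X and K = "\<lambda>x. x \<in> A" and E = "\<lambda>_. True"] by (simp add: \<mu>_def)
  qed
  have Xg: "finite Xg" "Xg \<subseteq> X ` ?W" unfolding Xg_def using fin by auto
  have Vne: "finite (V ` ?W)" "V ` ?W \<noteq> {}" "finite (U ` ?W)" "U ` ?W \<noteq> {}"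
    using fin set_pmf_not_empty[of p] by auto
  have "\<exists>cv. (\<forall>i. cv i \<in> V ` ?W) \<and> (\<Sum>x\<in>{x\<in>Xg. \<forall>i<M1. \<not> G1 (cv i) x}. \<mu> x) \<le> exp (- (real M1 * (1 / (2 * g1)))) * (\<Sum>x\<in>Xg. \<mu> x)"
  proof (rule greedy_covering_exp[where q = "\<lambda>v. ?P {\<omega>. V \<omega> = v}" and R = "\<lambda>x v. G1 v x"])
    show "(\<Sum>v\<in>V ` ?W. ?P {\<omega>. V \<omega> = v}) \<le> 1"
      using sum_prob_levels[OF fin, where A = V and K = "\<lambda>x. True" and E = "\<lambda>_. True"] by simp
    fix x assume x: "x \<in> Xg"
    then obtain \<omega>0 where w0: "\<omega>0 \<in> ?W" "x = X \<omega>0" unfolding Xg_def by auto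
    have mpos: "\<mu> x > 0" unfolding \<mu>_def w0(2) by (rule prob_level_pos[OF w0(1)])
    have "1 / (2 * g1) = (1/2 * \<mu> x) / (g1 * \<mu> x)" using mpos g by simp
    also have "\<dots> \<le> ?P {\<omega>. G1 (V \<omega>) x \<and> X \<omega> = x} / (g1 * \<mu> x)"
      using x mpos g unfolding Xg_def \<mu>_def by (intro divide_right_mono) (auto simp: conj_commute)
    also have "\<dots> = (\<Sum>v\<in>{v\<in>V ` ?W. G1 v x}. ?P {\<omega>. V \<omega> = v \<and> X \<omega> = x} / (g1 * \<mu> x))"
      using sum_prob_levels[OF fin, where A = V and K = "\<lambda>v. G1 v x" and E = "\<lambda>\<omega>. X \<omega> = x"] by (simp flip: sum_divide_distrib)
    also have "\<dots> \<le> (\<Sum>v\<in>{v\<in>V ` ?W. G1 v x}. ?P {\<omega>. V \<omega> = v})"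
    proof (rule sum_mono)
      fix v assume "v \<in> {v\<in>V ` ?W. G1 v x}"
      then obtain \<omega> where "\<omega> \<in> ?W" "V \<omega> = v" "X \<omega> = x" "E \<omega>" using G1D[of v x] by auto
      then have "?P {\<omega>. V \<omega> = v \<and> X \<omega> = x} \<le> g1 * (?P {\<omega>. V \<omega> = v} * \<mu> x)"
        using dens1[of \<omega>] by (simp add: \<mu>_def E_def)
      then show "?P {\<omega>. V \<omega> = v \<and> X \<omega> = x} / (g1 * \<mu> x) \<le> ?P {\<omega>. V \<omega> = v}"
        using mpos g by (subst divide_le_eq) (auto simp: mult_ac)
    qed
    finally show "1 / (2 * g1) \<le> (\<Sum>v\<in>{v\<in>V ` ?W. G1 v x}. ?P {\<omega>. V \<omega> = v})" .
  qed (use Xg Vne g in \<open>auto simp: \<mu>_def\<close>)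
  then obtain cv where cv: "\<And>i. cv i \<in> V ` ?W"
    "(\<Sum>x\<in>{x\<in>Xg. \<forall>i<M1. \<not> G1 (cv i) x}. \<mu> x) \<le> exp (- (real M1 / (2 * g1))) * (\<Sum>x\<in>Xg. \<mu> x)" by auto
  define Xc where "Xc = {x\<in>Xg. \<exists>i<M1. G1 (cv i) x}"
  \<comment> \<open>Each covered \<open>x\<close> is assigned to a single centre. The satellite
    problems of the centres are then disjoint, and their uncovered masses add up to a small fraction
    of one total.\<close>
  define \<alpha> where "\<alpha> = (\<lambda>x. SOME i. i < M1 \<and> G1 (cv i) x)"
  have \<alpha>: "\<alpha> x < M1" "G1 (cv (\<alpha> x)) x" if "x \<in> Xc" for x
    using someI_ex[of "\<lambda>i. i < M1 \<and> G1 (cv i) x"] that unfolding Xc_def \<alpha>_def by auto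
  have Xc: "finite Xc" "Xc \<subseteq> Xg" unfolding Xc_def using Xg by auto
  \<comment> \<open>Beyond typicality, \<open>R\<close> asks for an outcome in the support with
    these values; this keeps the codeword at positive probability together with
    \<open>x\<close>.\<close>
  define R where "R = (\<lambda>i x u. \<exists>\<omega>\<in>?W. V \<omega> = cv i \<and> U \<omega> = u \<and> X \<omega> = x \<and> E \<omega>)"
  have "\<exists>c. (\<forall>j. c j \<in> U ` ?W) \<and> (\<Sum>x\<in>{x\<in>{x\<in>Xc. \<alpha> x = i}. \<forall>j<M2. \<not> R i x (c j)}. \<mu> x) \<le> exp (- (real M2 * (1 / (2 * g2)))) * (\<Sum>x\<in>{x\<in>Xc. \<alpha> x = i}. \<mu> x)" for i
  proof (rule greedy_covering_exp[where q = "\<lambda>u. ?P {\<omega>. U \<omega> = u \<and> V \<omega> = cv i} / ?P {\<omega>. V \<omega> = cv i}"])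
    obtain \<omega>v where wv: "\<omega>v \<in> ?W" "V \<omega>v = cv i" using cv(1)[of i] by auto
    have vpos: "?P {\<omega>. V \<omega> = cv i} > 0" using prob_level_pos[OF wv(1), of V] wv(2) by simp
    show "(\<Sum>u\<in>U ` ?W. ?P {\<omega>. U \<omega> = u \<and> V \<omega> = cv i} / ?P {\<omega>. V \<omega> = cv i}) \<le> 1"
      using sum_prob_levels[OF fin, where A = U and K = "\<lambda>x. True" and E = "\<lambda>\<omega>. V \<omega> = cv i"] vpos by (simp flip: sum_divide_distrib)
    fix x assume "x \<in> {x\<in>Xc. \<alpha> x = i}"
    then have x: "x \<in> Xc" "\<alpha> x = i" by auto
    have G: "G1 (cv i) x" using \<alpha>(2)[OF x(1)] x(2) by simp
    define vx where "vx = ?P {\<omega>. V \<omega> = cv i \<and> X \<omega> = x}"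
    have vxpos: "vx > 0" using G unfolding G1_def vx_def by simp
    have "1 / (2 * g2) = (1/2 * vx) / (g2 * vx)" using vxpos g by simp
    also have "\<dots> \<le> ?P {\<omega>. V \<omega> = cv i \<and> X \<omega> = x \<and> E \<omega>} / (g2 * vx)"
      using G vxpos g unfolding G1_def vx_def by (intro divide_right_mono) auto
    also have "?P {\<omega>. V \<omega> = cv i \<and> X \<omega> = x \<and> E \<omega>} \<le> ?P {\<omega>. R i x (U \<omega>) \<and> V \<omega> = cv i \<and> X \<omega> = x}"
      by (rule prob_mono_supp) (auto simp: R_def)
    also have "?P {\<omega>. R i x (U \<omega>) \<and> V \<omega> = cv i \<and> X \<omega> = x} = (\<Sum>u\<in>{u\<in>U ` ?W. R i x u}. ?P {\<omega>. U \<omega> = u \<and> V \<omega> = cv i \<and> X \<omega> = x})"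
      by (rule sum_prob_levels[OF fin, symmetric])
    also have "\<dots> / (g2 * vx) = (\<Sum>u\<in>{u\<in>U ` ?W. R i x u}. ?P {\<omega>. U \<omega> = u \<and> V \<omega> = cv i \<and> X \<omega> = x} / (g2 * vx))"
      by (simp add: sum_divide_distrib)
    also have "\<dots> \<le> (\<Sum>u\<in>{u\<in>U ` ?W. R i x u}. ?P {\<omega>. U \<omega> = u \<and> V \<omega> = cv i} / ?P {\<omega>. V \<omega> = cv i})"
    proof (rule sum_mono)
      fix u assume "u \<in> {u\<in>U ` ?W. R i x u}"
      then obtain \<omega> where "\<omega> \<in> ?W" "V \<omega> = cv i" "U \<omega> = u" "X \<omega> = x" "E \<omega>" unfolding R_def by auto
      then have "?P {\<omega>. U \<omega> = u \<and> V \<omega> = cv i \<and> X \<omega> = x} * ?P {\<omega>. V \<omega> = cv i} \<le> g2 * (?P {\<omega>. U \<omega> = u \<and> V \<omega> = cv i} * vx)"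
        using dens2[of \<omega>] by (simp add: vx_def E_def)
      then show "?P {\<omega>. U \<omega> = u \<and> V \<omega> = cv i \<and> X \<omega> = x} / (g2 * vx) \<le> ?P {\<omega>. U \<omega> = u \<and> V \<omega> = cv i} / ?P {\<omega>. V \<omega> = cv i}"
        using vxpos vpos g by (simp add: field_simps)
    qed
    finally show "1 / (2 * g2) \<le> (\<Sum>u\<in>{u\<in>U ` ?W. R i x u}. ?P {\<omega>. U \<omega> = u \<and> V \<omega> = cv i} / ?P {\<omega>. V \<omega> = cv i})"
      using vxpos g by (simp add: divide_right_mono)
  qed (use Xc Vne g in \<open>auto simp: \<mu>_def\<close>)
  then have "\<forall>i. \<exists>c. (\<Sum>x\<in>{x\<in>{x\<in>Xc. \<alpha> x = i}. \<forall>j<M2. \<not> R i x (c j)}. \<mu> x) \<le> exp (- (real M2 * (1 / (2 * g2)))) * (\<Sum>x\<in>{x\<in>Xc. \<alpha> x = i}. \<mu> x)"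
    by blast
  from choice[OF this] obtain cu where cu: "\<And>i. (\<Sum>x\<in>{x\<in>{x\<in>Xc. \<alpha> x = i}. \<forall>j<M2. \<not> R i x (cu i j)}. \<mu> x) \<le> exp (- (real M2 / (2 * g2))) * (\<Sum>x\<in>{x\<in>Xc. \<alpha> x = i}. \<mu> x)"
    by auto
  define \<beta> where "\<beta> = (\<lambda>x. SOME j. j < M2 \<and> R (\<alpha> x) x (cu (\<alpha> x) j))"
  define G where "G = {x\<in>Xc. \<exists>j<M2. R (\<alpha> x) x (cu (\<alpha> x) j)}"
  have \<beta>: "\<beta> x < M2" "R (\<alpha> x) x (cu (\<alpha> x) (\<beta> x))" if "x \<in> G" for x
    using someI_ex[of "\<lambda>j. j < M2 \<and> R (\<alpha> x) x (cu (\<alpha> x) j)"] that unfolding G_def \<beta>_def by auto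
  have mu1: "(\<Sum>x\<in>A. \<mu> x) \<le> 1" if "A \<subseteq> X ` ?W" for A using musum[OF that] by simp
  have c1: "(\<Sum>x\<in>Xg - Xc. \<mu> x) \<le> exp (- (real M1 / (2 * g1)))"
  proof -
    have "Xg - Xc = {x\<in>Xg. \<forall>i<M1. \<not> G1 (cv i) x}" unfolding Xc_def by auto
    then show ?thesis using order_trans[OF cv(2) mult_left_le[OF mu1[OF Xg(2)]]] by simp
  qed
  have c2: "(\<Sum>x\<in>Xc - G. \<mu> x) \<le> exp (- (real M2 / (2 * g2)))"
  proof -
    have "(\<Sum>x\<in>Xc - G. \<mu> x) = (\<Sum>i<M1. \<Sum>x\<in>{x\<in>Xc - G. \<alpha> x = i}. \<mu> x)"
      by (rule sum.group[symmetric]) (use Xc \<alpha> in auto)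
    also have "\<dots> \<le> (\<Sum>i<M1. exp (- (real M2 / (2 * g2))) * (\<Sum>x\<in>{x\<in>Xc. \<alpha> x = i}. \<mu> x))"
    proof (rule sum_mono)
      fix i
      have "{x\<in>Xc - G. \<alpha> x = i} = {x\<in>{x\<in>Xc. \<alpha> x = i}. \<forall>j<M2. \<not> R i x (cu i j)}"
        unfolding G_def by auto
      then show "(\<Sum>x\<in>{x\<in>Xc - G. \<alpha> x = i}. \<mu> x) \<le> exp (- (real M2 / (2 * g2))) * (\<Sum>x\<in>{x\<in>Xc. \<alpha> x = i}. \<mu> x)"
        using cu[of i] by simp
    qed
    also have "\<dots> = exp (- (real M2 / (2 * g2))) * (\<Sum>i<M1. \<Sum>x\<in>{x\<in>Xc. \<alpha> x = i}. \<mu> x)"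
      by (rule sum_distrib_left[symmetric])
    also have "(\<Sum>i<M1. \<Sum>x\<in>{x\<in>Xc. \<alpha> x = i}. \<mu> x) = (\<Sum>x\<in>Xc. \<mu> x)"
      by (rule sum.group) (use Xc \<alpha> in auto)
    also have "exp (- (real M2 / (2 * g2))) * (\<Sum>x\<in>Xc. \<mu> x) \<le> exp (- (real M2 / (2 * g2)))"
      by (rule mult_left_le) (use mu1[of Xc] Xc Xg in auto)
    finally show ?thesis .
  qed
  have "?P {\<omega>. X \<omega> \<notin> G} \<le> ?P ({\<omega>. X \<omega> \<notin> Xg} \<union> ({\<omega>. X \<omega> \<in> Xg - Xc} \<union> {\<omega>. X \<omega> \<in> Xc - G}))"
    by (rule prob_mono_supp) auto
  also have "\<dots> \<le> ?P {\<omega>. X \<omega> \<notin> Xg} + (?P {\<omega>. X \<omega> \<in> Xg - Xc} + ?P {\<omega>. X \<omega> \<in> Xc - G})"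
    by (intro order_trans[OF measure_Un_le] add_left_mono) auto
  also have "\<dots> \<le> 4 * ?P {\<omega>. \<not> E \<omega>} + (exp (- (real M1 / (2 * g1))) + exp (- (real M2 / (2 * g2))))"
    using b2 c1 c2 musum[of "Xg - Xc"] musum[of "Xc - G"] Xg Xc by (intro add_mono) (auto simp: subset_eq)
  finally have fin_bound: "?P {\<omega>. X \<omega> \<notin> G} \<le> 4 * ?P {\<omega>. \<not> E \<omega>} + exp (- (real M1 / (2 * g1))) + exp (- (real M2 / (2 * g2)))" by simp
  have good: "\<forall>x\<in>G. \<alpha> x < M1 \<and> \<beta> x < M2 \<and>
       (\<exists>\<omega>\<in>set_pmf p. V \<omega> = cv (\<alpha> x) \<and> U \<omega> = cu (\<alpha> x) (\<beta> x) \<and> X \<omega> = x \<and> T (cv (\<alpha> x)) (cu (\<alpha> x) (\<beta> x)) x)"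
  proof
    fix x assume x: "x \<in> G"
    have "x \<in> Xc" using x unfolding G_def by auto
    obtain \<omega> where w: "\<omega> \<in> ?W" "V \<omega> = cv (\<alpha> x)" "U \<omega> = cu (\<alpha> x) (\<beta> x)" "X \<omega> = x" "E \<omega>"
      using \<beta>(2)[OF x] unfolding R_def by blast
    show "\<alpha> x < M1 \<and> \<beta> x < M2 \<and>
       (\<exists>\<omega>\<in>set_pmf p. V \<omega> = cv (\<alpha> x) \<and> U \<omega> = cu (\<alpha> x) (\<beta> x) \<and> X \<omega> = x \<and> T (cv (\<alpha> x)) (cu (\<alpha> x) (\<beta> x)) x)"
      using \<alpha>(1)[OF \<open>x \<in> Xc\<close>] \<beta>(1)[OF x] w unfolding E_def by metis
  qed
  show ?thesis using good fin_bound unfolding E_def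
    by (intro exI[of _ cv] exI[of _ cu] exI[of _ \<alpha>] exI[of _ \<beta>] exI[of _ G]) simp
qed

section \<open>Covering codes for long blocks\<close>

lemma prob_map_replicate_powr:
  assumes "ws \<in> set_pmf (replicate_pmf n p)"
  shows "measure_pmf.prob (replicate_pmf n p) {ws'. map A ws' = map A ws}
      = 2 powr (\<Sum>i<n. log 2 (measure_pmf.prob p {\<omega>. A \<omega> = A (ws ! i)}))"
proof -
  have l: "length ws = n" and s: "\<And>i. i < n \<Longrightarrow> ws ! i \<in> set_pmf p" using assms by (auto simp: set_replicate_pmf)
  have "measure_pmf.prob (replicate_pmf n p) {ws'. map A ws' = map A ws} = (\<Prod>i<n. measure_pmf.prob p {\<omega>. A \<omega> = A (ws ! i)})"
    using l by (simp add: prob_map_replicate_pmf)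
  also have "\<dots> = (\<Prod>i<n. 2 powr log 2 (measure_pmf.prob p {\<omega>. A \<omega> = A (ws ! i)}))"
  proof (rule prod.cong[OF refl])
    fix i assume "i \<in> {..<n}"
    then show "measure_pmf.prob p {\<omega>. A \<omega> = A (ws ! i)} = 2 powr log 2 (measure_pmf.prob p {\<omega>. A \<omega> = A (ws ! i)})"
      using prob_level_pos[OF s, of i A] by simp
  qed
  finally show ?thesis by (simp add: powr_sum)
qed

lemma prob_map_pair_replicate:
  "measure_pmf.prob (replicate_pmf n p) {ws'. map A ws' = map A ws \<and> map C ws' = map C ws} =
   measure_pmf.prob (replicate_pmf n p) {ws'. map (\<lambda>\<omega>. (A \<omega>, C \<omega>)) ws' = map (\<lambda>\<omega>. (A \<omega>, C \<omega>)) ws}"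
  by (simp add: map_eq_map_iff_pair)

lemma weak_law_finite_family:
  assumes fin: "finite (set_pmf p)" and e: "e > 0" and d: "d > 0" and H: "finite H"
  shows "\<forall>\<^sub>F n in sequentially. measure_pmf.prob (replicate_pmf n p)
     {ws. \<exists>h\<in>H. (\<Sum>i<n. h (ws ! i)) > real n * (measure_pmf.expectation p h + e)} \<le> d"
proof -
  define d' where "d' = d / (card H + 1)"
  have d': "d' > 0" using d unfolding d'_def by simp
  have "\<forall>\<^sub>F n in sequentially. \<forall>h\<in>H. measure_pmf.prob (replicate_pmf n p)
     {ws. \<bar>(\<Sum>i<n. h (ws ! i)) - real n * measure_pmf.expectation p h\<bar> > real n * e} \<le> d'"
    by (rule eventually_ball_finite[OF H]) (use weak_law_large_numbers[OF fin e d'] in blast)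
  then show ?thesis
  proof eventually_elim
    case (elim n)
    let ?P = "measure_pmf.prob (replicate_pmf n p)"
    have "?P {ws. \<exists>h\<in>H. (\<Sum>i<n. h (ws ! i)) > real n * (measure_pmf.expectation p h + e)}
      = ?P (\<Union>h\<in>H. {ws. (\<Sum>i<n. h (ws ! i)) > real n * (measure_pmf.expectation p h + e)})"
      by (rule arg_cong[where f = ?P]) auto
    also have "\<dots> \<le> (\<Sum>h\<in>H. ?P {ws. (\<Sum>i<n. h (ws ! i)) > real n * (measure_pmf.expectation p h + e)})"
      by (rule measure_UNION_le) (use H in auto)
    also have "\<dots> \<le> (\<Sum>h\<in>H. d')"
    proof (rule sum_mono)
      fix h assume h: "h \<in> H"
      have "?P {ws. (\<Sum>i<n. h (ws ! i)) > real n * (measure_pmf.expectation p h + e)}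
         \<le> ?P {ws. \<bar>(\<Sum>i<n. h (ws ! i)) - real n * measure_pmf.expectation p h\<bar> > real n * e}"
        by (rule prob_mono_supp) (auto simp: algebra_simps)
      also have "\<dots> \<le> d'" using elim h by blast
      finally show "?P {ws. (\<Sum>i<n. h (ws ! i)) > real n * (measure_pmf.expectation p h + e)} \<le> d'" .
    qed
    also have "\<dots> \<le> d" using d by (simp add: d'_def field_simps)
    finally show ?case .
  qed
qed

text \<open>Typical means here that both information densities and all costs in \<open>G\<close>
  stay below their means plus a margin; one-sided bounds suffice. \<open>G\<close> is left open so
  that the costs of describing the observations can be supplied later.\<close>

lemma block_covering:
  fixes V :: "'w \<Rightarrow> 'v" and U :: "'w \<Rightarrow> 'u" and X :: "'w \<Rightarrow> 'x" and G :: "('v \<Rightarrow> 'u \<Rightarrow> 'x \<Rightarrow> real) set"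
  assumes fin: "finite (set_pmf p)" and e: "e > 0" and d: "d > 0" and finG: "finite G"
  defines "I1 \<equiv> sh p V - shc p V X"
    and "I2 \<equiv> shc p U V - shc p U (\<lambda>\<omega>. (V \<omega>, X \<omega>))"
  shows "\<forall>\<^sub>F m in sequentially. \<exists>cv cu \<alpha> \<beta> K.
     (\<forall>xs\<in>K. \<alpha> xs < nat \<lceil>2 powr (real m * (I1 + e))\<rceil> \<and> \<beta> xs < nat \<lceil>2 powr (real m * (I2 + e))\<rceil> \<and>
        (\<exists>ws\<in>set_pmf (replicate_pmf m p). map V ws = cv (\<alpha> xs) \<and> map U ws = cu (\<alpha> xs) (\<beta> xs) \<and> map X ws = xs \<and>
           (\<forall>g\<in>G. (\<Sum>i<m. g (V (ws ! i)) (U (ws ! i)) (X (ws ! i))) \<le> real m * (measure_pmf.expectation p (\<lambda>\<omega>. g (V \<omega>) (U \<omega>) (X \<omega>)) + e)))) \<and>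
     measure_pmf.prob (replicate_pmf m p) {ws. map X ws \<notin> K} \<le> d"
proof -
  let ?P = "measure_pmf.prob p"
  let ?E = "measure_pmf.expectation p"
  \<comment> \<open>\<open>i1\<close> and \<open>i2\<close> are the information densities of
    \<open>V\<close> and \<open>X\<close>, and of \<open>U\<close> and \<open>X\<close> given
    \<open>V\<close>, with means \<open>I1\<close> and \<open>I2\<close>. As sums of logarithms they
    add up along a sequence to the exponents in \<open>dens1\<close> and
    \<open>dens2\<close>.\<close>
  define i1 where "i1 = (\<lambda>v x. log 2 (?P {\<omega>. V \<omega> = v \<and> X \<omega> = x}) - (log 2 (?P {\<omega>. V \<omega> = v}) + log 2 (?P {\<omega>. X \<omega> = x})))"
  define i2 where "i2 = (\<lambda>v u x. log 2 (?P {\<omega>. U \<omega> = u \<and> V \<omega> = v \<and> X \<omega> = x}) + log 2 (?P {\<omega>. V \<omega> = v})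
       - (log 2 (?P {\<omega>. U \<omega> = u \<and> V \<omega> = v}) + log 2 (?P {\<omega>. V \<omega> = v \<and> X \<omega> = x})))"
  define f1 where "f1 = (\<lambda>\<omega>. i1 (V \<omega>) (X \<omega>))"
  define f2 where "f2 = (\<lambda>\<omega>. i2 (V \<omega>) (U \<omega>) (X \<omega>))"
  define fg where "fg = (\<lambda>g \<omega>. g (V \<omega>) (U \<omega>) (X \<omega>) :: real)"
  have int: "integrable (measure_pmf p) (h :: _ \<Rightarrow> real)" for h
    by (simp add: integrable_measure_pmf_finite fin)
  have E1: "?E f1 = I1"
    unfolding f1_def i1_def I1_def shc_def sh_def
    by (simp add: Bochner_Integration.integral_diff[OF int int] Bochner_Integration.integral_add[OF int int])
  have E2: "?E f2 = I2"
    unfolding f2_def i2_def I2_def shc_def sh_def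
    by (simp add: Bochner_Integration.integral_diff[OF int int] Bochner_Integration.integral_add[OF int int])
  define H where "H = insert f1 (insert f2 (fg ` G))"
  have H: "finite H" unfolding H_def using finG by simp
  \<comment> \<open>The failure bound becomes \<open>4 * (d / 8) + d / 4 + d / 4 = d\<close>.
    Typicality uses the margin \<open>e / 2\<close> and the codebooks have rate excess
    \<open>e\<close>; the other half of it drives the exponentials to zero.\<close>
  have ev1: "\<forall>\<^sub>F m in sequentially. measure_pmf.prob (replicate_pmf m p)
     {ws. \<exists>h\<in>H. (\<Sum>i<m. h (ws ! i)) > real m * (?E h + e / 2)} \<le> d / 8"
    by (rule weak_law_finite_family[OF fin _ _ H]) (use e d in auto)
  have "((\<lambda>m. exp (- (2 powr (real m * (e/2)) / 2))) \<longlongrightarrow> 0) sequentially"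
  proof -
    have "filterlim (\<lambda>m. real m * (e/2) * ln 2) at_top sequentially"
      by (intro filterlim_at_top_mult_tendsto_pos[OF tendsto_const] filterlim_at_top_mult_tendsto_pos[OF tendsto_const] filterlim_real_sequentially)
         (use e in auto)
    then have "filterlim (\<lambda>m. exp (real m * (e/2) * ln 2)) at_top sequentially"
      by (rule filterlim_compose[OF exp_at_top])
    then have "filterlim (\<lambda>m. exp (real m * (e/2) * ln 2) * (1/2)) at_top sequentially"
      by (rule filterlim_at_top_mult_tendsto_pos[OF tendsto_const, rotated]) simp
    then have "filterlim (\<lambda>m. - (exp (real m * (e/2) * ln 2) * (1/2))) at_bot sequentially"
      by (simp add: filterlim_uminus_at_top)
    then have "((\<lambda>m. exp (- (exp (real m * (e/2) * ln 2) * (1/2)))) \<longlongrightarrow> 0) sequentially"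
      by (rule filterlim_compose[OF exp_at_bot])
    then show ?thesis by (simp add: powr_def)
  qed
  then have ev2: "\<forall>\<^sub>F m in sequentially. exp (- (2 powr (real m * (e/2)) / 2)) < d / 4"
    by (rule order_tendstoD(2)) (use d in simp)
  show ?thesis using ev1 ev2
  proof eventually_elim
    case (elim m)
    let ?R = "replicate_pmf m p"
    have finR: "finite (set_pmf ?R)" by (simp add: fin finite_set_replicate_pmf)
    define T where "T = (\<lambda>vs us xs. (\<Sum>i<m. i1 (vs ! i) (xs ! i)) \<le> real m * (I1 + e/2) \<and>
        (\<Sum>i<m. i2 (vs ! i) (us ! i) (xs ! i)) \<le> real m * (I2 + e/2) \<and>
        (\<forall>g\<in>G. (\<Sum>i<m. g (vs ! i) (us ! i) (xs ! i)) \<le> real m * (?E (fg g) + e/2)))"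
    define g1 where "g1 = 2 powr (real m * (I1 + e/2))"
    define g2 where "g2 = 2 powr (real m * (I2 + e/2))"
    define M1 where "M1 = nat \<lceil>2 powr (real m * (I1 + e))\<rceil>"
    define M2 where "M2 = nat \<lceil>2 powr (real m * (I2 + e))\<rceil>"
    have T_iff: "T (map V ws) (map U ws) (map X ws) \<longleftrightarrow> (\<Sum>i<m. f1 (ws ! i)) \<le> real m * (I1 + e/2) \<and>
        (\<Sum>i<m. f2 (ws ! i)) \<le> real m * (I2 + e/2) \<and> (\<forall>g\<in>G. (\<Sum>i<m. fg g (ws ! i)) \<le> real m * (?E (fg g) + e/2))"
      if "ws \<in> set_pmf ?R" for ws
      using length_replicate_pmf[OF that] unfolding T_def f1_def f2_def fg_def by simp
    have PT: "measure_pmf.prob ?R {ws. \<not> T (map V ws) (map U ws) (map X ws)} \<le> d / 8"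
    proof (rule order_trans[OF prob_mono_supp elim(1)])
      fix ws assume ws: "ws \<in> set_pmf ?R" "ws \<in> {ws. \<not> T (map V ws) (map U ws) (map X ws)}"
      then have "\<not> ((\<Sum>i<m. f1 (ws ! i)) \<le> real m * (I1 + e/2) \<and>
        (\<Sum>i<m. f2 (ws ! i)) \<le> real m * (I2 + e/2) \<and> (\<forall>g\<in>G. (\<Sum>i<m. fg g (ws ! i)) \<le> real m * (?E (fg g) + e/2)))"
        using T_iff[OF ws(1)] by simp
      then show "ws \<in> {ws. \<exists>h\<in>H. (\<Sum>i<m. h (ws ! i)) > real m * (?E h + e / 2)}"
        unfolding H_def by (auto simp: not_le E1 E2)
    qed
    have "\<exists>cv cu \<alpha> \<beta> K. (\<forall>xs\<in>K. \<alpha> xs < M1 \<and> \<beta> xs < M2 \<and>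
       (\<exists>ws\<in>set_pmf ?R. map V ws = cv (\<alpha> xs) \<and> map U ws = cu (\<alpha> xs) (\<beta> xs) \<and> map X ws = xs \<and> T (cv (\<alpha> xs)) (cu (\<alpha> xs) (\<beta> xs)) xs)) \<and>
     measure_pmf.prob ?R {ws. map X ws \<notin> K} \<le> 4 * measure_pmf.prob ?R {ws. \<not> T (map V ws) (map U ws) (map X ws)}
        + exp (- (real M1 / (2 * g1))) + exp (- (real M2 / (2 * g2)))"
    proof (rule superposition_covering[OF finR])
      show "g1 > 0" "g2 > 0" by (simp_all add: g1_def g2_def)
    next
      fix ws assume ws: "ws \<in> set_pmf ?R" and T: "T (map V ws) (map U ws) (map X ws)"
      note pw = prob_map_replicate_powr[OF ws]
      have S1: "(\<Sum>i<m. f1 (ws ! i)) \<le> real m * (I1 + e/2)" using T T_iff[OF ws] by simp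
      have "measure_pmf.prob ?R {ws'. map V ws' = map V ws \<and> map X ws' = map X ws} =
        2 powr ((\<Sum>i<m. f1 (ws ! i)) + ((\<Sum>i<m. log 2 (?P {\<omega>. V \<omega> = V (ws ! i)})) + (\<Sum>i<m. log 2 (?P {\<omega>. X \<omega> = X (ws ! i)}))))"
        unfolding prob_map_pair_replicate pw f1_def i1_def sum.distrib[symmetric] by simp
      also have "\<dots> = 2 powr (\<Sum>i<m. f1 (ws ! i)) * (measure_pmf.prob ?R {ws'. map V ws' = map V ws} * measure_pmf.prob ?R {ws'. map X ws' = map X ws})"
        unfolding powr_add pw ..
      also have "\<dots> \<le> g1 * (measure_pmf.prob ?R {ws'. map V ws' = map V ws} * measure_pmf.prob ?R {ws'. map X ws' = map X ws})"
        by (rule mult_right_mono) (use S1 in \<open>auto simp: g1_def\<close>)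
      finally show "measure_pmf.prob ?R {ws'. map V ws' = map V ws \<and> map X ws' = map X ws} \<le>
          g1 * (measure_pmf.prob ?R {ws'. map V ws' = map V ws} * measure_pmf.prob ?R {ws'. map X ws' = map X ws})" .
    next
      fix ws assume ws: "ws \<in> set_pmf ?R" and T: "T (map V ws) (map U ws) (map X ws)"
      note pw = prob_map_replicate_powr[OF ws]
      have S2: "(\<Sum>i<m. f2 (ws ! i)) \<le> real m * (I2 + e/2)" using T T_iff[OF ws] by simp
      have uvx: "measure_pmf.prob ?R {ws'. map U ws' = map U ws \<and> map V ws' = map V ws \<and> map X ws' = map X ws}
          = 2 powr (\<Sum>i<m. log 2 (?P {\<omega>. U \<omega> = U (ws ! i) \<and> V \<omega> = V (ws ! i) \<and> X \<omega> = X (ws ! i)}))"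
        using pw[of "\<lambda>\<omega>. (U \<omega>, V \<omega>, X \<omega>)"] by (simp add: map_eq_map_iff_pair)
      have uv: "measure_pmf.prob ?R {ws'. map U ws' = map U ws \<and> map V ws' = map V ws}
          = 2 powr (\<Sum>i<m. log 2 (?P {\<omega>. U \<omega> = U (ws ! i) \<and> V \<omega> = V (ws ! i)}))"
        using pw[of "\<lambda>\<omega>. (U \<omega>, V \<omega>)"] by (simp add: map_eq_map_iff_pair)
      have vx: "measure_pmf.prob ?R {ws'. map V ws' = map V ws \<and> map X ws' = map X ws}
          = 2 powr (\<Sum>i<m. log 2 (?P {\<omega>. V \<omega> = V (ws ! i) \<and> X \<omega> = X (ws ! i)}))"
        using pw[of "\<lambda>\<omega>. (V \<omega>, X \<omega>)"] by (simp add: map_eq_map_iff_pair)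
      have "measure_pmf.prob ?R {ws'. map U ws' = map U ws \<and> map V ws' = map V ws \<and> map X ws' = map X ws} * measure_pmf.prob ?R {ws'. map V ws' = map V ws}
        = 2 powr (\<Sum>i<m. f2 (ws ! i)) * (measure_pmf.prob ?R {ws'. map U ws' = map U ws \<and> map V ws' = map V ws} * measure_pmf.prob ?R {ws'. map V ws' = map V ws \<and> map X ws' = map X ws})"
        unfolding uvx uv vx pw[of V] f2_def i2_def powr_add[symmetric] sum.distrib[symmetric] by simp
      also have "\<dots> \<le> g2 * (measure_pmf.prob ?R {ws'. map U ws' = map U ws \<and> map V ws' = map V ws} * measure_pmf.prob ?R {ws'. map V ws' = map V ws \<and> map X ws' = map X ws})"
        by (rule mult_right_mono) (use S2 in \<open>auto simp: g2_def\<close>)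
      finally show "measure_pmf.prob ?R {ws'. map U ws' = map U ws \<and> map V ws' = map V ws \<and> map X ws' = map X ws} * measure_pmf.prob ?R {ws'. map V ws' = map V ws}
        \<le> g2 * (measure_pmf.prob ?R {ws'. map U ws' = map U ws \<and> map V ws' = map V ws} * measure_pmf.prob ?R {ws'. map V ws' = map V ws \<and> map X ws' = map X ws})" .
    qed
    then obtain cv cu \<alpha> \<beta> K where K: "\<And>xs. xs \<in> K \<Longrightarrow> \<alpha> xs < M1 \<and> \<beta> xs < M2 \<and>
       (\<exists>ws\<in>set_pmf ?R. map V ws = cv (\<alpha> xs) \<and> map U ws = cu (\<alpha> xs) (\<beta> xs) \<and> map X ws = xs \<and> T (cv (\<alpha> xs)) (cu (\<alpha> xs) (\<beta> xs)) xs)"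
      and PK: "measure_pmf.prob ?R {ws. map X ws \<notin> K} \<le> 4 * measure_pmf.prob ?R {ws. \<not> T (map V ws) (map U ws) (map X ws)}
        + exp (- (real M1 / (2 * g1))) + exp (- (real M2 / (2 * g2)))" by blast
    have ratio: "exp (- (real (nat \<lceil>2 powr (real m * (I + e))\<rceil>) / (2 * 2 powr (real m * (I + e/2))))) < d / 4" for I
    proof -
      have "2 powr (real m * (e/2)) / 2 = 2 powr (real m * (I + e)) / (2 * 2 powr (real m * (I + e/2)))"
        by (simp add: powr_diff[symmetric] algebra_simps field_simps flip: powr_add)
      also have "\<dots> \<le> real (nat \<lceil>2 powr (real m * (I + e))\<rceil>) / (2 * 2 powr (real m * (I + e/2)))"
        by (rule divide_right_mono) (auto intro: real_nat_ceiling_ge)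
      finally show ?thesis using elim(2) by (smt (verit) exp_le_cancel_iff)
    qed
    have P: "measure_pmf.prob ?R {ws. map X ws \<notin> K} \<le> d"
      using PK PT ratio[of I1] ratio[of I2] unfolding M1_def M2_def g1_def g2_def by linarith
    show ?case
    proof (intro exI conjI ballI)
      fix xs assume xs: "xs \<in> K"
      show "\<alpha> xs < nat \<lceil>2 powr (real m * (I1 + e))\<rceil>" "\<beta> xs < nat \<lceil>2 powr (real m * (I2 + e))\<rceil>"
        using K[OF xs] unfolding M1_def M2_def by auto
      obtain ws where ws: "ws \<in> set_pmf ?R" "map V ws = cv (\<alpha> xs)" "map U ws = cu (\<alpha> xs) (\<beta> xs)" "map X ws = xs"
         "T (map V ws) (map U ws) (map X ws)" using K[OF xs] by metis
      have "(\<Sum>i<m. g (V (ws ! i)) (U (ws ! i)) (X (ws ! i))) \<le> real m * (?E (\<lambda>\<omega>. g (V \<omega>) (U \<omega>) (X \<omega>)) + e)" if g: "g \<in> G" for g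
      proof -
        have "(\<Sum>i<m. g (V (ws ! i)) (U (ws ! i)) (X (ws ! i))) \<le> real m * (?E (\<lambda>\<omega>. g (V \<omega>) (U \<omega>) (X \<omega>)) + e / 2)"
          using ws(5) g unfolding T_iff[OF ws(1)] unfolding fg_def by blast
        also have "\<dots> \<le> real m * (?E (\<lambda>\<omega>. g (V \<omega>) (U \<omega>) (X \<omega>)) + e)"
          by (rule mult_left_mono) (use e in auto)
        finally show ?thesis .
      qed
      then show "\<exists>ws\<in>set_pmf ?R. map V ws = cv (\<alpha> xs) \<and> map U ws = cu (\<alpha> xs) (\<beta> xs) \<and> map X ws = xs \<and>
           (\<forall>g\<in>G. (\<Sum>i<m. g (V (ws ! i)) (U (ws ! i)) (X (ws ! i))) \<le> real m * (?E (\<lambda>\<omega>. g (V \<omega>) (U \<omega>) (X \<omega>)) + e))"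
        using ws by blast
    qed (rule P)
  qed
qed

section \<open>Entropies of codeword indices\<close>

lemma expectation_swap:
  assumes "finite (set_pmf p)" "finite (set_pmf q)"
  shows "measure_pmf.expectation p (\<lambda>x. measure_pmf.expectation q (h x)) =
     (measure_pmf.expectation q (\<lambda>y. measure_pmf.expectation p (\<lambda>x. h x y)) :: real)"
  using assms by (simp add: integral_measure_pmf sum_distrib_left) (subst sum.swap, simp add: mult_ac)

text \<open>The Markov chain \<open>w - X - \<omega>\<close>: the test channel \<open>K\<close> sees
  the outcome only through \<open>X\<close>.\<close>

definition adjoin :: "'w pmf \<Rightarrow> ('w \<Rightarrow> 'x) \<Rightarrow> ('x \<Rightarrow> 'c pmf) \<Rightarrow> ('c \<times> 'w) pmf" where
  "adjoin L X K = L \<bind> (\<lambda>\<omega>. map_pmf (\<lambda>w. (w, \<omega>)) (K (X \<omega>)))"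

lemma set_adjoin: "set_pmf (adjoin L X K) = {(w, \<omega>). \<omega> \<in> set_pmf L \<and> w \<in> set_pmf (K (X \<omega>))}"
  unfolding adjoin_def by auto

lemma map_snd_adjoin: "map_pmf snd (adjoin L X K) = L"
  unfolding adjoin_def by (simp add: map_bind_pmf pmf.map_comp o_def bind_return_pmf')

lemma map_adjoin: "map_pmf (\<lambda>(w, \<omega>). (w, X \<omega>)) (adjoin L X K) = map_pmf X L \<bind> (\<lambda>x. map_pmf (\<lambda>w. (w, x)) (K x))"
  unfolding adjoin_def by (simp add: map_bind_pmf bind_map_pmf pmf.map_comp o_def)

context
  fixes L :: "'w pmf" and X :: "'w \<Rightarrow> 'x" and K :: "'x \<Rightarrow> 'c pmf"
  assumes finL: "finite (set_pmf L)" and finK: "\<And>x. finite (set_pmf (K x))"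
begin

lemma finite_set_adjoin: "finite (set_pmf (adjoin L X K))"
  unfolding adjoin_def using finL finK by auto

lemma expectation_adjoin:
  "measure_pmf.expectation (adjoin L X K) f = measure_pmf.expectation L (\<lambda>\<omega>. measure_pmf.expectation (K (X \<omega>)) (\<lambda>w. f (w, \<omega>)) :: real)"
  unfolding adjoin_def by (subst expectation_bind_finite) (auto simp: finL finK)

text \<open>Once the observation fixes \<open>X\<close>, it says nothing more about the adjoined
  letter, whose law is then \<open>K x\<close>.\<close>

lemma prob_adjoin:
  assumes "\<And>\<omega>. \<omega> \<in> set_pmf L \<Longrightarrow> O' \<omega> = ob \<Longrightarrow> X \<omega> = x"
  shows "measure_pmf.prob (adjoin L X K) {p. h (fst p) = a \<and> O' (snd p) = ob}
      = measure_pmf.prob L {\<omega>. O' \<omega> = ob} * measure_pmf.prob (K x) {w. h w = a}"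
proof -
  have "measure_pmf.prob (adjoin L X K) {p. h (fst p) = a \<and> O' (snd p) = ob} =
    measure_pmf.expectation (adjoin L X K) (indicat_real {p. h (fst p) = a \<and> O' (snd p) = ob})" by simp
  also have "\<dots> = measure_pmf.expectation L (\<lambda>\<omega>. indicat_real {\<omega>. O' \<omega> = ob} \<omega> * measure_pmf.prob (K x) {w. h w = a})"
    unfolding expectation_adjoin
  proof (rule expectation_cong_supp)
    fix \<omega> assume w: "\<omega> \<in> set_pmf L"
    show "measure_pmf.expectation (K (X \<omega>)) (\<lambda>w. indicat_real {p. h (fst p) = a \<and> O' (snd p) = ob} (w, \<omega>)) =
        indicat_real {\<omega>. O' \<omega> = ob} \<omega> * measure_pmf.prob (K x) {w. h w = a}"
    proof (cases "O' \<omega> = ob")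
      case True
      have "(\<lambda>w. indicat_real {p. h (fst p) = a \<and> O' (snd p) = ob} (w, \<omega>)) = indicat_real {w. h w = a}"
        using True by (auto simp: indicator_def)
      then show ?thesis using True assms[OF w True] by simp
    qed (simp add: indicator_def)
  qed
  finally show ?thesis by simp
qed

lemma shc_adjoin_kernel:
  assumes Q: "\<And>\<omega> \<omega>'. Q \<omega> = Q \<omega>' \<Longrightarrow> X \<omega> = X \<omega>'"
  shows "shc (adjoin L X K) (\<lambda>p. h (fst p)) (\<lambda>p. Q (snd p))
      = measure_pmf.expectation (adjoin L X K) (\<lambda>p. - log 2 (measure_pmf.prob (K (X (snd p))) {w. h w = h (fst p)}))"
  unfolding shc_expectation[OF finite_set_adjoin]
proof (rule expectation_cong_supp)
  let ?F = "adjoin L X K"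
  fix p assume p: "p \<in> set_pmf ?F"
  then have w: "snd p \<in> set_pmf L" by (auto simp: set_adjoin)
  have m: "measure_pmf.prob ?F {p'. Q (snd p') = Q (snd p)} = measure_pmf.prob L {\<omega>. Q \<omega> = Q (snd p)}"
    by (subst (2) map_snd_adjoin[of L X K, symmetric]) (simp add: vimage_def)
  have pa: "measure_pmf.prob ?F {p'. h (fst p') = h (fst p) \<and> Q (snd p') = Q (snd p)} =
      measure_pmf.prob L {\<omega>. Q \<omega> = Q (snd p)} * measure_pmf.prob (K (X (snd p))) {w. h w = h (fst p)}"
    by (rule prob_adjoin) (rule Q)
  show "- log 2 (measure_pmf.prob ?F {p'. h (fst p') = h (fst p) \<and> Q (snd p') = Q (snd p)} / measure_pmf.prob ?F {p'. Q (snd p') = Q (snd p)}) =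
     - log 2 (measure_pmf.prob (K (X (snd p))) {w. h w = h (fst p)})"
    unfolding m pa using prob_level_pos[OF w, of Q] by simp
qed

lemma shc_adjoin_markov:
  "shc (adjoin L X K) (\<lambda>p. h (fst p)) (\<lambda>p. (X (snd p), O' (snd p))) = shc (adjoin L X K) (\<lambda>p. h (fst p)) (\<lambda>p. X (snd p))"
  using shc_adjoin_kernel[of "\<lambda>\<omega>. (X \<omega>, O' \<omega>)" h] shc_adjoin_kernel[of X h] by simp

text \<open>
  The number of bits that describe \<open>D\<close> when \<open>E\<close> and a codeword letter are known. Codewords are only
  used where the probabilities are positive, so the junk value of \<open>log\<close> at 0 never matters.
\<close>

definition letter_cost :: "('c \<Rightarrow> 'h) \<Rightarrow> ('w \<Rightarrow> 'd) \<Rightarrow> ('w \<Rightarrow> 'e) \<Rightarrow> 'h \<Rightarrow> 'w \<Rightarrow> real" where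
  "letter_cost h D E a \<omega> = - log 2 (measure_pmf.prob (adjoin L X K) {p. D (snd p) = D \<omega> \<and> h (fst p) = a \<and> E (snd p) = E \<omega>}
      / measure_pmf.prob (adjoin L X K) {p. h (fst p) = a \<and> E (snd p) = E \<omega>})"

text \<open>Typicality controls functions of the codeword letter and of \<open>X\<close>, not of the
  observation. Replacing the cost by its conditional mean given \<open>X\<close> makes it such a
  function; by the Markov chain the expectation stays that of the cost itself, which is a
  conditional entropy.\<close>

lemma expectation_letter_cost:
  "measure_pmf.expectation (adjoin L X K) (\<lambda>p. cond_mean L X (letter_cost h D E (h (fst p))) (X (snd p)))
     = shc (adjoin L X K) (\<lambda>p. D (snd p)) (\<lambda>p. (h (fst p), E (snd p)))"
proof -
  have "measure_pmf.expectation (K x) (\<lambda>w. cond_mean L X (letter_cost h D E (h w)) x)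
      = cond_mean L X (\<lambda>\<omega>. measure_pmf.expectation (K x) (\<lambda>w. letter_cost h D E (h w) \<omega>)) x" for x
    unfolding cond_mean_def by (simp add: expectation_swap[OF finK finL])
  then have "measure_pmf.expectation (adjoin L X K) (\<lambda>p. cond_mean L X (letter_cost h D E (h (fst p))) (X (snd p)))
    = measure_pmf.expectation L (\<lambda>\<omega>. measure_pmf.expectation (K (X \<omega>)) (\<lambda>w. letter_cost h D E (h w) \<omega>))"
    unfolding expectation_adjoin
    using expectation_cond_mean[OF finL, of "\<lambda>x \<omega>. measure_pmf.expectation (K x) (\<lambda>w. letter_cost h D E (h w) \<omega>)" X]
    by simp
  also have "\<dots> = measure_pmf.expectation (adjoin L X K) (\<lambda>p. letter_cost h D E (h (fst p)) (snd p))"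
    unfolding expectation_adjoin by simp
  also have "\<dots> = shc (adjoin L X K) (\<lambda>p. D (snd p)) (\<lambda>p. (h (fst p), E (snd p)))"
    unfolding shc_expectation[OF finite_set_adjoin] letter_cost_def by simp
  finally show ?thesis .
qed

end

section \<open>Descriptions along codewords\<close>

lemma sum_lists_prod:
  assumes "finite S"
  shows "(\<Sum>ds\<in>{ds. set ds \<subseteq> S \<and> length ds = m}. \<Prod>i<m. q i (ds ! i)) = (\<Prod>i<m. \<Sum>d\<in>S. q i d :: real)"
proof (induction m arbitrary: q)
  case 0
  have "{ds. set ds \<subseteq> S \<and> length ds = 0} = {[]}" by auto
  then show ?case by simp
next
  case (Suc m)
  have "(\<Sum>ds\<in>{ds. set ds \<subseteq> S \<and> length ds = Suc m}. \<Prod>i<Suc m. q i (ds ! i)) =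
    (\<Sum>(ds, d)\<in>{ds. set ds \<subseteq> S \<and> length ds = m} \<times> S. q 0 d * (\<Prod>i<m. q (Suc i) (ds ! i)))"
    unfolding lists_length_Suc_eq
    by (subst sum.reindex) (auto simp: inj_on_def prod.lessThan_Suc_shift case_prod_unfold simp del: prod.lessThan_Suc intro!: sum.cong)
  also have "\<dots> = (\<Sum>d\<in>S. q 0 d) * (\<Sum>ds\<in>{ds. set ds \<subseteq> S \<and> length ds = m}. \<Prod>i<m. q (Suc i) (ds ! i))"
    by (simp add: sum.cartesian_product[symmetric] sum_product sum.swap[of _ S])
  also have "\<dots> = (\<Prod>i<Suc m. \<Sum>d\<in>S. q i d)"
    by (simp add: Suc.IH[of "\<lambda>i. q (Suc i)"] prod.lessThan_Suc_shift del: prod.lessThan_Suc)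
  finally show ?case .
qed

text \<open>
  The description of \<open>D\<^sup>m\<close> by letter costs along the codeword; for the \<open>bad\<close> indices, which have no
  codeword, it is the uniform one.
\<close>

lemma shc_block_index:
  fixes L :: "'w pmf" and X :: "'w \<Rightarrow> 'x" and K :: "'x \<Rightarrow> 'c pmf" and h :: "'c \<Rightarrow> 'h" and cw :: "'b \<Rightarrow> 'h list"
  assumes finL: "finite (set_pmf L)" and finK: "\<And>x. finite (set_pmf (K x))"
    and e: "e \<ge> 0"
    and good: "\<And>xs. xs \<in> map X ` set_pmf (replicate_pmf m L) \<Longrightarrow> \<not> bad (C xs) \<Longrightarrow>
        length (cw (C xs)) = m \<and> (\<forall>i<m. cw (C xs) ! i \<in> h ` set_pmf (K (xs ! i))) \<and>
        (\<Sum>i<m. cond_mean L X (letter_cost L X K h D E (cw (C xs) ! i)) (xs ! i))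
           \<le> real m * (shc (adjoin L X K) (\<lambda>p. D (snd p)) (\<lambda>p. (h (fst p), E (snd p))) + e)"
    and bad: "measure_pmf.prob (replicate_pmf m L) {ws. bad (C (map X ws))} \<le> \<eta>"
    and S: "finite S" "D ` set_pmf L \<subseteq> S"
  shows "shc (replicate_pmf m L) (map D) (\<lambda>ws. (C (map X ws), map E ws)) \<le>
     real m * (shc (adjoin L X K) (\<lambda>p. D (snd p)) (\<lambda>p. (h (fst p), E (snd p))) + e + \<eta> * log 2 (card S))"
proof -
  let ?R = "replicate_pmf m L"
  let ?F = "adjoin L X K"
  define H where "H = shc ?F (\<lambda>p. D (snd p)) (\<lambda>p. (h (fst p), E (snd p)))"
  have finR: "finite (set_pmf ?R)" by (simp add: finL finite_set_replicate_pmf)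
  have finF: "finite (set_pmf ?F)" by (rule finite_set_adjoin[OF finL finK])
  have H0: "H \<ge> 0" unfolding H_def by (rule shc_nonneg[OF finF])
  have Sne: "S \<noteq> {}" using S set_pmf_not_empty[of L] by auto
  define s where "s = real (card S)"
  have s: "s \<ge> 1" unfolding s_def using Sne S(1) by (simp add: Suc_le_eq card_gt_0_iff)
  define q1 where "q1 = (\<lambda>d a c. measure_pmf.prob ?F {p. D (snd p) = d \<and> h (fst p) = a \<and> E (snd p) = c}
      / measure_pmf.prob ?F {p. h (fst p) = a \<and> E (snd p) = c})"
  have q10: "q1 d a c \<ge> 0" for d a c unfolding q1_def by simp
  have q1s: "(\<Sum>d\<in>S. q1 d a c) \<le> 1" for a c
  proof -
    have "(\<Sum>d\<in>S. measure_pmf.prob ?F {p. D (snd p) = d \<and> h (fst p) = a \<and> E (snd p) = c}) =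
         measure_pmf.prob ?F (\<Union>d\<in>S. {p. D (snd p) = d \<and> h (fst p) = a \<and> E (snd p) = c})"
      by (rule measure_pmf.finite_measure_finite_Union[symmetric]) (use S in \<open>auto simp: disjoint_family_on_def\<close>)
    also have "\<dots> \<le> measure_pmf.prob ?F {p. h (fst p) = a \<and> E (snd p) = c}"
      by (rule measure_pmf.finite_measure_mono) auto
    finally show ?thesis
      unfolding q1_def sum_divide_distrib[symmetric]
      by (cases "measure_pmf.prob ?F {p. h (fst p) = a \<and> E (snd p) = c} = 0") (simp_all add: less_le)
  qed
  define q where "q = (\<lambda>ds (c, es). if bad c then (1/s) ^ m else \<Prod>i<m. q1 (ds ! i) (cw c ! i) (es ! i))"
  have q1cost: "- log 2 (q1 (D \<omega>) a (E \<omega>)) = letter_cost L X K h D E a \<omega>" for a \<omega>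
    unfolding q1_def letter_cost_def[OF finL finK] ..
  have q1pos: "q1 (D \<omega>) a (E \<omega>) > 0" if "\<omega> \<in> set_pmf L" "a \<in> h ` set_pmf (K (X \<omega>))" for a \<omega>
  proof -
    from that(2) obtain w where w: "w \<in> set_pmf (K (X \<omega>))" "a = h w" by auto
    then have p: "(w, \<omega>) \<in> set_pmf ?F" using that(1) by (simp add: set_adjoin)
    show ?thesis unfolding q1_def
      using prob_level_pos[OF p, of "\<lambda>p. (D (snd p), h (fst p), E (snd p))"] prob_level_pos[OF p, of "\<lambda>p. (h (fst p), E (snd p))"] w(2)
      by simp
  qed
  have good': "length (cw (C (map X ws))) = m" "\<And>i. i < m \<Longrightarrow> q1 (D (ws ! i)) (cw (C (map X ws)) ! i) (E (ws ! i)) > 0"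
      "length ws = m"
      "(\<Sum>i<m. cond_mean L X (letter_cost L X K h D E (cw (C (map X ws)) ! i)) (X (ws ! i))) \<le> real m * (H + e)"
    if "ws \<in> set_pmf ?R" "\<not> bad (C (map X ws))" for ws
  proof -
    have l: "length ws = m" and sL: "\<And>i. i < m \<Longrightarrow> ws ! i \<in> set_pmf L" using that(1) by (auto simp: set_replicate_pmf)
    note g = good[of "map X ws"]
    show "length (cw (C (map X ws))) = m" "length ws = m" using g that l by auto
    show "\<And>i. i < m \<Longrightarrow> q1 (D (ws ! i)) (cw (C (map X ws)) ! i) (E (ws ! i)) > 0"
      by (rule q1pos) (use g that l sL in auto)
    have "(\<Sum>i<m. cond_mean L X (letter_cost L X K h D E (cw (C (map X ws)) ! i)) (map X ws ! i)) \<le> real m * (H + e)"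
      using g that unfolding H_def by blast
    then show "(\<Sum>i<m. cond_mean L X (letter_cost L X K h D E (cw (C (map X ws)) ! i)) (X (ws ! i))) \<le> real m * (H + e)"
      using l by simp
  qed
  \<comment> \<open>In a block without codeword every letter gets the parameter \<open>None\<close>
    and cost 0; the uniform description of the block is charged separately through the indicator.
    The remaining cost then fits \<open>expectation_replicate_cond_mean\<close>, whose parameter may
    depend on \<open>X\<^sup>m\<close>.\<close>
  define \<Phi> where "\<Phi> = (\<lambda>b \<omega>. case b of None \<Rightarrow> 0 | Some a \<Rightarrow> letter_cost L X K h D E a \<omega>)"
  define Fc where "Fc = (\<lambda>xs i. if bad (C xs) then None else Some (cw (C xs) ! i))"
  have "shc ?R (map D) (\<lambda>ws. (C (map X ws), map E ws)) \<le> measure_pmf.expectation ?R (\<lambda>ws. - log 2 (q (map D ws) (C (map X ws), map E ws)))"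
  proof (rule shc_le_cross_entropy[OF finR])
    fix ws assume ws: "ws \<in> set_pmf ?R"
    show "0 < q (map D ws) (C (map X ws), map E ws)"
    proof (cases "bad (C (map X ws))")
      case True then show ?thesis using s by (simp add: q_def)
    next
      case False
      then show ?thesis using good'[OF ws False] by (auto simp: q_def intro!: prod_pos)
    qed
  next
    fix ds c
    show "0 \<le> q ds c" using s q10 by (auto simp: q_def split: prod.split intro!: prod_nonneg)
  next
    fix ce assume "ce \<in> (\<lambda>ws. (C (map X ws), map E ws)) ` set_pmf ?R"
    obtain c es where ce: "ce = (c, es)" by force
    have fl: "finite {ds. set ds \<subseteq> S \<and> length ds = m}" by (rule finite_lists_length_eq[OF S(1)])
    have "(\<Sum>ds\<in>map D ` set_pmf ?R. q ds ce) \<le> (\<Sum>ds\<in>{ds. set ds \<subseteq> S \<and> length ds = m}. q ds ce)"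
    proof (rule sum_mono2[OF fl])
      show "map D ` set_pmf ?R \<subseteq> {ds. set ds \<subseteq> S \<and> length ds = m}"
        using S(2) by (auto simp: set_replicate_pmf in_lists_conv_set image_subset_iff)
      show "\<And>ds. 0 \<le> q ds ce" using s q10 by (auto simp: q_def split: prod.split intro!: prod_nonneg)
    qed
    also have "\<dots> \<le> 1"
    proof (cases "bad c")
      case True
      then show ?thesis using s by (simp add: ce q_def card_lists_length_eq[OF S(1)] s_def power_one_over)
    next
      case False
      have "(\<Sum>ds\<in>{ds. set ds \<subseteq> S \<and> length ds = m}. q ds ce) = (\<Prod>i<m. \<Sum>d\<in>S. q1 d (cw c ! i) (es ! i))"
        using False sum_lists_prod[OF S(1), where m = m and q = "\<lambda>i d. q1 d (cw c ! i) (es ! i)"] by (simp add: ce q_def)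
      also have "\<dots> \<le> 1" by (rule prod_le_1) (use q1s q10 in \<open>auto intro: sum_nonneg\<close>)
      finally show ?thesis .
    qed
    finally show "(\<Sum>ds\<in>map D ` set_pmf ?R. q ds ce) \<le> 1" .
  qed
  also have "\<dots> = measure_pmf.expectation ?R (\<lambda>ws. indicat_real {ws. bad (C (map X ws))} ws * (real m * log 2 s) + (\<Sum>i<m. \<Phi> (Fc (map X ws) i) (ws ! i)))"
  proof (rule expectation_cong_supp)
    fix ws assume ws: "ws \<in> set_pmf ?R"
    show "- log 2 (q (map D ws) (C (map X ws), map E ws)) = indicat_real {ws. bad (C (map X ws))} ws * (real m * log 2 s) + (\<Sum>i<m. \<Phi> (Fc (map X ws) i) (ws ! i))"
    proof (cases "bad (C (map X ws))")
      case True
      then show ?thesis using s by (simp add: q_def Fc_def \<Phi>_def log_nat_power log_divide power_one_over)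
    next
      case False
      note g = good'[OF ws False]
      have "log 2 (\<Prod>i<m. q1 (D (ws ! i)) (cw (C (map X ws)) ! i) (E (ws ! i))) = (\<Sum>i<m. log 2 (q1 (D (ws ! i)) (cw (C (map X ws)) ! i) (E (ws ! i))))"
        unfolding log_def by (subst ln_prod) (use g(2) in \<open>auto simp: sum_divide_distrib less_le\<close>)
      then show ?thesis using False g(3)
        by (simp add: q_def Fc_def \<Phi>_def q1cost[symmetric] sum_negf)
    qed
  qed
  also have "\<dots> = measure_pmf.prob ?R {ws. bad (C (map X ws))} * (real m * log 2 s) + measure_pmf.expectation ?R (\<lambda>ws. \<Sum>i<m. \<Phi> (Fc (map X ws) i) (ws ! i))"
    by (subst Bochner_Integration.integral_add) (auto simp: integrable_measure_pmf_finite[OF finR])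
  also have "measure_pmf.expectation ?R (\<lambda>ws. \<Sum>i<m. \<Phi> (Fc (map X ws) i) (ws ! i)) =
      measure_pmf.expectation ?R (\<lambda>ws. \<Sum>i<m. cond_mean L X (\<Phi> (Fc (map X ws) i)) (X (ws ! i)))"
    by (rule expectation_replicate_cond_mean[OF finL])
  also have "\<dots> \<le> measure_pmf.expectation ?R (\<lambda>ws. real m * (H + e))"
  proof (rule expectation_mono_supp[OF finR])
    fix ws assume ws: "ws \<in> set_pmf ?R"
    show "(\<Sum>i<m. cond_mean L X (\<Phi> (Fc (map X ws) i)) (X (ws ! i))) \<le> real m * (H + e)"
    proof (cases "bad (C (map X ws))")
      case True
      have z: "cond_mean L X (\<Phi> None) x = 0" for x by (simp add: cond_mean_def \<Phi>_def)
      show ?thesis using True H0 e by (simp add: Fc_def z)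
    next
      case False
      have "\<Phi> (Some a) = letter_cost L X K h D E a" for a by (simp add: \<Phi>_def fun_eq_iff)
      then show ?thesis using good'(4)[OF ws False] False by (simp add: Fc_def)
    qed
  qed
  also have "measure_pmf.prob ?R {ws. bad (C (map X ws))} * (real m * log 2 s) + measure_pmf.expectation ?R (\<lambda>ws. real m * (H + e))
      \<le> \<eta> * (real m * log 2 s) + real m * (H + e)"
    using bad s by (simp add: mult_right_mono)
  finally show ?thesis unfolding H_def s_def by (simp add: algebra_simps)
qed

lemma sh_adjoin_snd: "sh (adjoin L X K) (\<lambda>p. A (snd p)) = sh L A"
  using sh_map[of snd "adjoin L X K" A] by (simp add: map_snd_adjoin)

lemma shc_adjoin_snd: "shc (adjoin L X K) (\<lambda>p. A (snd p)) (\<lambda>p. C (snd p)) = shc L A C"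
  using shc_map[of snd "adjoin L X K" A C] by (simp add: map_snd_adjoin)

text \<open>
  The lower bound is \<open>H(C | O\<^sup>m) = H(X\<^sup>m | O\<^sup>m) - H(X\<^sup>m | C, O\<^sup>m)\<close>, the index \<open>C\<close> being a function of \<open>X\<^sup>m\<close>;
  the upper bound is \<open>H(C | O\<^sup>m) = H(C) + H(O\<^sup>m | C) - H(O\<^sup>m)\<close>.
\<close>

lemma block_index_entropy:
  fixes L :: "'w pmf" and X :: "'w \<Rightarrow> 'x" and K :: "'x \<Rightarrow> 'c pmf" and h :: "'c \<Rightarrow> 'h"
    and cw :: "'b \<Rightarrow> 'h list" and Ob :: "'w \<Rightarrow> 'o"
  assumes finL: "finite (set_pmf L)" and finK: "\<And>x. finite (set_pmf (K x))"
    and e: "e \<ge> 0"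
    and good: "\<And>xs. xs \<in> map X ` set_pmf (replicate_pmf m L) \<Longrightarrow> \<not> bad (C xs) \<Longrightarrow>
        length (cw (C xs)) = m \<and> (\<forall>i<m. cw (C xs) ! i \<in> h ` set_pmf (K (xs ! i)))"
    and good_lo: "\<And>xs. xs \<in> map X ` set_pmf (replicate_pmf m L) \<Longrightarrow> \<not> bad (C xs) \<Longrightarrow>
        (\<Sum>i<m. cond_mean L X (letter_cost L X K h X Ob (cw (C xs) ! i)) (xs ! i))
           \<le> real m * (shc (adjoin L X K) (\<lambda>p. X (snd p)) (\<lambda>p. (h (fst p), Ob (snd p))) + e)"
    and good_hi: "\<And>xs. xs \<in> map X ` set_pmf (replicate_pmf m L) \<Longrightarrow> \<not> bad (C xs) \<Longrightarrow>
        (\<Sum>i<m. cond_mean L X (letter_cost L X K h Ob (\<lambda>_. ()) (cw (C xs) ! i)) (xs ! i))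
           \<le> real m * (shc (adjoin L X K) (\<lambda>p. Ob (snd p)) (\<lambda>p. (h (fst p), ())) + e)"
    and bad: "measure_pmf.prob (replicate_pmf m L) {ws. bad (C (map X ws))} \<le> \<eta>" and \<eta>: "\<eta> \<ge> 0"
    and \<kappa>: "log 2 (card (X ` set_pmf L)) \<le> \<kappa>" "log 2 (card (Ob ` set_pmf L)) \<le> \<kappa>"
    and T: "finite T" "C ` map X ` set_pmf (replicate_pmf m L) \<subseteq> T"
       "log 2 (card T) \<le> real m * (sh (adjoin L X K) (\<lambda>p. h (fst p)) - shc (adjoin L X K) (\<lambda>p. h (fst p)) (\<lambda>p. X (snd p)) + a)"
    and a: "a \<ge> 0"
  shows "\<bar>shc (replicate_pmf m L) (\<lambda>ws. C (map X ws)) (map Ob)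
     - real m * (shc L X Ob - shc (adjoin L X K) (\<lambda>p. X (snd p)) (\<lambda>p. (h (fst p), Ob (snd p))))\<bar> \<le> real m * (a + e + \<eta> * \<kappa>)"
proof -
  let ?R = "replicate_pmf m L" and ?F = "adjoin L X K"
  have finR: "finite (set_pmf ?R)" by (simp add: finL finite_set_replicate_pmf)
  have finF: "finite (set_pmf ?F)" by (rule finite_set_adjoin[OF finL finK])
  let ?W = "\<lambda>p :: 'c \<times> 'w. h (fst p)" and ?X = "\<lambda>p :: 'c \<times> 'w. X (snd p)" and ?O = "\<lambda>p :: 'c \<times> 'w. Ob (snd p)"
  let ?C = "\<lambda>ws. C (map X ws)"
  have lo: "shc ?R (map X) (\<lambda>ws. (?C ws, map Ob ws)) \<le> real m * (shc ?F ?X (\<lambda>p. (?W p, ?O p)) + e + \<eta> * \<kappa>)"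
  proof -
    have "shc ?R (map X) (\<lambda>ws. (?C ws, map Ob ws)) \<le> real m * (shc ?F ?X (\<lambda>p. (?W p, ?O p)) + e + \<eta> * log 2 (card (X ` set_pmf L)))"
      by (rule shc_block_index[where bad = bad and C = C and cw = cw and h = h and K = K, OF finL finK e]) (use good good_lo finL bad in auto)
    also have "\<dots> \<le> real m * (shc ?F ?X (\<lambda>p. (?W p, ?O p)) + e + \<eta> * \<kappa>)"
      by (intro mult_left_mono add_left_mono \<kappa> \<eta>) auto
    finally show ?thesis .
  qed
  have hi: "shc ?R (map Ob) (\<lambda>ws. (?C ws, map (\<lambda>_. ()) ws)) \<le> real m * (shc ?F ?O (\<lambda>p. (?W p, ())) + e + \<eta> * \<kappa>)"
  proof -
    have "shc ?R (map Ob) (\<lambda>ws. (?C ws, map (\<lambda>_. ()) ws)) \<le> real m * (shc ?F ?O (\<lambda>p. (?W p, ())) + e + \<eta> * log 2 (card (Ob ` set_pmf L)))"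
      by (rule shc_block_index[where bad = bad and C = C and cw = cw and h = h and K = K, OF finL finK e]) (use good good_hi finL bad in auto)
    also have "\<dots> \<le> real m * (shc ?F ?O (\<lambda>p. (?W p, ())) + e + \<eta> * \<kappa>)"
      by (intro mult_left_mono add_left_mono \<kappa> \<eta>) auto
    finally show ?thesis .
  qed
  have e1: "sh ?R (\<lambda>ws. (map X ws, ?C ws, map Ob ws)) = sh ?R (\<lambda>ws. (map X ws, map Ob ws))"
    by (rule sh_kernel_eq) auto
  have XO: "shc ?R (map X) (map Ob) = real m * shc L X Ob" by (rule shc_replicate[OF finL])
  have O: "sh ?R (map Ob) = real m * sh L Ob" by (rule sh_replicate[OF finL])
  have low: "shc ?R ?C (map Ob) \<ge> real m * (shc L X Ob - shc ?F ?X (\<lambda>p. (?W p, ?O p)) - e - \<eta> * \<kappa>)"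
    using lo XO unfolding shc_def e1 by (simp add: algebra_simps)
  have card: "sh ?R ?C \<le> log 2 (card T)"
    using shc_le_log_card[OF finR T(1), of ?C "\<lambda>_. ()"] T(2) by (simp add: shc_const finR image_image)
  \<comment> \<open>\<open>\<lambda>_. ()\<close> stands for absent side information. Mapped over a
    block it is constant on the support, where all blocks have length \<open>m\<close>.\<close>
  have e2: "sh ?R (\<lambda>ws. (map Ob ws, ?C ws, map (\<lambda>_. ()) ws)) = sh ?R (\<lambda>ws. (?C ws, map Ob ws))"
    by (rule sh_eq[OF finR]) (auto simp: det_by_def set_replicate_pmf map_replicate_const)
  have e3: "sh ?R (\<lambda>ws. (?C ws, map (\<lambda>_. ()) ws)) = sh ?R ?C"
    by (rule sh_eq[OF finR]) (auto simp: det_by_def set_replicate_pmf map_replicate_const)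
  have e4: "sh ?F (\<lambda>p. (?O p, ?W p, ())) = sh ?F (\<lambda>p. (?W p, ?O p))" "sh ?F (\<lambda>p. (?W p, ())) = sh ?F ?W"
    by (rule sh_kernel_eq; auto)+
  have upp: "shc ?R ?C (map Ob) \<le> real m * (sh ?F ?W - shc ?F ?W ?X + a) + real m * (shc ?F ?O (\<lambda>p. (?W p, ())) + e + \<eta> * \<kappa>) - real m * sh L Ob"
    using hi card T(3) O unfolding shc_def e2 e3 by linarith
  have mk: "shc ?F ?W (\<lambda>p. (?X p, ?O p)) = shc ?F ?W ?X" by (rule shc_adjoin_markov[OF finL finK])
  have e5: "sh ?F (\<lambda>p. (?W p, ?X p, ?O p)) = sh ?F (\<lambda>p. (?X p, ?W p, ?O p))"
    by (rule sh_kernel_eq) auto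
  have s: "sh L Ob = sh ?F ?O" "sh L X = sh ?F ?X" "sh L (\<lambda>\<omega>. (X \<omega>, Ob \<omega>)) = sh ?F (\<lambda>p. (?X p, ?O p))"
    using sh_adjoin_snd[of L X K Ob] sh_adjoin_snd[of L X K X] sh_adjoin_snd[of L X K "\<lambda>\<omega>. (X \<omega>, Ob \<omega>)"] by auto
  \<comment> \<open>\<open>I(W; X) - I(W; O) = I(W; X | O)\<close> by the Markov chain
    \<open>W - X - O\<close>; thus the upper bound meets the lower one.\<close>
  have id: "sh ?F ?W - shc ?F ?W ?X + shc ?F ?O (\<lambda>p. (?W p, ())) - sh L Ob = shc L X Ob - shc ?F ?X (\<lambda>p. (?W p, ?O p))"
    using mk unfolding shc_def e4 e5 s by linarith
  have "shc ?R ?C (map Ob) \<le> real m * (shc L X Ob - shc ?F ?X (\<lambda>p. (?W p, ?O p)) + a + e + \<eta> * \<kappa>)"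
    using upp unfolding id[symmetric] by (simp add: algebra_simps)
  moreover have "real m * a \<ge> 0" using a by simp
  ultimately show ?thesis using low unfolding abs_le_iff by (simp add: algebra_simps)
qed

lemma nat_ceiling_powr_le:
  assumes "t \<ge> 0"
  shows "real (nat \<lceil>2 powr t\<rceil>) \<le> 2 * 2 powr t"
proof -
  have "1 \<le> 2 powr t" using assms by (simp add: ge_one_powr_ge_zero)
  then show ?thesis by linarith
qed

lemma shc_le_sh: "finite (set_pmf p) \<Longrightarrow> shc p A C \<le> sh p A"
  using shc_mono_cond[of p "\<lambda>_. ()" C A] by (simp add: shc_const det_by_def)

text \<open>The index is \<open>None\<close> where the covering fails. One map \<open>B\<close>
  serves all pairs \<open>(L, Ob)\<close>: all laws share \<open>PX\<close>, hence the joint law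
  \<open>P0\<close> with the auxiliary letters, and the observations enter through finitely many
  costs required of the codewords.\<close>

theorem block_index:
  fixes X :: "'w \<Rightarrow> 'x" and K :: "'x \<Rightarrow> ('v \<times> 'u) pmf" and \<O> :: "('w pmf \<times> ('w \<Rightarrow> 'o)) set"
  assumes fin\<O>: "finite \<O>" and L: "\<And>L Ob. (L, Ob) \<in> \<O> \<Longrightarrow> finite (set_pmf L) \<and> map_pmf X L = PX"
    and finP: "finite (set_pmf PX)" and finK: "\<And>x. finite (set_pmf (K x))" and e: "e > 0"
  shows "\<forall>\<^sub>F m in sequentially. \<exists>B :: 'x list \<Rightarrow> (nat \<times> nat) option. finite (range B) \<and>
     (\<forall>(L, Ob) \<in> \<O>.
        \<bar>shc (replicate_pmf m L) (\<lambda>ws. map_option fst (B (map X ws))) (map Ob)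
          - real m * (shc L X Ob - shc (adjoin L X K) (\<lambda>p. X (snd p)) (\<lambda>p. (fst (fst p), Ob (snd p))))\<bar> \<le> real m * e \<and>
        \<bar>shc (replicate_pmf m L) (\<lambda>ws. B (map X ws)) (map Ob)
          - real m * (shc L X Ob - shc (adjoin L X K) (\<lambda>p. X (snd p)) (\<lambda>p. (fst p, Ob (snd p))))\<bar> \<le> real m * e)"
proof -
  define P0 where "P0 = PX \<bind> (\<lambda>x. map_pmf (\<lambda>w. (w, x)) (K x))"
  have finP0: "finite (set_pmf P0)" unfolding P0_def using finP finK by auto
  have P0: "P0 = map_pmf (\<lambda>p. (fst p, X (snd p))) (adjoin L X K)" if "(L, Ob) \<in> \<O>" for L Ob
    using L[OF that] map_adjoin[of X L K] unfolding P0_def by (simp add: case_prod_unfold)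
  have EP0: "measure_pmf.expectation P0 (\<lambda>q. f (fst q) (snd q)) = measure_pmf.expectation (adjoin L X K) (\<lambda>p. f (fst p) (X (snd p)) :: real)"
    if "(L, Ob) \<in> \<O>" for L Ob and f :: "'v \<times> 'u \<Rightarrow> 'x \<Rightarrow> real"
    unfolding P0[OF that] by simp
  define V where "V = (\<lambda>q :: ('v \<times> 'u) \<times> 'x. fst (fst q))"
  define U where "U = (\<lambda>q :: ('v \<times> 'u) \<times> 'x. snd (fst q))"
  define X0 where "X0 = (\<lambda>q :: ('v \<times> 'u) \<times> 'x. snd q)"
  define \<kappa> where "\<kappa> = (\<Sum>(L, Ob)\<in>\<O>. log 2 (card (X ` set_pmf L)) + log 2 (card (Ob ` set_pmf L)))"
  have card1: "log 2 (card (f ` set_pmf L)) \<ge> 0" if "(L, Ob) \<in> \<O>" for L Ob and f :: "'w \<Rightarrow> 'q"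
  proof -
    have "card (f ` set_pmf L) \<ge> 1" using L[OF that] set_pmf_not_empty[of L] by (simp add: Suc_le_eq card_gt_0_iff)
    then show ?thesis by simp
  qed
  have kk: "log 2 (card (X ` set_pmf L)) + log 2 (card (Ob ` set_pmf L)) \<le> \<kappa>" if "(L, Ob) \<in> \<O>" for L Ob
    unfolding \<kappa>_def using that
    by (intro member_le_sum[of "(L, Ob)" \<O> "\<lambda>(L, Ob). log 2 (card (X ` set_pmf L)) + log 2 (card (Ob ` set_pmf L))", simplified])
       (auto simp: fin\<O> intro!: add_nonneg_nonneg card1)
  have \<kappa>0: "\<kappa> \<ge> 0" unfolding \<kappa>_def by (rule sum_nonneg) (auto intro!: add_nonneg_nonneg card1)
  have \<kappa>: "log 2 (card (X ` set_pmf L)) \<le> \<kappa>" "log 2 (card (Ob ` set_pmf L)) \<le> \<kappa>" if "(L, Ob) \<in> \<O>" for L Ob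
    using kk[OF that] card1[OF that, of X] card1[OF that, of Ob] by linarith+
  \<comment> \<open>The larger of the two errors is \<open>3 * e1 + e1 + \<eta> * \<kappa>\<close>,
    at most \<open>5 * e1\<close>. Here \<open>\<eta>\<close> bounds the probability of a missing
    codeword and \<open>\<kappa>\<close> the bits per letter that it costs.\<close>
  define e1 where "e1 = e / 8"
  define \<eta> where "\<eta> = e1 / (\<kappa> + 1)"
  have e1: "e1 > 0" unfolding e1_def using e by simp
  have \<eta>: "\<eta> > 0" unfolding \<eta>_def using e1 \<kappa>0 by simp
  have \<eta>\<kappa>: "\<eta> * \<kappa> \<le> e1" unfolding \<eta>_def using e1 \<kappa>0 by (simp add: field_simps)
  define g1 where "g1 = (\<lambda>(L, Ob :: 'w \<Rightarrow> 'o) v (u :: 'u) x. cond_mean L X (letter_cost L X K fst X Ob v) x)"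
  define g2 where "g2 = (\<lambda>(L, Ob :: 'w \<Rightarrow> 'o) v (u :: 'u) x. cond_mean L X (letter_cost L X K fst Ob (\<lambda>_. ()) v) x)"
  define g3 where "g3 = (\<lambda>(L, Ob :: 'w \<Rightarrow> 'o) v u x. cond_mean L X (letter_cost L X K (\<lambda>w. w) X Ob (v, u)) x)"
  define g4 where "g4 = (\<lambda>(L, Ob :: 'w \<Rightarrow> 'o) v u x. cond_mean L X (letter_cost L X K (\<lambda>w. w) Ob (\<lambda>_. ()) (v, u)) x)"
  \<comment> \<open>For each observation and each of the two codeword levels there is one cost for
    the lower bound, describing \<open>X\<close> given the observation, and one for the upper bound,
    describing the observation itself.\<close>
  define G where "G = g1 ` \<O> \<union> g2 ` \<O> \<union> g3 ` \<O> \<union> g4 ` \<O>"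
  have finG: "finite G" unfolding G_def using fin\<O> by auto
  define I1 where "I1 = sh P0 V - shc P0 V X0"
  define I2 where "I2 = shc P0 U V - shc P0 U (\<lambda>\<omega>. (V \<omega>, X0 \<omega>))"
  have I0: "I1 \<ge> 0" "I2 \<ge> 0"
    unfolding I1_def I2_def using shc_le_sh[OF finP0, of V X0] shc_mono_cond[OF finP0, of V "\<lambda>\<omega>. (V \<omega>, X0 \<omega>)" U]
    by (auto simp: det_by_def)
  have ev1: "\<forall>\<^sub>F m in sequentially. \<exists>cv cu \<alpha> \<beta> K0.
     (\<forall>xs\<in>K0. \<alpha> xs < nat \<lceil>2 powr (real m * (I1 + e1))\<rceil> \<and> \<beta> xs < nat \<lceil>2 powr (real m * (I2 + e1))\<rceil> \<and>
        (\<exists>ws\<in>set_pmf (replicate_pmf m P0). map V ws = cv (\<alpha> xs) \<and> map U ws = cu (\<alpha> xs) (\<beta> xs) \<and> map X0 ws = xs \<and>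
           (\<forall>g\<in>G. (\<Sum>i<m. g (V (ws ! i)) (U (ws ! i)) (X0 (ws ! i))) \<le> real m * (measure_pmf.expectation P0 (\<lambda>\<omega>. g (V \<omega>) (U \<omega>) (X0 \<omega>)) + e1)))) \<and>
     measure_pmf.prob (replicate_pmf m P0) {ws. map X0 ws \<notin> K0} \<le> \<eta>"
    unfolding I1_def I2_def by (rule block_covering[OF finP0 e1 \<eta> finG])
  \<comment> \<open>Absorbs a factor \<open>2 powr 3\<close>: each of the two ceilings at most
    doubles a codebook size, and the index \<open>None\<close> adds one.\<close>
  have ev2: "\<forall>\<^sub>F m in sequentially. 3 / e1 \<le> real m"
    using filterlim_real_sequentially unfolding filterlim_at_top by blast
  show ?thesis using ev1 ev2
  proof eventually_elim
    case (elim m)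
    define M1 where "M1 = nat \<lceil>2 powr (real m * (I1 + e1))\<rceil>"
    define M2 where "M2 = nat \<lceil>2 powr (real m * (I2 + e1))\<rceil>"
    from elim(1) obtain cv cu \<alpha> \<beta> K0 where cov: "\<And>xs. xs \<in> K0 \<Longrightarrow> \<alpha> xs < M1 \<and> \<beta> xs < M2 \<and>
        (\<exists>ws\<in>set_pmf (replicate_pmf m P0). map V ws = cv (\<alpha> xs) \<and> map U ws = cu (\<alpha> xs) (\<beta> xs) \<and> map X0 ws = xs \<and>
           (\<forall>g\<in>G. (\<Sum>i<m. g (V (ws ! i)) (U (ws ! i)) (X0 (ws ! i))) \<le> real m * (measure_pmf.expectation P0 (\<lambda>\<omega>. g (V \<omega>) (U \<omega>) (X0 \<omega>)) + e1)))"
      and PK: "measure_pmf.prob (replicate_pmf m P0) {ws. map X0 ws \<notin> K0} \<le> \<eta>"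
      unfolding M1_def M2_def by blast
    define B where "B = (\<lambda>xs. if xs \<in> K0 then Some (\<alpha> xs, \<beta> xs) else None)"
    define T2 where "T2 = insert None (Some ` ({..<M1} \<times> {..<M2}))"
    define T1 where "T1 = insert None (Some ` {..<M1})"
    have BT: "B xs \<in> T2" "map_option fst (B xs) \<in> T1" for xs
      using cov[of xs] by (auto simp: B_def T1_def T2_def)
    have finT: "finite T1" "finite T2" unfolding T1_def T2_def by auto
    have m3: "3 \<le> real m * e1" using elim(2) e1 by (simp add: field_simps)
    have M1: "real M1 \<le> 2 * 2 powr (real m * (I1 + e1))" unfolding M1_def
      by (rule nat_ceiling_powr_le) (use I0 e1 in simp)
    have M2: "real M2 \<le> 2 * 2 powr (real m * (I2 + e1))" unfolding M2_def
      by (rule nat_ceiling_powr_le) (use I0 e1 in simp)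
    have p1: "1 \<le> 2 powr (real m * (I1 + e1))" "1 \<le> 2 powr (real m * (I1 + I2 + 2 * e1))"
      using I0 e1 by (auto intro!: ge_one_powr_ge_zero)
    have cT1: "log 2 (card T1) \<le> real m * (I1 + 2 * e1)"
    proof -
      have "real (card T1) = real M1 + 1" unfolding T1_def by (simp add: card_image)
      also have "\<dots> \<le> 2 powr 3 * 2 powr (real m * (I1 + e1))" using M1 p1 by simp
      also have "\<dots> \<le> 2 powr (real m * (I1 + 2 * e1))"
        unfolding powr_add[symmetric] using m3 by (simp add: algebra_simps)
      finally have "log 2 (card T1) \<le> log 2 (2 powr (real m * (I1 + 2 * e1)))"
        by (subst log_le_cancel_iff) (use finT in \<open>auto simp: T1_def card_gt_0_iff\<close>)
      then show ?thesis by simp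
    qed
    have cT2: "log 2 (card T2) \<le> real m * (I1 + I2 + 3 * e1)"
    proof -
      have "real (card T2) = real M1 * real M2 + 1" unfolding T2_def by (simp add: card_image)
      also have "\<dots> \<le> (2 * 2 powr (real m * (I1 + e1))) * (2 * 2 powr (real m * (I2 + e1))) + 1"
        by (intro add_right_mono mult_mono M1 M2) auto
      also have "\<dots> = 4 * 2 powr (real m * (I1 + I2 + 2 * e1)) + 1"
        by (simp add: algebra_simps flip: powr_add)
      also have "\<dots> \<le> 2 powr 3 * 2 powr (real m * (I1 + I2 + 2 * e1))" using p1 by simp
      also have "\<dots> \<le> 2 powr (real m * (I1 + I2 + 3 * e1))"
        unfolding powr_add[symmetric] using m3 by (simp add: algebra_simps)
      finally have "log 2 (card T2) \<le> log 2 (2 powr (real m * (I1 + I2 + 3 * e1)))"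
        by (subst log_le_cancel_iff) (use finT in \<open>auto simp: T2_def card_gt_0_iff\<close>)
      then show ?thesis by simp
    qed
    have main: "\<bar>shc (replicate_pmf m L) (\<lambda>ws. map_option fst (B (map X ws))) (map Ob)
          - real m * (shc L X Ob - shc (adjoin L X K) (\<lambda>p. X (snd p)) (\<lambda>p. (fst (fst p), Ob (snd p))))\<bar> \<le> real m * e \<and>
        \<bar>shc (replicate_pmf m L) (\<lambda>ws. B (map X ws)) (map Ob)
          - real m * (shc L X Ob - shc (adjoin L X K) (\<lambda>p. X (snd p)) (\<lambda>p. (fst p, Ob (snd p))))\<bar> \<le> real m * e"
      if LO: "(L, Ob) \<in> \<O>" for L Ob
    proof -
      let ?F = "adjoin L X K"
      have finL: "finite (set_pmf L)" using L[OF LO] by simp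
      have I1': "I1 = sh ?F (\<lambda>p. fst (fst p)) - shc ?F (\<lambda>p. fst (fst p)) (\<lambda>p. X (snd p))"
        unfolding I1_def P0[OF LO] sh_map shc_map V_def X0_def by simp
      have k1: "sh ?F (\<lambda>p. (snd (fst p), fst (fst p), X (snd p))) = sh ?F (\<lambda>p. (fst p, X (snd p)))"
          "sh ?F (\<lambda>p. (snd (fst p), fst (fst p))) = sh ?F fst"
        by (rule sh_kernel_eq; auto simp: prod_eq_iff)+
      \<comment> \<open>The chain rule \<open>I(V; X) + I(U; X | V) = I(V, U; X)\<close>: up to the
        margins, index pairs are as few as in a covering by single codewords for
        \<open>(V, U)\<close>.\<close>
      have I2': "I1 + I2 = sh ?F (\<lambda>p. fst p) - shc ?F (\<lambda>p. fst p) (\<lambda>p. X (snd p))"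
        unfolding I1' I2_def P0[OF LO] shc_map V_def X0_def U_def
        unfolding shc_def by (simp add: k1)
      have PKL: "measure_pmf.prob (replicate_pmf m L) {ws. map X ws \<notin> K0} \<le> \<eta>"
      proof -
        have "map_pmf X0 P0 = map_pmf X (map_pmf snd ?F)" unfolding P0[OF LO] pmf.map_comp by (simp add: o_def X0_def)
        then have "map_pmf (map X0) (replicate_pmf m P0) = map_pmf (map X) (replicate_pmf m L)"
          unfolding map_replicate_pmf by (simp add: map_snd_adjoin)
        then have "measure_pmf.prob (map_pmf (map X0) (replicate_pmf m P0)) (- K0) = measure_pmf.prob (map_pmf (map X) (replicate_pmf m L)) (- K0)" by simp
        then show ?thesis using PK by (simp add: vimage_def)
      qed
      have cov': "\<exists>ws\<in>set_pmf (replicate_pmf m P0). map V ws = cv (\<alpha> xs) \<and> map U ws = cu (\<alpha> xs) (\<beta> xs) \<and> map X0 ws = xs \<and> length ws = m \<and>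
           (\<forall>i<m. fst (ws ! i) \<in> set_pmf (K (xs ! i))) \<and>
           (\<forall>g\<in>G. (\<Sum>i<m. g (V (ws ! i)) (U (ws ! i)) (xs ! i)) \<le> real m * (measure_pmf.expectation P0 (\<lambda>\<omega>. g (V \<omega>) (U \<omega>) (X0 \<omega>)) + e1))"
        if "xs \<in> K0" for xs
      proof -
        from cov[OF that] obtain ws where ws: "ws\<in>set_pmf (replicate_pmf m P0)" "map V ws = cv (\<alpha> xs)" "map U ws = cu (\<alpha> xs) (\<beta> xs)" "map X0 ws = xs"
          and g: "\<And>g. g \<in> G \<Longrightarrow> (\<Sum>i<m. g (V (ws ! i)) (U (ws ! i)) (X0 (ws ! i))) \<le> real m * (measure_pmf.expectation P0 (\<lambda>\<omega>. g (V \<omega>) (U \<omega>) (X0 \<omega>)) + e1)" by blast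
        have l: "length ws = m" and s: "\<And>i. i < m \<Longrightarrow> ws ! i \<in> set_pmf P0" using ws(1) by (auto simp: set_replicate_pmf)
        have x: "xs ! i = X0 (ws ! i)" if "i < m" for i using ws(4) l that by auto
        have "fst (ws ! i) \<in> set_pmf (K (xs ! i))" if "i < m" for i
          using s[OF that] unfolding x[OF that] X0_def P0_def by auto
        then show ?thesis using ws l g x by (intro bexI[of _ ws]) auto
      qed
      have inG: "g1 (L, Ob) \<in> G" "g2 (L, Ob) \<in> G" "g3 (L, Ob) \<in> G" "g4 (L, Ob) \<in> G"
        unfolding G_def using LO by auto
      have E1: "measure_pmf.expectation P0 (\<lambda>q. g1 (L, Ob) (V q) (U q) (X0 q)) = shc ?F (\<lambda>p. X (snd p)) (\<lambda>p. (fst (fst p), Ob (snd p)))"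
        unfolding expectation_letter_cost[OF finL finK, where X = X and h = fst and D = X and E = Ob, symmetric] g1_def V_def U_def X0_def P0[OF LO] by simp
      have E2: "measure_pmf.expectation P0 (\<lambda>q. g2 (L, Ob) (V q) (U q) (X0 q)) = shc ?F (\<lambda>p. Ob (snd p)) (\<lambda>p. (fst (fst p), ()))"
        unfolding expectation_letter_cost[OF finL finK, where X = X and h = fst and D = Ob and E = "\<lambda>_. ()", symmetric] g2_def V_def U_def X0_def P0[OF LO] by simp
      have E3: "measure_pmf.expectation P0 (\<lambda>q. g3 (L, Ob) (V q) (U q) (X0 q)) = shc ?F (\<lambda>p. X (snd p)) (\<lambda>p. (fst p, Ob (snd p)))"
        unfolding expectation_letter_cost[OF finL finK, where X = X and h = "\<lambda>w. w" and D = X and E = Ob, symmetric] g3_def V_def U_def X0_def P0[OF LO] by simp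
      have E4: "measure_pmf.expectation P0 (\<lambda>q. g4 (L, Ob) (V q) (U q) (X0 q)) = shc ?F (\<lambda>p. Ob (snd p)) (\<lambda>p. (fst p, ()))"
        unfolding expectation_letter_cost[OF finL finK, where X = X and h = "\<lambda>w. w" and D = Ob and E = "\<lambda>_. ()", symmetric] g4_def V_def U_def X0_def P0[OF LO] by simp
      define cw1 where "cw1 = (\<lambda>c. case c of None \<Rightarrow> [] | Some i \<Rightarrow> cv i)"
      define cw2 where "cw2 = (\<lambda>c. case c of None \<Rightarrow> [] | Some (i, j) \<Rightarrow> zip (cv i) (cu i j))"
      have "\<bar>shc (replicate_pmf m L) (\<lambda>ws. map_option fst (B (map X ws))) (map Ob)
          - real m * (shc L X Ob - shc ?F (\<lambda>p. X (snd p)) (\<lambda>p. (fst (fst p), Ob (snd p))))\<bar> \<le> real m * (2 * e1 + e1 + \<eta> * \<kappa>)"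
      proof (rule block_index_entropy[where cw = cw1 and bad = "\<lambda>c. c = None" and h = fst and C = "\<lambda>xs. map_option fst (B xs)" and T = T1, OF finL finK])
        fix xs assume "map_option fst (B xs) \<noteq> None"
        then have xs: "xs \<in> K0" by (auto simp: B_def split: if_splits)
        from cov'[OF xs] obtain ws where ws: "map V ws = cv (\<alpha> xs)" "length ws = m" "\<And>i. i < m \<Longrightarrow> fst (ws ! i) \<in> set_pmf (K (xs ! i))"
          and g: "\<And>g. g \<in> G \<Longrightarrow> (\<Sum>i<m. g (V (ws ! i)) (U (ws ! i)) (xs ! i)) \<le> real m * (measure_pmf.expectation P0 (\<lambda>\<omega>. g (V \<omega>) (U \<omega>) (X0 \<omega>)) + e1)"
          by blast
        have c: "cw1 (map_option fst (B xs)) = map V ws" using xs by (simp add: cw1_def B_def ws)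
        show "length (cw1 (map_option fst (B xs))) = m \<and> (\<forall>i<m. cw1 (map_option fst (B xs)) ! i \<in> fst ` set_pmf (K (xs ! i)))"
          unfolding c using ws(2,3) by (auto simp: V_def)
        show "(\<Sum>i<m. cond_mean L X (letter_cost L X K fst X Ob (cw1 (map_option fst (B xs)) ! i)) (xs ! i))
           \<le> real m * (shc (adjoin L X K) (\<lambda>p. X (snd p)) (\<lambda>p. (fst (fst p), Ob (snd p))) + e1)"
          using g[OF inG(1)] ws(2) unfolding c E1 by (simp add: g1_def)
        show "(\<Sum>i<m. cond_mean L X (letter_cost L X K fst Ob (\<lambda>_. ()) (cw1 (map_option fst (B xs)) ! i)) (xs ! i))
           \<le> real m * (shc (adjoin L X K) (\<lambda>p. Ob (snd p)) (\<lambda>p. (fst (fst p), ())) + e1)"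
          using g[OF inG(2)] ws(2) unfolding c E2 by (simp add: g2_def)
      next
        have "{ws. map_option fst (B (map X ws)) = None} = {ws. map X ws \<notin> K0}" by (auto simp: B_def)
        then show "measure_pmf.prob (replicate_pmf m L) {ws. map_option fst (B (map X ws)) = None} \<le> \<eta>" using PKL by simp
        show "log 2 (card T1) \<le> real m * (sh ?F (\<lambda>p. fst (fst p)) - shc ?F (\<lambda>p. fst (fst p)) (\<lambda>p. X (snd p)) + 2 * e1)"
          using cT1 unfolding I1' .
      qed (use e1 \<eta> \<kappa>[OF LO] finT BT in auto)
      moreover have "\<bar>shc (replicate_pmf m L) (\<lambda>ws. B (map X ws)) (map Ob)
          - real m * (shc L X Ob - shc ?F (\<lambda>p. X (snd p)) (\<lambda>p. (fst p, Ob (snd p))))\<bar> \<le> real m * (3 * e1 + e1 + \<eta> * \<kappa>)"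
      proof (rule block_index_entropy[where cw = cw2 and bad = "\<lambda>c. c = None" and h = "\<lambda>w. w" and C = B and T = T2, OF finL finK])
        fix xs assume "B xs \<noteq> None"
        then have xs: "xs \<in> K0" by (auto simp: B_def split: if_splits)
        from cov'[OF xs] obtain ws where ws: "map V ws = cv (\<alpha> xs)" "map U ws = cu (\<alpha> xs) (\<beta> xs)" "length ws = m" "\<And>i. i < m \<Longrightarrow> fst (ws ! i) \<in> set_pmf (K (xs ! i))"
          and g: "\<And>g. g \<in> G \<Longrightarrow> (\<Sum>i<m. g (V (ws ! i)) (U (ws ! i)) (xs ! i)) \<le> real m * (measure_pmf.expectation P0 (\<lambda>\<omega>. g (V \<omega>) (U \<omega>) (X0 \<omega>)) + e1)"
          by blast
        have c: "cw2 (B xs) = zip (map V ws) (map U ws)" using xs by (simp add: cw2_def B_def ws)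
        have c': "cw2 (B xs) ! i = (V (ws ! i), U (ws ! i))" if "i < m" for i unfolding c using ws(3) that by simp
        show "length (cw2 (B xs)) = m \<and> (\<forall>i<m. cw2 (B xs) ! i \<in> (\<lambda>w. w) ` set_pmf (K (xs ! i)))"
          using ws(3,4) c' by (auto simp: c V_def U_def)
        show "(\<Sum>i<m. cond_mean L X (letter_cost L X K (\<lambda>w. w) X Ob (cw2 (B xs) ! i)) (xs ! i))
           \<le> real m * (shc (adjoin L X K) (\<lambda>p. X (snd p)) (\<lambda>p. (fst p, Ob (snd p))) + e1)"
          using g[OF inG(3)] unfolding E3 by (simp add: g3_def c')
        show "(\<Sum>i<m. cond_mean L X (letter_cost L X K (\<lambda>w. w) Ob (\<lambda>_. ()) (cw2 (B xs) ! i)) (xs ! i))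
           \<le> real m * (shc (adjoin L X K) (\<lambda>p. Ob (snd p)) (\<lambda>p. (fst p, ())) + e1)"
          using g[OF inG(4)] unfolding E4 by (simp add: g4_def c')
      next
        have "{ws. B (map X ws) = None} = {ws. map X ws \<notin> K0}" by (auto simp: B_def)
        then show "measure_pmf.prob (replicate_pmf m L) {ws. B (map X ws) = None} \<le> \<eta>" using PKL by simp
        show "log 2 (card T2) \<le> real m * (sh ?F (\<lambda>p. fst p) - shc ?F (\<lambda>p. fst p) (\<lambda>p. X (snd p)) + 3 * e1)"
          using cT2 unfolding I2' .
      qed (use e1 \<eta> \<kappa>[OF LO] finT BT in auto)
      moreover have "real m * (2 * e1 + e1 + \<eta> * \<kappa>) \<le> real m * e" "real m * (3 * e1 + e1 + \<eta> * \<kappa>) \<le> real m * e"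
        by (rule mult_left_mono; use \<eta>\<kappa> e1 in \<open>simp add: e1_def\<close>)+
      ultimately show ?thesis by linarith
    qed
    have "finite (range B)" using finite_subset[OF _ finT(2), of "range B"] BT by auto
    then show ?case using main by (intro exI[of _ B]) auto
  qed
qed

section \<open>Hashing of correlated sources\<close>

text \<open>Residues are equidistributed on \<open>{..<M}\<close> because \<open>K\<close> divides
  \<open>M\<close>; this gives a collision its probability \<open>1 / K\<close>.\<close>

lemma card_mod_class:
  assumes "K dvd M" "(K::nat) > 0" "r < K"
  shows "card {t\<in>{..<M}. t mod K = r} = M div K"
proof -
  obtain q where M: "M = K * q" using assms(1) by auto
  have "{t\<in>{..<M}. t mod K = r} = (\<lambda>s. r + K * s) ` {..<q}"
  proof (intro equalityI subsetI)
    fix t assume t: "t \<in> {t\<in>{..<M}. t mod K = r}"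
    then have "t = r + K * (t div K)" by (metis (mono_tags, lifting) mem_Collect_eq mod_mult_div_eq)
    moreover have "t div K < q" using t assms(2) by (simp add: M less_mult_imp_div_less mult.commute)
    ultimately show "t \<in> (\<lambda>s. r + K * s) ` {..<q}" by blast
  next
    fix t assume "t \<in> (\<lambda>s. r + K * s) ` {..<q}"
    then obtain s where s: "s < q" "t = r + K * s" by auto
    have "t < K + K * s" using s assms by simp
    also have "\<dots> = K * Suc s" by simp
    also have "\<dots> \<le> K * q" using s by (intro mult_le_mono2) simp
    finally show "t \<in> {t\<in>{..<M}. t mod K = r}" using s assms by (simp add: M)
  qed
  moreover have "inj_on (\<lambda>s. r + K * s) {..<q}" using assms by (auto simp: inj_on_def)
  ultimately show ?thesis using assms by (simp add: card_image M)
qed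

text \<open>
  The hash values are chosen one after the other, each no worse than the average over all
  \<open>M\<close> values. As the moduli divide \<open>M\<close>, one function serves as a hash of several sizes.
\<close>

lemma hash_exists:
  fixes c :: "'i \<Rightarrow> 'b \<Rightarrow> 'b \<Rightarrow> real" and K :: "'i \<Rightarrow> nat"
  assumes W: "finite W" and I: "finite I" and c: "\<And>i w w'. i \<in> I \<Longrightarrow> c i w w' \<ge> 0"
    and K: "\<And>i. i \<in> I \<Longrightarrow> K i dvd M" "M > 0"
  shows "\<exists>h :: 'b \<Rightarrow> nat. (\<Sum>i\<in>I. \<Sum>w\<in>W. \<Sum>w'\<in>W - {w}. if h w mod K i = h w' mod K i then c i w w' else 0)
     \<le> (\<Sum>i\<in>I. \<Sum>w\<in>W. \<Sum>w'\<in>W - {w}. c i w w' / real (K i))"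
  using W
proof (induction W)
  case empty
  show ?case by simp
next
  case (insert a W)
  then obtain h where h: "(\<Sum>i\<in>I. \<Sum>w\<in>W. \<Sum>w'\<in>W - {w}. if h w mod K i = h w' mod K i then c i w w' else 0)
     \<le> (\<Sum>i\<in>I. \<Sum>w\<in>W. \<Sum>w'\<in>W - {w}. c i w w' / real (K i))" by blast
  have split: "(\<Sum>w\<in>insert a W. \<Sum>w'\<in>insert a W - {w}. f w w') = (\<Sum>w\<in>W. f a w + f w a) + (\<Sum>w\<in>W. \<Sum>w'\<in>W - {w}. f w w')"
    for f :: "'b \<Rightarrow> 'b \<Rightarrow> real"
  proof -
    have "(\<Sum>w'\<in>insert a W - {w}. f w w') = f w a + (\<Sum>w'\<in>W - {w}. f w w')" if "w \<in> W" for w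
    proof -
      have "insert a W - {w} = insert a (W - {w})" using that insert.hyps by auto
      then show ?thesis using insert.hyps by simp
    qed
    then have "(\<Sum>w\<in>W. \<Sum>w'\<in>insert a W - {w}. f w w') = (\<Sum>w\<in>W. f w a) + (\<Sum>w\<in>W. \<Sum>w'\<in>W - {w}. f w w')"
      by (simp add: sum.distrib)
    moreover have "insert a W - {a} = W" using insert.hyps by auto
    ultimately show ?thesis using insert.hyps by (simp add: sum.distrib)
  qed
  \<comment> \<open>\<open>F t\<close> is what the cost grows by when \<open>a\<close> receives the
    value \<open>t\<close>. Its average over \<open>t\<close> is the growth of the right-hand
    side.\<close>
  define F where "F = (\<lambda>t. \<Sum>i\<in>I. \<Sum>w\<in>W. if t mod K i = h w mod K i then c i a w + c i w a else 0)"
  have Kpos: "K i > 0" if "i \<in> I" for i using K(1)[OF that] K(2) by (auto intro: dvd_pos_nat)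
  have "(\<Sum>t<M. F t) = (\<Sum>i\<in>I. \<Sum>w\<in>W. \<Sum>t<M. if t mod K i = h w mod K i then c i a w + c i w a else 0)"
    unfolding F_def by (subst sum.swap, rule sum.cong[OF refl], rule sum.swap)
  also have "\<dots> = (\<Sum>i\<in>I. \<Sum>w\<in>W. real M * ((c i a w + c i w a) / real (K i)))"
  proof (intro sum.cong refl)
    fix i w assume i: "i \<in> I"
    have "(\<Sum>t<M. if t mod K i = h w mod K i then c i a w + c i w a else 0) = real (card {t\<in>{..<M}. t mod K i = h w mod K i}) * (c i a w + c i w a)"
      by (simp add: sum.inter_filter[symmetric])
    also have "\<dots> = real M * ((c i a w + c i w a) / real (K i))"
      using card_mod_class[OF K(1)[OF i] Kpos[OF i], of "h w mod K i"] Kpos[OF i] K(1)[OF i] by (simp add: real_of_nat_div)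
    finally show "(\<Sum>t<M. if t mod K i = h w mod K i then c i a w + c i w a else 0) = real M * ((c i a w + c i w a) / real (K i))" .
  qed
  also have "\<dots> = (\<Sum>t<M. \<Sum>i\<in>I. \<Sum>w\<in>W. (c i a w + c i w a) / real (K i))"
    by (simp add: sum_distrib_left)
  finally have avg: "(\<Sum>t<M. F t) = (\<Sum>t<M. \<Sum>i\<in>I. \<Sum>w\<in>W. (c i a w + c i w a) / real (K i))" .
  have "\<exists>t<M. F t \<le> (\<Sum>i\<in>I. \<Sum>w\<in>W. (c i a w + c i w a) / real (K i))"
  proof (rule ccontr)
    assume "\<not> ?thesis"
    then have "(\<Sum>t<M. \<Sum>i\<in>I. \<Sum>w\<in>W. (c i a w + c i w a) / real (K i)) < (\<Sum>t<M. F t)"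
      using K(2) by (intro sum_strict_mono) (auto simp: not_le)
    with avg show False by simp
  qed
  then obtain t where t: "F t \<le> (\<Sum>i\<in>I. \<Sum>w\<in>W. (c i a w + c i w a) / real (K i))" by blast
  define h' where "h' = h(a := t)"
  have h'W: "h' w = h w" if "w \<in> W" for w using that insert.hyps by (auto simp: h'_def)
  have h'a: "h' a = t" by (simp add: h'_def)
  have "(\<Sum>i\<in>I. \<Sum>w\<in>insert a W. \<Sum>w'\<in>insert a W - {w}. if h' w mod K i = h' w' mod K i then c i w w' else 0)
     = F t + (\<Sum>i\<in>I. \<Sum>w\<in>W. \<Sum>w'\<in>W - {w}. if h w mod K i = h w' mod K i then c i w w' else 0)"
    unfolding split F_def sum.distrib[symmetric]
    by (intro sum.cong refl arg_cong2[where f = "(+)"]) (auto simp: h'W h'a)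
  also have "\<dots> \<le> (\<Sum>i\<in>I. \<Sum>w\<in>W. (c i a w + c i w a) / real (K i)) + (\<Sum>i\<in>I. \<Sum>w\<in>W. \<Sum>w'\<in>W - {w}. c i w w' / real (K i))"
    using t h by simp
  also have "\<dots> = (\<Sum>i\<in>I. \<Sum>w\<in>insert a W. \<Sum>w'\<in>insert a W - {w}. c i w w' / real (K i))"
    unfolding split sum.distrib add_divide_distrib by simp
  finally show ?case by blast
qed

section \<open>Decoding of hashes by conditional typicality\<close>

lemma tendsto_powr_minus_0:
  assumes "e > 0"
  shows "((\<lambda>n. 2 powr (- (real n * e))) \<longlongrightarrow> 0) sequentially"
proof -
  have "filterlim (\<lambda>n. real n * e * ln 2) at_top sequentially"
    by (intro filterlim_at_top_mult_tendsto_pos[OF tendsto_const] filterlim_real_sequentially) (use assms in auto)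
  then have "filterlim (\<lambda>n. - (real n * e * ln 2)) at_bot sequentially" by (simp add: filterlim_uminus_at_top)
  then have "((\<lambda>n. exp (- (real n * e * ln 2))) \<longlongrightarrow> 0) sequentially" by (rule filterlim_compose[OF exp_at_bot])
  then show ?thesis by (simp add: powr_def)
qed

text \<open>The conditional probability of \<open>ws\<close> given \<open>os\<close> is at least
  \<open>2 powr (- (real n * r))\<close>, written without division. Without the last conjunct every
  \<open>ws\<close> would be typical for an \<open>os\<close> of probability zero.\<close>

definition cond_typical :: "'s pmf \<Rightarrow> nat \<Rightarrow> ('s \<Rightarrow> 'b) \<Rightarrow> ('s \<Rightarrow> 'o) \<Rightarrow> real \<Rightarrow> 'b list \<Rightarrow> 'o list \<Rightarrow> bool" where
  "cond_typical q n W Ob r ws os \<longleftrightarrow>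
     2 powr (- (real n * r)) * measure_pmf.prob (replicate_pmf n q) {ss. map Ob ss = os}
        \<le> measure_pmf.prob (replicate_pmf n q) {ss. map W ss = ws \<and> map Ob ss = os} \<and>
     measure_pmf.prob (replicate_pmf n q) {ss. map Ob ss = os} > 0"

lemma cond_typical_support:
  assumes "cond_typical q n W Ob r ws os"
  shows "ws \<in> map W ` set_pmf (replicate_pmf n q)"
proof (rule ccontr)
  assume a: "ws \<notin> map W ` set_pmf (replicate_pmf n q)"
  have "0 < 2 powr (- (real n * r)) * measure_pmf.prob (replicate_pmf n q) {ss. map Ob ss = os}"
    using assms by (simp add: cond_typical_def)
  also have "\<dots> \<le> measure_pmf.prob (replicate_pmf n q) {ss. map W ss = ws \<and> map Ob ss = os}"
    using assms by (simp add: cond_typical_def)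
  also have "\<dots> \<le> measure_pmf.prob (replicate_pmf n q) {}"
    by (rule prob_mono_supp) (use a in auto)
  finally show False by simp
qed

text \<open>Each member has conditional probability at least \<open>2 powr (- (real n * r))\<close>
  given \<open>os\<close>, and these probabilities sum to at most 1.\<close>

lemma card_cond_typical:
  assumes fin: "finite (set_pmf q)"
  shows "finite {ws. cond_typical q n W Ob r ws os}" "real (card {ws. cond_typical q n W Ob r ws os}) \<le> 2 powr (real n * r)"
proof -
  let ?R = "replicate_pmf n q" and ?S = "{ws. cond_typical q n W Ob r ws os}"
  have finR: "finite (set_pmf ?R)" by (simp add: fin finite_set_replicate_pmf)
  show finS: "finite ?S"
    by (rule finite_subset[of _ "map W ` set_pmf ?R"]) (use cond_typical_support finR in auto)
  show "real (card ?S) \<le> 2 powr (real n * r)"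
  proof (cases "?S = {}")
    case False
    define P where "P = measure_pmf.prob ?R {ss. map Ob ss = os}"
    have P: "P > 0" using False by (auto simp: cond_typical_def P_def)
    have "real (card ?S) * (2 powr (- (real n * r)) * P) = (\<Sum>ws\<in>?S. 2 powr (- (real n * r)) * P)" by simp
    also have "\<dots> \<le> (\<Sum>ws\<in>?S. measure_pmf.prob ?R {ss. map W ss = ws \<and> map Ob ss = os})"
      by (rule sum_mono) (simp add: cond_typical_def P_def)
    also have "\<dots> = measure_pmf.prob ?R (\<Union>ws\<in>?S. {ss. map W ss = ws \<and> map Ob ss = os})"
      by (rule measure_pmf.finite_measure_finite_Union[symmetric]) (use finS in \<open>auto simp: disjoint_family_on_def\<close>)
    also have "\<dots> \<le> P" unfolding P_def by (rule measure_pmf.finite_measure_mono) auto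
    finally have "real (card ?S) * 2 powr (- (real n * r)) \<le> 1" using P by (simp add: mult.assoc[symmetric])
    then show ?thesis by (simp add: powr_minus field_simps)
  qed simp
qed

text \<open>The weak law for the conditional surprisal. \<open>r\<close> only bounds its mean, so
  that several laws can share one threshold.\<close>

lemma prob_not_cond_typical:
  assumes fin: "finite (set_pmf q)" and r: "shc q W Ob \<le> r" and e: "e > 0" and d: "d > 0"
  shows "\<forall>\<^sub>F n in sequentially. measure_pmf.prob (replicate_pmf n q) {ss. \<not> cond_typical q n W Ob (r + e) (map W ss) (map Ob ss)} \<le> d"
proof -
  define f where "f = (\<lambda>s. - log 2 (measure_pmf.prob q {\<omega>. W \<omega> = W s \<and> Ob \<omega> = Ob s} / measure_pmf.prob q {\<omega>. Ob \<omega> = Ob s}))"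
  have Ef: "measure_pmf.expectation q f = shc q W Ob" unfolding f_def shc_expectation[OF fin] ..
  have "\<forall>\<^sub>F n in sequentially. measure_pmf.prob (replicate_pmf n q)
     {ws. \<exists>h\<in>{f}. (\<Sum>i<n. h (ws ! i)) > real n * (measure_pmf.expectation q h + e)} \<le> d"
    by (rule weak_law_finite_family[OF fin e d]) simp
  then show ?thesis
  proof eventually_elim
    case (elim n)
    let ?R = "replicate_pmf n q"
    have "measure_pmf.prob ?R {ss. \<not> cond_typical q n W Ob (r + e) (map W ss) (map Ob ss)} \<le>
        measure_pmf.prob ?R {ws. \<exists>h\<in>{f}. (\<Sum>i<n. h (ws ! i)) > real n * (measure_pmf.expectation q h + e)}"
    proof (rule prob_mono_supp)
      fix ss assume ss: "ss \<in> set_pmf ?R" and nt: "ss \<in> {ss. \<not> cond_typical q n W Ob (r + e) (map W ss) (map Ob ss)}"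
      show "ss \<in> {ws. \<exists>h\<in>{f}. (\<Sum>i<n. h (ws ! i)) > real n * (measure_pmf.expectation q h + e)}"
      proof (rule ccontr)
        assume "\<not> ?thesis"
        then have "(\<Sum>i<n. f (ss ! i)) \<le> real n * (shc q W Ob + e)" by (simp add: Ef not_less)
        also have "\<dots> \<le> real n * (r + e)" by (rule mult_left_mono) (use r in auto)
        finally have le: "(\<Sum>i<n. f (ss ! i)) \<le> real n * (r + e)" .
        have s: "\<And>i. i < n \<Longrightarrow> ss ! i \<in> set_pmf q" using ss by (auto simp: set_replicate_pmf)
        have fi: "f (ss ! i) = log 2 (measure_pmf.prob q {\<omega>. Ob \<omega> = Ob (ss ! i)}) - log 2 (measure_pmf.prob q {\<omega>. W \<omega> = W (ss ! i) \<and> Ob \<omega> = Ob (ss ! i)})"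
          if "i < n" for i
          using prob_level_pos[OF s[OF that], of "\<lambda>\<omega>. (W \<omega>, Ob \<omega>)"] prob_level_pos[OF s[OF that], of Ob]
          by (simp add: f_def log_divide)
        have pO: "measure_pmf.prob ?R {ss'. map Ob ss' = map Ob ss} = 2 powr (\<Sum>i<n. log 2 (measure_pmf.prob q {\<omega>. Ob \<omega> = Ob (ss ! i)}))"
          by (rule prob_map_replicate_powr[OF ss])
        have pWO: "measure_pmf.prob ?R {ss'. map W ss' = map W ss \<and> map Ob ss' = map Ob ss} = 2 powr (\<Sum>i<n. log 2 (measure_pmf.prob q {\<omega>. W \<omega> = W (ss ! i) \<and> Ob \<omega> = Ob (ss ! i)}))"
          unfolding prob_map_pair_replicate using prob_map_replicate_powr[OF ss, of "\<lambda>\<omega>. (W \<omega>, Ob \<omega>)"] by simp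
        have "(\<Sum>i<n. f (ss ! i)) = (\<Sum>i<n. log 2 (measure_pmf.prob q {\<omega>. Ob \<omega> = Ob (ss ! i)})) - (\<Sum>i<n. log 2 (measure_pmf.prob q {\<omega>. W \<omega> = W (ss ! i) \<and> Ob \<omega> = Ob (ss ! i)}))"
          by (simp add: fi sum_subtractf)
        then have "cond_typical q n W Ob (r + e) (map W ss) (map Ob ss)"
          using le unfolding cond_typical_def pO pWO powr_add[symmetric] by simp
        then show False using nt by simp
      qed
    qed
    then show ?case using elim by linarith
  qed
qed

text \<open>An index \<open>\<tau>\<close> is a decoding task with its own observation and modulus;
  \<open>Q \<tau>\<close> holds the laws that its decoder has to cope with. Being typical for some
  law in \<open>Q \<tau>\<close> lengthens the candidate list only by the constant factor
  \<open>card (Q \<tau>)\<close>. The moduli are quantified after \<open>n\<close>, since they grow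
  with it.\<close>

theorem slepian_wolf_hash:
  fixes W :: "'s \<Rightarrow> 'b" and Ob :: "'t \<Rightarrow> 's \<Rightarrow> 'o" and Q :: "'t \<Rightarrow> 's pmf set" and \<rho> :: "'t \<Rightarrow> real"
  assumes \<T>: "finite \<T>" and Q: "\<And>\<tau>. \<tau> \<in> \<T> \<Longrightarrow> finite (Q \<tau>)"
    and q: "\<And>\<tau> q. \<tau> \<in> \<T> \<Longrightarrow> q \<in> Q \<tau> \<Longrightarrow> finite (set_pmf q) \<and> shc q W (Ob \<tau>) \<le> \<rho> \<tau>"
    and e: "e > 0" and d: "d > 0"
  shows "\<forall>\<^sub>F n in sequentially. \<forall>K M. M > 0 \<longrightarrow> (\<forall>\<tau>\<in>\<T>. K \<tau> dvd M \<and> 2 powr (real n * (\<rho> \<tau> + e)) \<le> real (K \<tau>)) \<longrightarrow>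
     (\<exists>(h :: 'b list \<Rightarrow> nat) dec. \<forall>\<tau>\<in>\<T>. \<forall>q\<in>Q \<tau>.
        measure_pmf.prob (replicate_pmf n q) {ss. dec \<tau> (h (map W ss) mod K \<tau>) (map (Ob \<tau>) ss) \<noteq> map W ss} \<le> d)"
proof -
  define I where "I = Sigma \<T> Q"
  have finI: "finite I" unfolding I_def using \<T> Q by auto
  define c0 where "c0 = (\<Sum>(\<tau>, q)\<in>I. real (card (Q \<tau>)))"
  have ev1: "\<forall>\<^sub>F n in sequentially. \<forall>i\<in>I. measure_pmf.prob (replicate_pmf n (snd i))
       {ss. \<not> cond_typical (snd i) n W (Ob (fst i)) (\<rho> (fst i) + e/2) (map W ss) (map (Ob (fst i)) ss)} \<le> d/2"
    by (rule eventually_ball_finite[OF finI], intro ballI prob_not_cond_typical) (use q e d in \<open>auto simp: I_def\<close>)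
  have "((\<lambda>n. c0 * 2 powr (- (real n * (e/2)))) \<longlongrightarrow> c0 * 0) sequentially"
    by (intro tendsto_mult tendsto_const tendsto_powr_minus_0) (use e in simp)
  then have ev2: "\<forall>\<^sub>F n in sequentially. c0 * 2 powr (- (real n * (e/2))) < d/2"
    by (intro order_tendstoD(2)) (use d in auto)
  show ?thesis using ev1 ev2
  proof eventually_elim
    case (elim n)
    show ?case
    proof (intro allI impI)
      fix K :: "'t \<Rightarrow> nat" and M :: nat
      assume M: "M > 0" and K: "\<forall>\<tau>\<in>\<T>. K \<tau> dvd M \<and> 2 powr (real n * (\<rho> \<tau> + e)) \<le> real (K \<tau>)"
      define T where "T = (\<lambda>\<tau> ws os. \<exists>q\<in>Q \<tau>. cond_typical q n W (Ob \<tau>) (\<rho> \<tau> + e/2) ws os)"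
      define \<W> where "\<W> = (\<Union>i\<in>I. map W ` set_pmf (replicate_pmf n (snd i)))"
      have fin\<W>: "finite \<W>" unfolding \<W>_def using finI q by (auto simp: I_def intro!: finite_set_replicate_pmf)
      have T\<W>: "ws \<in> \<W>" if "\<tau> \<in> \<T>" "T \<tau> ws os" for \<tau> ws os
        using that cond_typical_support unfolding T_def \<W>_def I_def by fastforce
      have cardT: "real (card {ws. T \<tau> ws os}) \<le> real (card (Q \<tau>)) * 2 powr (real n * (\<rho> \<tau> + e/2))"
        if t: "\<tau> \<in> \<T>" for \<tau> os
      proof -
        have "{ws. T \<tau> ws os} = (\<Union>q\<in>Q \<tau>. {ws. cond_typical q n W (Ob \<tau>) (\<rho> \<tau> + e/2) ws os})"
          unfolding T_def by auto
        then have "card {ws. T \<tau> ws os} \<le> (\<Sum>q\<in>Q \<tau>. card {ws. cond_typical q n W (Ob \<tau>) (\<rho> \<tau> + e/2) ws os})"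
          using card_UN_le[OF Q[OF t]] by simp
        then have "real (card {ws. T \<tau> ws os}) \<le> (\<Sum>q\<in>Q \<tau>. real (card {ws. cond_typical q n W (Ob \<tau>) (\<rho> \<tau> + e/2) ws os}))"
          by (metis of_nat_le_iff of_nat_sum)
        also have "\<dots> \<le> (\<Sum>q\<in>Q \<tau>. 2 powr (real n * (\<rho> \<tau> + e/2)))"
          by (rule sum_mono, rule card_cond_typical(2)) (use q t in auto)
        finally show ?thesis by simp
      qed
      \<comment> \<open>The probability that \<open>w\<close> is emitted while \<open>w'\<close>
        looks typical, which is the price of a collision of the two. Summed over both, it is at most
        the mean number of candidates.\<close>
      define c where "c = (\<lambda>i w w'. measure_pmf.prob (replicate_pmf n (snd i)) {ss. map W ss = w \<and> T (fst i) w' (map (Ob (fst i)) ss)})"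
      have "\<exists>h :: 'b list \<Rightarrow> nat. (\<Sum>i\<in>I. \<Sum>w\<in>\<W>. \<Sum>w'\<in>\<W> - {w}. if h w mod K (fst i) = h w' mod K (fst i) then c i w w' else 0)
         \<le> (\<Sum>i\<in>I. \<Sum>w\<in>\<W>. \<Sum>w'\<in>\<W> - {w}. c i w w' / real (K (fst i)))"
        by (rule hash_exists[OF fin\<W> finI _ _ M]) (use K in \<open>auto simp: c_def I_def\<close>)
      then obtain h :: "'b list \<Rightarrow> nat" where h: "(\<Sum>i\<in>I. \<Sum>w\<in>\<W>. \<Sum>w'\<in>\<W> - {w}. if h w mod K (fst i) = h w' mod K (fst i) then c i w w' else 0)
         \<le> (\<Sum>i\<in>I. \<Sum>w\<in>\<W>. \<Sum>w'\<in>\<W> - {w}. c i w w' / real (K (fst i)))" by blast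
      have avg: "(\<Sum>w\<in>\<W>. \<Sum>w'\<in>\<W> - {w}. c i w w' / real (K (fst i))) \<le> real (card (Q (fst i))) * 2 powr (- (real n * (e/2)))"
        if i: "i \<in> I" for i
      proof -
        let ?R = "replicate_pmf n (snd i)"
        have t: "fst i \<in> \<T>" and finR: "finite (set_pmf ?R)" using i q by (auto simp: I_def intro!: finite_set_replicate_pmf)
        have Kge: "2 powr (real n * (\<rho> (fst i) + e)) \<le> real (K (fst i))" using K t by blast
        then have Kpos: "real (K (fst i)) > 0" using powr_gt_zero[of 2 "real n * (\<rho> (fst i) + e)"] by linarith
        have "(\<Sum>w\<in>\<W>. \<Sum>w'\<in>\<W> - {w}. c i w w') \<le> (\<Sum>w\<in>\<W>. \<Sum>w'\<in>\<W>. c i w w')"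
          by (intro sum_mono sum_mono2) (use fin\<W> in \<open>auto simp: c_def\<close>)
        also have "\<dots> = (\<Sum>w'\<in>\<W>. \<Sum>w\<in>\<W>. c i w w')" by (rule sum.swap)
        also have "\<dots> \<le> (\<Sum>w'\<in>\<W>. measure_pmf.prob ?R {ss. T (fst i) w' (map (Ob (fst i)) ss)})"
        proof (rule sum_mono)
          fix w'
          have "(\<Sum>w\<in>\<W>. c i w w') = measure_pmf.prob ?R (\<Union>w\<in>\<W>. {ss. map W ss = w \<and> T (fst i) w' (map (Ob (fst i)) ss)})"
            unfolding c_def
            by (rule measure_pmf.finite_measure_finite_Union[symmetric]) (use fin\<W> in \<open>auto simp: disjoint_family_on_def\<close>)
          also have "\<dots> \<le> measure_pmf.prob ?R {ss. T (fst i) w' (map (Ob (fst i)) ss)}"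
            by (rule measure_pmf.finite_measure_mono) auto
          finally show "(\<Sum>w\<in>\<W>. c i w w') \<le> measure_pmf.prob ?R {ss. T (fst i) w' (map (Ob (fst i)) ss)}" .
        qed
        also have "\<dots> = measure_pmf.expectation ?R (\<lambda>ss. \<Sum>w'\<in>\<W>. indicat_real {ss. T (fst i) w' (map (Ob (fst i)) ss)} ss)"
          by (subst Bochner_Integration.integral_sum) (auto simp: integrable_measure_pmf_finite finR)
        also have "\<dots> \<le> measure_pmf.expectation ?R (\<lambda>ss. real (card (Q (fst i))) * 2 powr (real n * (\<rho> (fst i) + e/2)))"
        proof (rule expectation_mono_supp[OF finR])
          fix ss
          have "(\<Sum>w'\<in>\<W>. indicat_real {ss. T (fst i) w' (map (Ob (fst i)) ss)} ss) = real (card {w'\<in>\<W>. T (fst i) w' (map (Ob (fst i)) ss)})"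
            using fin\<W> by (simp add: indicator_def sum.inter_filter[symmetric] of_bool_def flip: sum.inter_filter)
          also have "{w'\<in>\<W>. T (fst i) w' (map (Ob (fst i)) ss)} = {w'. T (fst i) w' (map (Ob (fst i)) ss)}"
            using T\<W>[OF t] by auto
          finally show "(\<Sum>w'\<in>\<W>. indicat_real {ss. T (fst i) w' (map (Ob (fst i)) ss)} ss) \<le> real (card (Q (fst i))) * 2 powr (real n * (\<rho> (fst i) + e/2))"
            using cardT[OF t] by simp
        qed
        finally have "(\<Sum>w\<in>\<W>. \<Sum>w'\<in>\<W> - {w}. c i w w') \<le> real (card (Q (fst i))) * 2 powr (real n * (\<rho> (fst i) + e/2))" by simp
        then have "(\<Sum>w\<in>\<W>. \<Sum>w'\<in>\<W> - {w}. c i w w') / real (K (fst i)) \<le> real (card (Q (fst i))) * 2 powr (real n * (\<rho> (fst i) + e/2)) / 2 powr (real n * (\<rho> (fst i) + e))"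
          by (rule frac_le[rotated]) (use Kge in auto)
        also have "\<dots> = real (card (Q (fst i))) * 2 powr (- (real n * (e/2)))"
        proof -
          have "real n * (\<rho> (fst i) + e/2) - real n * (\<rho> (fst i) + e) = - (real n * (e/2))"
            by (simp add: algebra_simps)
          then show ?thesis unfolding times_divide_eq_right[symmetric] powr_diff[symmetric] by simp
        qed
        finally show ?thesis by (simp add: sum_divide_distrib)
      qed
      define cost where "cost = (\<lambda>i. \<Sum>w\<in>\<W>. \<Sum>w'\<in>\<W> - {w}. if h w mod K (fst i) = h w' mod K (fst i) then c i w w' else 0)"
      have cost0: "cost i \<ge> 0" for i unfolding cost_def by (intro sum_nonneg) (simp add: c_def)
      have costi: "cost i \<le> d/2" if i: "i \<in> I" for i
      proof -
        have "cost i \<le> (\<Sum>i\<in>I. cost i)" by (rule member_le_sum[OF i]) (use cost0 finI in auto)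
        also have "\<dots> \<le> (\<Sum>i\<in>I. \<Sum>w\<in>\<W>. \<Sum>w'\<in>\<W> - {w}. c i w w' / real (K (fst i)))"
          unfolding cost_def by (rule h)
        also have "\<dots> \<le> (\<Sum>i\<in>I. real (card (Q (fst i))) * 2 powr (- (real n * (e/2))))"
          by (rule sum_mono) (rule avg)
        also have "\<dots> = c0 * 2 powr (- (real n * (e/2)))"
          unfolding c0_def by (simp add: sum_distrib_right case_prod_unfold)
        finally show ?thesis using elim(2) by linarith
      qed
      define dec where "dec = (\<lambda>\<tau> r os. SOME w. w \<in> \<W> \<and> T \<tau> w os \<and> h w mod K \<tau> = r)"
      show "\<exists>(h :: 'b list \<Rightarrow> nat) dec. \<forall>\<tau>\<in>\<T>. \<forall>q\<in>Q \<tau>.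
        measure_pmf.prob (replicate_pmf n q) {ss. dec \<tau> (h (map W ss) mod K \<tau>) (map (Ob \<tau>) ss) \<noteq> map W ss} \<le> d"
      proof (intro exI[of _ h] exI[of _ dec] ballI)
        fix \<tau> q assume t: "\<tau> \<in> \<T>" and qQ: "q \<in> Q \<tau>"
        let ?R = "replicate_pmf n q" and ?i = "(\<tau>, q)"
        have i: "?i \<in> I" using t qQ by (simp add: I_def)
        let ?N = "{ss. \<not> cond_typical q n W (Ob \<tau>) (\<rho> \<tau> + e/2) (map W ss) (map (Ob \<tau>) ss)}"
        let ?C = "\<lambda>w w'. {ss. h w mod K \<tau> = h w' mod K \<tau> \<and> map W ss = w \<and> T \<tau> w' (map (Ob \<tau>) ss)}"
        have "measure_pmf.prob ?R {ss. dec \<tau> (h (map W ss) mod K \<tau>) (map (Ob \<tau>) ss) \<noteq> map W ss}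
           \<le> measure_pmf.prob ?R (?N \<union> (\<Union>w\<in>\<W>. \<Union>w'\<in>\<W> - {w}. ?C w w'))"
        proof (rule prob_mono_supp)
          fix ss assume ss: "ss \<in> set_pmf ?R" and err: "ss \<in> {ss. dec \<tau> (h (map W ss) mod K \<tau>) (map (Ob \<tau>) ss) \<noteq> map W ss}"
          show "ss \<in> ?N \<union> (\<Union>w\<in>\<W>. \<Union>w'\<in>\<W> - {w}. ?C w w')"
          proof (rule ccontr)
            assume a: "\<not> ?thesis"
            have w1: "map W ss \<in> \<W>" using i ss unfolding \<W>_def by force
            have t1: "T \<tau> (map W ss) (map (Ob \<tau>) ss)" using a qQ unfolding T_def by blast
            have "dec \<tau> (h (map W ss) mod K \<tau>) (map (Ob \<tau>) ss) = map W ss"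
              unfolding dec_def
            proof (rule some_equality)
              fix w assume "w \<in> \<W> \<and> T \<tau> w (map (Ob \<tau>) ss) \<and> h w mod K \<tau> = h (map W ss) mod K \<tau>"
              then show "w = map W ss" using a w1 by (cases "w = map W ss") auto
            qed (use w1 t1 in auto)
            then show False using err by simp
          qed
        qed
        also have "\<dots> \<le> measure_pmf.prob ?R ?N + measure_pmf.prob ?R (\<Union>w\<in>\<W>. \<Union>w'\<in>\<W> - {w}. ?C w w')"
          by (rule measure_Un_le) auto
        also have "measure_pmf.prob ?R ?N \<le> d/2" using elim(1) i by auto
        also have "measure_pmf.prob ?R (\<Union>w\<in>\<W>. \<Union>w'\<in>\<W> - {w}. ?C w w') \<le> (\<Sum>w\<in>\<W>. measure_pmf.prob ?R (\<Union>w'\<in>\<W> - {w}. ?C w w'))"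
          by (rule measure_UNION_le) (use fin\<W> in auto)
        also have "\<dots> \<le> (\<Sum>w\<in>\<W>. \<Sum>w'\<in>\<W> - {w}. measure_pmf.prob ?R (?C w w'))"
          by (rule sum_mono, rule measure_UNION_le) (use fin\<W> in auto)
        also have "\<dots> = cost ?i" unfolding cost_def c_def by (intro sum.cong refl) auto
        also have "\<dots> \<le> d/2" by (rule costi[OF i])
        finally show "measure_pmf.prob ?R {ss. dec \<tau> (h (map W ss) mod K \<tau>) (map (Ob \<tau>) ss) \<noteq> map W ss} \<le> d" by simp
      qed
    qed
  qed
qed

section \<open>Key extraction from independent blocks\<close>

lemma fano_replicate:
  assumes fin: "finite (set_pmf q)" and d: "d * log 2 (card (A ` set_pmf q)) \<le> e"
    and err: "measure_pmf.prob (replicate_pmf n q) {ss. dec (C ss) \<noteq> map A ss} \<le> d"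
  shows "shc (replicate_pmf n q) (map A) C \<le> 1 + real n * e"
proof -
  let ?S = "{as. set as \<subseteq> A ` set_pmf q \<and> length as = n}"
  have c: "card (A ` set_pmf q) > 0" using fin set_pmf_not_empty[of q] by (simp add: card_gt_0_iff)
  have "shc (replicate_pmf n q) (map A) C \<le> 1 + d * log 2 (card ?S)"
  proof (rule fano[where d = dec])
    show "finite (set_pmf (replicate_pmf n q))" by (rule finite_set_replicate_pmf[OF fin])
  qed (use fin err in \<open>auto simp: set_replicate_pmf finite_lists_length_eq\<close>)
  also have "log 2 (card ?S) = real n * log 2 (card (A ` set_pmf q))"
    using fin c by (simp add: card_lists_length_eq log_nat_power)
  also have "d * (real n * log 2 (card (A ` set_pmf q))) = real n * (d * log 2 (card (A ` set_pmf q)))" by simp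
  also have "1 + \<dots> \<le> 1 + real n * e" using d by (simp add: mult_left_mono)
  finally show ?thesis .
qed

lemma sh_pair_le:
  assumes "finite (set_pmf p)" "finite S" "A ` set_pmf p \<subseteq> S"
  shows "sh p (\<lambda>\<omega>. (A \<omega>, C \<omega>)) \<le> sh p C + log 2 (card S)"
  using shc_le_log_card[OF assms, of C] by (simp add: shc_def)

lemma sh_le_of_det:
  assumes "finite (set_pmf p)" "\<And>\<omega> \<omega>'. B \<omega> = B \<omega>' \<Longrightarrow> A \<omega> = A \<omega>'"
  shows "sh p A \<le> sh p B"
  by (rule sh_mono[OF assms(1)]) (use assms(2) in \<open>unfold det_by_def, blast\<close>)

lemma shc_mono_det:
  assumes "finite (set_pmf p)" "\<And>\<omega> \<omega>'. C \<omega> = C \<omega>' \<Longrightarrow> B \<omega> = B \<omega>'"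
  shows "shc p A C \<le> shc p A B"
  by (rule shc_mono_cond[OF assms(1)]) (use assms(2) in \<open>unfold det_by_def, blast\<close>)

text \<open>The value \<open>t mod (KU * KS * D)\<close> consists of the helper data
  \<open>t mod KU\<close>, the key and one more digit below \<open>D\<close>. What it reveals about
  \<open>B\<close> is carried by these three; the helper data carry at most
  \<open>log 2 (real KU)\<close> bits, the last digit at most \<open>log 2 (real D)\<close>, and the
  rest falls to the key.\<close>

lemma key_equivocation:
  fixes R :: "'w pmf" and t :: "'w \<Rightarrow> nat" and B :: "'w \<Rightarrow> 'b" and C :: "'w \<Rightarrow> 'c"
  assumes fin: "finite (set_pmf R)" and pos: "KU > 0" "KS > 0" "D > 0"
  shows "shc R (\<lambda>\<omega>. (t \<omega> mod (KU * KS)) div KU) (\<lambda>\<omega>. (t \<omega> mod KU, C \<omega>))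
     \<ge> shc R B C - shc R B (\<lambda>\<omega>. (t \<omega> mod (KU * KS * D), C \<omega>)) - log 2 (real D) - log 2 (real KU)"
proof -
  let ?m = "KU * KS" and ?M = "KU * KS * D"
  have l1: "sh R (\<lambda>\<omega>. (t \<omega> mod KU, C \<omega>)) \<le> sh R C + log 2 (real KU)"
    using sh_pair_le[OF fin, of "{..<KU}" "\<lambda>\<omega>. t \<omega> mod KU" C] pos by (simp add: image_subset_iff)
  have l2: "sh R (\<lambda>\<omega>. ((t \<omega> mod ?m) div KU, t \<omega> mod KU, C \<omega>)) = sh R (\<lambda>\<omega>. (t \<omega> mod ?m, C \<omega>))"
  proof (rule sh_kernel_eq)
    fix \<omega> \<omega>'
    have "t \<omega> mod ?m = KU * ((t \<omega> mod ?m) div KU) + t \<omega> mod KU" for \<omega>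
      using mult_div_mod_eq[of KU "t \<omega> mod ?m"] by (simp add: mod_mod_cancel)
    moreover have "t \<omega> mod ?m = t \<omega>' mod ?m \<Longrightarrow> t \<omega> mod KU = t \<omega>' mod KU"
      by (metis dvd_triv_left mod_mod_cancel)
    ultimately show "((t \<omega> mod ?m) div KU, t \<omega> mod KU, C \<omega>) = ((t \<omega>' mod ?m) div KU, t \<omega>' mod KU, C \<omega>') \<longleftrightarrow>
        (t \<omega> mod ?m, C \<omega>) = (t \<omega>' mod ?m, C \<omega>')" by (metis prod.inject)
  qed
  have l3: "sh R (\<lambda>\<omega>. (t \<omega> mod ?M, C \<omega>)) \<le> sh R (\<lambda>\<omega>. (t \<omega> mod ?m, C \<omega>)) + log 2 (real D)"
  proof -
    have e: "t \<omega> mod ?M = ?m * ((t \<omega> mod ?M) div ?m) + t \<omega> mod ?m" for \<omega>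
      using mult_div_mod_eq[of ?m "t \<omega> mod ?M"] by (simp add: mod_mod_cancel)
    have "sh R (\<lambda>\<omega>. (t \<omega> mod ?M, C \<omega>)) \<le> sh R (\<lambda>\<omega>. ((t \<omega> mod ?M) div ?m, t \<omega> mod ?m, C \<omega>))"
      by (rule sh_le_of_det[OF fin]) (metis e prod.inject)
    also have "\<dots> \<le> sh R (\<lambda>\<omega>. (t \<omega> mod ?m, C \<omega>)) + log 2 (card {..<D})"
    proof (rule sh_pair_le[OF fin])
      have "(t \<omega> mod ?M) div ?m < D" for \<omega>
        using pos by (intro less_mult_imp_div_less) (simp add: mult.commute)
      then show "(\<lambda>\<omega>. (t \<omega> mod ?M) div ?m) ` set_pmf R \<subseteq> {..<D}" by auto
    qed simp
    finally show ?thesis by simp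
  qed
  have l4: "sh R (\<lambda>\<omega>. (B \<omega>, C \<omega>)) \<le> sh R (\<lambda>\<omega>. (B \<omega>, t \<omega> mod ?M, C \<omega>))"
    by (rule sh_le_of_det[OF fin]) auto
  show ?thesis using l1 l2 l3 l4 unfolding shc_def by linarith
qed

text \<open>Rounding up at most doubles a number that is at least 1 and sends smaller positive ones
  to 1; hence the maximum.\<close>

lemma log_nat_ceiling_le:
  assumes "x > 0"
  shows "log 2 (real (nat \<lceil>x\<rceil>)) \<le> 1 + max 0 (log 2 x)" "nat \<lceil>x\<rceil> > 0" "x \<le> real (nat \<lceil>x\<rceil>)"
proof -
  show p: "nat \<lceil>x\<rceil> > 0" using assms by simp
  show "x \<le> real (nat \<lceil>x\<rceil>)" by (rule real_nat_ceiling_ge)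
  have "real (nat \<lceil>x\<rceil>) \<le> 2 * max 1 x" using assms by linarith
  then have "log 2 (real (nat \<lceil>x\<rceil>)) \<le> log 2 (2 * max 1 x)"
    using p by (subst log_le_cancel_iff) auto
  also have "\<dots> = 1 + log 2 (max 1 x)" by (simp add: log_mult)
  also have "\<dots> \<le> 1 + max 0 (log 2 x)" by (simp add: max_def)
  finally show "log 2 (real (nat \<lceil>x\<rceil>)) \<le> 1 + max 0 (log 2 x)" .
qed

text \<open>
  \<open>G\<close> stands for \<open>(X\<^sup>n, Z\<^sup>n)\<close>, in which case the last condition bounds \<open>I(X\<^sup>n; J | Z\<^sup>n) = H(J | Z\<^sup>n) - H(J | X\<^sup>n, Z\<^sup>n)\<close>.
\<close>

definition code_ok ::
  "real \<Rightarrow> nat \<Rightarrow> real \<Rightarrow> real \<Rightarrow> 'w pmf \<Rightarrow> ('w \<Rightarrow> nat) \<Rightarrow> ('w \<Rightarrow> nat) \<Rightarrow> ('w \<Rightarrow> 'j) \<Rightarrow> ('w \<Rightarrow> 'z) \<Rightarrow> ('w \<Rightarrow> 'g) \<Rightarrow> bool" where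
  "code_ok e KS s l R S S' J Z G \<longleftrightarrow>
     measure_pmf.prob R {\<omega>. S' \<omega> \<noteq> S \<omega>} \<le> e \<and>
     log 2 (real KS) - s \<le> shc R S (\<lambda>\<omega>. (J \<omega>, Z \<omega>)) \<and>
     shc R J Z - shc R J G \<le> l"

text \<open>
  A single hash \<open>h\<close> of \<open>B\<^sup>N\<close> is read off modulo \<open>KU\<close> (helper data), modulo \<open>KU * KS\<close> (helper data and key)
  and modulo \<open>KU * KS * D i\<close>. The last one determines \<open>B\<^sup>N\<close> from \<open>A\<^sup>N\<close> and the observation of
  the eavesdropper, with \<open>D i\<close> as small as possible; hence the key is nearly uniform for the eavesdropper.
\<close>

theorem superletter_code:
  fixes q :: "'i::finite \<Rightarrow> 's pmf" and B :: "'s \<Rightarrow> 'b" and A :: "'s \<Rightarrow> 'a" and f :: "'b \<Rightarrow> 'a" and Y G Z :: "'s \<Rightarrow> 'o"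
  assumes fin: "\<And>i. finite (set_pmf (q i))" and A: "\<And>s. A s = f (B s)"
    and rV: "\<And>i. shc (q i) A Y \<le> rV" "\<And>i. shc (q i) A G \<le> rV"
    and rU: "\<And>i. shc (q i) B (\<lambda>s. (A s, Y s)) \<le> rU" "\<And>i. shc (q i) B (\<lambda>s. (A s, G s)) \<le> rU"
    and hz: "\<And>i. hz \<le> shc (q i) B (\<lambda>s. (A s, Z s))"
    and leak: "\<And>i. rU + shc (q i) A Z - shc (q i) B G \<le> leak"
    and e: "e > 0" and er: "er > 0"
  shows "\<forall>\<^sub>F N in sequentially. \<forall>KS. KS > 0 \<longrightarrow> log 2 (real KS) \<le> real N * (hz - rU + e) \<longrightarrow>
    (\<exists>KV KU hV hU key dec. real KV * real KU \<le> 2 powr (real N * (rV + rU + 4 * e)) \<and>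
       (\<forall>as. hV as < KV) \<and> (\<forall>bs. hU bs < KU) \<and> (\<forall>bs. key bs < KS) \<and> (\<forall>j os. dec j os < KS) \<and>
       (\<forall>i. code_ok er KS (6 * (real N * e)) (real N * (leak + 6 * e)) (replicate_pmf N (q i))
           (\<lambda>ss. key (map B ss)) (\<lambda>ss. dec (hV (map A ss) :: nat, hU (map B ss) :: nat) (map Y ss))
           (\<lambda>ss. (hV (map A ss), hU (map B ss))) (map Z) (map G)))"
proof -
  define \<kappa> where "\<kappa> = (\<Sum>i\<in>UNIV. log 2 (card (A ` set_pmf (q i))) + log 2 (card (B ` set_pmf (q i))))"
  have card1: "log 2 (card (g ` set_pmf (q i))) \<ge> 0" for i and g :: "'s \<Rightarrow> 'q"
  proof -
    have "card (g ` set_pmf (q i)) \<ge> 1" using fin[of i] set_pmf_not_empty[of "q i"] by (simp add: Suc_le_eq card_gt_0_iff)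
    then show ?thesis by simp
  qed
  have kk: "log 2 (card (A ` set_pmf (q i))) + log 2 (card (B ` set_pmf (q i))) \<le> \<kappa>" for i
    unfolding \<kappa>_def by (rule member_le_sum) (auto intro!: add_nonneg_nonneg card1)
  have \<kappa>: "log 2 (card (A ` set_pmf (q i))) \<le> \<kappa>" "log 2 (card (B ` set_pmf (q i))) \<le> \<kappa>" for i
    using kk[of i] card1[of A i] card1[of B i] by linarith+
  have \<kappa>0: "\<kappa> \<ge> 0" using \<kappa>(1)[of undefined] card1[of A undefined] by linarith
  \<comment> \<open>Two decodings in a row give error \<open>2 * d \<le> er\<close>; the other term
    of the minimum keeps the error term of each use of Fano's inequality below \<open>e\<close> bits
    per superletter.\<close>
  define d where "d = min (er / 2) (e / (\<kappa> + 1))"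
  have d: "d > 0" "d \<le> er / 2"
  proof -
    show "d > 0" unfolding d_def using e er \<kappa>0 by simp
    show "d \<le> er / 2" unfolding d_def by (rule min.cobounded1)
  qed
  have d\<kappa>: "d * x \<le> e" if "x \<le> \<kappa>" for x
  proof -
    have "d * x \<le> d * \<kappa>" using that d by (simp add: mult_left_mono)
    also have "\<dots> \<le> e / (\<kappa> + 1) * \<kappa>" by (rule mult_right_mono) (auto simp: d_def \<kappa>0)
    also have "\<dots> \<le> e" using e \<kappa>0 by (simp add: field_simps)
    finally show ?thesis .
  qed
  define O1 where "O1 = (\<lambda>b. if b then Y else G)"
  \<comment> \<open>Tasks for \<open>B\<^sup>N\<close>, always with \<open>A\<^sup>N\<close> known.
    \<open>Inl True\<close> is the decoder and \<open>Inl False\<close> a hypothetical one that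
    observes \<open>G\<close>; both face all states. \<open>Inr i\<close> is the eavesdropper in
    state \<open>i\<close>, who may know the state, as the modulus depends on it through
    \<open>D i\<close>.\<close>
  define O2 where "O2 = (\<lambda>\<tau> :: bool + 'i. case \<tau> of Inl b \<Rightarrow> (\<lambda>s. (A s, O1 b s)) | Inr i \<Rightarrow> (\<lambda>s. (A s, Z s)))"
  define Q2 where "Q2 = (\<lambda>\<tau> :: bool + 'i. case \<tau> of Inl b \<Rightarrow> range q | Inr i \<Rightarrow> {q i})"
  define H where "H = (\<lambda>i. shc (q i) B (\<lambda>s. (A s, Z s)))"
  define r2 where "r2 = (\<lambda>\<tau> :: bool + 'i. case \<tau> of Inl b \<Rightarrow> rU | Inr i \<Rightarrow> H i)"
  have rV0: "rV \<ge> 0" using rV(1)[of undefined] shc_nonneg[OF fin, of undefined A Y] by linarith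
  have rU0: "rU \<ge> 0" using rU(1)[of undefined] shc_nonneg[OF fin, of undefined B "\<lambda>s. (A s, Y s)"] by linarith
  have ev1: "\<forall>\<^sub>F n in sequentially. \<forall>K M. M > 0 \<longrightarrow> (\<forall>\<tau>\<in>UNIV. K \<tau> dvd M \<and> 2 powr (real n * (rV + e)) \<le> real (K \<tau>)) \<longrightarrow>
     (\<exists>(h :: 'a list \<Rightarrow> nat) dec. \<forall>\<tau>\<in>UNIV. \<forall>q\<in>range q.
        measure_pmf.prob (replicate_pmf n q) {ss. dec \<tau> (h (map A ss) mod K \<tau>) (map (O1 \<tau>) ss) \<noteq> map A ss} \<le> d)"
    by (rule slepian_wolf_hash) (use fin rV e d in \<open>auto simp: O1_def\<close>)
  have ev2: "\<forall>\<^sub>F n in sequentially. \<forall>K M. M > 0 \<longrightarrow> (\<forall>\<tau>\<in>UNIV. K \<tau> dvd M \<and> 2 powr (real n * (r2 \<tau> + e)) \<le> real (K \<tau>)) \<longrightarrow>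
     (\<exists>(h :: 'b list \<Rightarrow> nat) dec. \<forall>\<tau>\<in>UNIV. \<forall>q\<in>Q2 \<tau>.
        measure_pmf.prob (replicate_pmf n q) {ss. dec \<tau> (h (map B ss) mod K \<tau>) (map (O2 \<tau>) ss) \<noteq> map B ss} \<le> d)"
    by (rule slepian_wolf_hash) (use fin rU e d in \<open>auto simp: O1_def O2_def Q2_def r2_def H_def split: sum.splits\<close>)
  have ev3: "\<forall>\<^sub>F N in sequentially. 2 / e \<le> real N"
    using filterlim_real_sequentially unfolding filterlim_at_top by blast
  show ?thesis using ev1 ev2 ev3
  proof eventually_elim
    case (elim N)
    have N2: "2 \<le> real N * e" using elim(3) e by (simp add: field_simps)
    show ?case
    proof (intro allI impI)
      fix KS :: nat assume KS: "KS > 0" and logKS: "log 2 (real KS) \<le> real N * (hz - rU + e)"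
      define KV where "KV = nat \<lceil>2 powr (real N * (rV + e))\<rceil>"
      define KU where "KU = nat \<lceil>2 powr (real N * (rU + e))\<rceil>"
      \<comment> \<open>The moduli of helper data and key are filled up to what decoding from
        \<open>Z\<close> takes. Where the quotient is at most 1 nothing is missing and
        \<open>D i\<close> is 1.\<close>
      define D where "D = (\<lambda>i. nat \<lceil>2 powr (real N * (H i + e)) / (real KU * real KS)\<rceil>)"
      have KV: "KV > 0" "2 powr (real N * (rV + e)) \<le> real KV" "log 2 (real KV) \<le> real N * (rV + 2 * e)"
        using log_nat_ceiling_le[of "2 powr (real N * (rV + e))"] rV0 N2 e unfolding KV_def
        by (auto simp: algebra_simps max_def split: if_splits)
      have KU: "KU > 0" "2 powr (real N * (rU + e)) \<le> real KU" "log 2 (real KU) \<le> real N * (rU + 2 * e)"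
        using log_nat_ceiling_le[of "2 powr (real N * (rU + e))"] rU0 N2 e unfolding KU_def
        by (auto simp: algebra_simps max_def split: if_splits)
      have Dx: "2 powr (real N * (H i + e)) / (real KU * real KS) > 0" for i using KU KS by simp
      have D: "D i > 0" "2 powr (real N * (H i + e)) \<le> real (KU * KS * D i)"
         "log 2 (real (D i)) \<le> 1 + max 0 (real N * (H i + e) - log 2 (real KU) - log 2 (real KS))" for i
      proof -
        show "D i > 0" unfolding D_def by (rule log_nat_ceiling_le(2)[OF Dx])
        have "2 powr (real N * (H i + e)) / (real KU * real KS) \<le> real (D i)" unfolding D_def by (rule log_nat_ceiling_le(3)[OF Dx])
        then show "2 powr (real N * (H i + e)) \<le> real (KU * KS * D i)" using KU KS by (simp add: field_simps)
        have "log 2 (2 powr (real N * (H i + e)) / (real KU * real KS)) = real N * (H i + e) - log 2 (real KU) - log 2 (real KS)"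
          using KU KS by (simp add: log_divide log_mult)
        then show "log 2 (real (D i)) \<le> 1 + max 0 (real N * (H i + e) - log 2 (real KU) - log 2 (real KS))"
          using log_nat_ceiling_le(1)[OF Dx, of i] unfolding D_def by simp
      qed
      obtain hV0 decV where decV: "\<And>\<tau> i. measure_pmf.prob (replicate_pmf N (q i)) {ss. decV \<tau> (hV0 (map A ss) mod KV) (map (O1 \<tau>) ss) \<noteq> map A ss} \<le> d"
        using elim(1)[rule_format, of KV "\<lambda>_. KV"] KV by auto
      define K2 where "K2 = (\<lambda>\<tau> :: bool + 'i. case \<tau> of Inl b \<Rightarrow> KU | Inr i \<Rightarrow> KU * KS * D i)"
      define M where "M = KU * KS * (\<Prod>i\<in>UNIV. D i)"
      have Mpos: "M > 0" unfolding M_def using KU KS D(1) by (simp add: prod_pos)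
      have K2: "K2 \<tau> dvd M \<and> 2 powr (real N * (r2 \<tau> + e)) \<le> real (K2 \<tau>)" for \<tau>
      proof (cases \<tau>)
        case (Inl b)
        then show ?thesis using KU by (simp add: K2_def M_def r2_def)
      next
        case (Inr i)
        have "D i dvd (\<Prod>i\<in>UNIV. D i)" by (rule dvd_prodI) auto
        then show ?thesis using Inr D(2)[of i] by (simp add: K2_def M_def r2_def mult_dvd_mono)
      qed
      obtain h decU where decU: "\<And>\<tau> q. q \<in> Q2 \<tau> \<Longrightarrow> measure_pmf.prob (replicate_pmf N q) {ss. decU \<tau> (h (map B ss) mod K2 \<tau>) (map (O2 \<tau>) ss) \<noteq> map B ss} \<le> d"
        using elim(2)[rule_format, of M K2] Mpos K2 by blast
      have decUI: "measure_pmf.prob (replicate_pmf N (q i)) {ss. decU (Inl b) (h (map B ss) mod KU) (map (\<lambda>s. (A s, O1 b s)) ss) \<noteq> map B ss} \<le> d" for i b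
        using decU[of "q i" "Inl b"] by (simp add: Q2_def K2_def O2_def)
      have decUZ: "measure_pmf.prob (replicate_pmf N (q i)) {ss. decU (Inr i) (h (map B ss) mod (KU * KS * D i)) (map (\<lambda>s. (A s, Z s)) ss) \<noteq> map B ss} \<le> d" for i
        using decU[of "q i" "Inr i"] by (simp add: Q2_def K2_def O2_def)
      define hV where "hV = (\<lambda>as. hV0 as mod KV)"
      define hU where "hU = (\<lambda>bs. h bs mod KU)"
      define key where "key = (\<lambda>bs. (h bs mod (KU * KS)) div KU)"
      define dec where "dec = (\<lambda>(v, u) os. key (decU (Inl True) u (zip (decV True v os) os)))"
      have zipm: "zip (map A ss) (map g ss) = map (\<lambda>s. (A s, g s)) ss" for ss and g :: "'s \<Rightarrow> 'o"
        by (induction ss) auto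
      have keylt: "key bs < KS" for bs
        unfolding key_def using KU KS by (intro less_mult_imp_div_less) (simp add: mult.commute)
      have ok: "code_ok er KS (6 * (real N * e)) (real N * (leak + 6 * e)) (replicate_pmf N (q i))
           (\<lambda>ss. key (map B ss)) (\<lambda>ss. dec (hV (map A ss), hU (map B ss)) (map Y ss))
           (\<lambda>ss. (hV (map A ss), hU (map B ss))) (map Z) (map G)" for i
      proof -
        let ?R = "replicate_pmf N (q i)"
        have finR: "finite (set_pmf ?R)" by (simp add: fin finite_set_replicate_pmf)
        have Adet: "map B ss = map B ss' \<Longrightarrow> map A ss = map A ss'" for ss ss'
        proof -
          have "map A ss = map f (map B ss)" for ss by (simp add: A)
          then show "map B ss = map B ss' \<Longrightarrow> map A ss = map A ss'" by metis
        qed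
        let ?J = "\<lambda>ss. (hV (map A ss), hU (map B ss))"
        have err: "measure_pmf.prob ?R {ss. dec (?J ss) (map Y ss) \<noteq> key (map B ss)} \<le> er"
        proof -
          have "measure_pmf.prob ?R {ss. dec (?J ss) (map Y ss) \<noteq> key (map B ss)} \<le>
             measure_pmf.prob ?R ({ss. decV True (hV0 (map A ss) mod KV) (map (O1 True) ss) \<noteq> map A ss} \<union>
                {ss. decU (Inl True) (h (map B ss) mod KU) (map (\<lambda>s. (A s, O1 True s)) ss) \<noteq> map B ss})"
            by (rule prob_mono_supp) (auto simp: dec_def hV_def hU_def zipm O1_def)
          also have "\<dots> \<le> d + d" by (intro order_trans[OF measure_Un_le] add_mono decV decUI) auto
          finally show ?thesis using d by simp
        qed
        have sec: "log 2 (real KS) - 6 * (real N * e) \<le> shc ?R (\<lambda>ss. key (map B ss)) (\<lambda>ss. (?J ss, map Z ss))"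
        proof -
          \<comment> \<open>\<open>A\<^sup>N\<close> is handed to the eavesdropper: this can only
            lower the equivocation, and the decoding of \<open>B\<^sup>N\<close> from
            \<open>Z\<^sup>N\<close> takes it as known.\<close>
          let ?C = "\<lambda>ss. (map A ss, map Z ss)"
          have "shc ?R (\<lambda>ss. key (map B ss)) (\<lambda>ss. (hU (map B ss), ?C ss)) \<le> shc ?R (\<lambda>ss. key (map B ss)) (\<lambda>ss. (?J ss, map Z ss))"
            by (rule shc_mono_det[OF finR]) auto
          moreover have "shc ?R (\<lambda>ss. key (map B ss)) (\<lambda>ss. (hU (map B ss), ?C ss)) \<ge>
             shc ?R (map B) ?C - shc ?R (map B) (\<lambda>ss. (h (map B ss) mod (KU * KS * D i), ?C ss)) - log 2 (real (D i)) - log 2 (real KU)"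
            using key_equivocation[OF finR KU(1) KS D(1)[of i], where B = "map B" and C = ?C and t = "\<lambda>ss. h (map B ss)"] by (simp add: key_def hU_def)
          moreover have "shc ?R (map B) ?C = real N * H i"
          proof -
            have "shc ?R (map B) ?C = shc ?R (map B) (map (\<lambda>s. (A s, Z s)))"
              by (rule shc_eq[OF finR]; unfold det_by_def map_eq_map_iff_pair; simp)
            then show ?thesis unfolding H_def by (simp add: shc_replicate fin)
          qed
          moreover have "shc ?R (map B) (\<lambda>ss. (h (map B ss) mod (KU * KS * D i), ?C ss)) \<le> 1 + real N * e"
          proof (rule fano_replicate[OF fin, where d = d])
            show "d * log 2 (card (B ` set_pmf (q i))) \<le> e" by (rule d\<kappa>[OF \<kappa>(2)])
            show "measure_pmf.prob ?R {ss. (\<lambda>(t, as, zs). decU (Inr i) t (zip as zs)) (h (map B ss) mod (KU * KS * D i), ?C ss) \<noteq> map B ss} \<le> d"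
              using decUZ[of i] by (simp add: zipm)
          qed
          moreover have "real N * H i \<ge> real N * hz" using hz[of i] by (simp add: H_def mult_left_mono)
          \<comment> \<open>If the maximum in \<open>D(3)\<close> is positive,
            \<open>log 2 (D i) + log 2 KU\<close> cancels against \<open>H i\<close> and leaves the
            key length; if it is 0, the equivocation left by the helper data suffices by
            \<open>logKS\<close>.\<close>
          ultimately show ?thesis using D(3)[of i] KU(3) logKS N2
            by (simp add: algebra_simps max_def split: if_splits)
        qed
        \<comment> \<open>Upper bound: \<open>hU\<close> costs at most \<open>log 2 KU\<close> bits
          and \<open>hV\<close> is a function of \<open>A\<^sup>N\<close>. Lower bound: together
          with \<open>G\<^sup>N\<close> the helper data give back \<open>A\<^sup>N\<close> and then
          \<open>B\<^sup>N\<close>, so up to Fano terms they carry the whole entropy of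
          \<open>B\<^sup>N\<close> given \<open>G\<^sup>N\<close>.\<close>
        have lk: "shc ?R ?J (map Z) - shc ?R ?J (map G) \<le> real N * (leak + 6 * e)"
        proof -
          have u1: "sh ?R (\<lambda>ss. (?J ss, map Z ss)) \<le> sh ?R (\<lambda>ss. (hU (map B ss), map A ss, map Z ss))"
            by (rule sh_le_of_det[OF finR]) auto
          have u2: "sh ?R (\<lambda>ss. (hU (map B ss), map A ss, map Z ss)) \<le> sh ?R (\<lambda>ss. (map A ss, map Z ss)) + log 2 (card {..<KU})"
            by (rule sh_pair_le[OF finR]) (use KU in \<open>auto simp: hU_def\<close>)
          have u3: "shc ?R (map A) (map Z) = real N * shc (q i) A Z" by (rule shc_replicate[OF fin])
          have u: "shc ?R ?J (map Z) \<le> real N * (rU + 2 * e) + real N * shc (q i) A Z"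
            using u1 u2 u3 KU(3) unfolding shc_def by simp
          have v1: "sh ?R (\<lambda>ss. (map B ss, map G ss)) \<le> sh ?R (\<lambda>ss. (map B ss, map A ss, ?J ss, map G ss))"
            by (rule sh_le_of_det[OF finR]) auto
          have v2: "shc ?R (map A) (\<lambda>ss. (?J ss, map G ss)) \<le> 1 + real N * e"
          proof (rule fano_replicate[OF fin, where d = d])
            show "d * log 2 (card (A ` set_pmf (q i))) \<le> e" by (rule d\<kappa>[OF \<kappa>(1)])
            show "measure_pmf.prob ?R {ss. (\<lambda>((v, u), gs). decV False v gs) (?J ss, map G ss) \<noteq> map A ss} \<le> d"
              using decV[of i False] by (simp add: hV_def O1_def)
          qed
          have v3: "shc ?R (map B) (\<lambda>ss. (map A ss, ?J ss, map G ss)) \<le> 1 + real N * e"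
          proof (rule fano_replicate[OF fin, where d = d])
            show "d * log 2 (card (B ` set_pmf (q i))) \<le> e" by (rule d\<kappa>[OF \<kappa>(2)])
            show "measure_pmf.prob ?R {ss. (\<lambda>(as, (v, u), gs). decU (Inl False) u (zip as gs)) (map A ss, ?J ss, map G ss) \<noteq> map B ss} \<le> d"
              using decUI[of i False] by (simp add: hU_def O1_def zipm)
          qed
          have v4: "shc ?R (map B) (map G) = real N * shc (q i) B G" by (rule shc_replicate[OF fin])
          have v: "shc ?R ?J (map G) \<ge> real N * shc (q i) B G - 2 - 2 * (real N * e)"
            using v1 v2 v3 v4 unfolding shc_def by simp
          have "real N * (rU + shc (q i) A Z - shc (q i) B G) \<le> real N * leak"
            by (rule mult_left_mono[OF leak]) simp
          then show ?thesis using u v N2 by (simp add: algebra_simps)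
        qed
        show ?thesis unfolding code_ok_def using err sec lk by blast
      qed
      have KVKU: "real KV * real KU \<le> 2 powr (real N * (rV + rU + 4 * e))"
      proof -
        have "log 2 (real KV * real KU) \<le> real N * (rV + rU + 4 * e)"
          using KV KU by (simp add: log_mult algebra_simps)
        then show ?thesis using KV(1) KU(1) by (simp add: log_le_iff)
      qed
      show "\<exists>KV KU hV hU key dec. real KV * real KU \<le> 2 powr (real N * (rV + rU + 4 * e)) \<and>
       (\<forall>as. hV as < KV) \<and> (\<forall>bs. hU bs < KU) \<and> (\<forall>bs. key bs < KS) \<and> (\<forall>j os. dec j os < KS) \<and>
       (\<forall>i. code_ok er KS (6 * (real N * e)) (real N * (leak + 6 * e)) (replicate_pmf N (q i))
           (\<lambda>ss. key (map B ss)) (\<lambda>ss. dec (hV (map A ss) :: nat, hU (map B ss) :: nat) (map Y ss))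
           (\<lambda>ss. (hV (map A ss), hU (map B ss))) (map Z) (map G))"
      proof (intro exI conjI allI)
        show "real KV * real KU \<le> 2 powr (real N * (rV + rU + 4 * e))" by (rule KVKU)
        show "hV as < KV" "hU bs < KU" for as bs using KV KU by (auto simp: hV_def hU_def)
        show "key bs < KS" for bs by (rule keylt)
        show "dec j os < KS" for j os using keylt by (auto simp: dec_def split: prod.split)
      qed (rule ok)
    qed
  qed
qed

section \<open>Single-letter rates\<close>

lemma shc_kernel_eq:
  assumes "\<And>\<omega> \<omega>'. C \<omega> = C \<omega>' \<longleftrightarrow> D \<omega> = D \<omega>'"
  shows "shc p A C = shc p A D"
proof -
  have "sh p (\<lambda>\<omega>. (A \<omega>, C \<omega>)) = sh p (\<lambda>\<omega>. (A \<omega>, D \<omega>))" by (rule sh_kernel_eq) (simp add: assms)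
  moreover have "sh p C = sh p D" by (rule sh_kernel_eq) (rule assms)
  ultimately show ?thesis by (simp add: shc_def)
qed

definition aux_kernel :: "(nat \<Rightarrow> nat pmf) \<Rightarrow> ('xt \<Rightarrow> nat pmf) \<Rightarrow> 'xt \<Rightarrow> (nat \<times> nat) pmf" where
  "aux_kernel PV PU xt = PU xt \<bind> (\<lambda>u. map_pmf (\<lambda>v. (v, u)) (PV u))"

definition full_law ::
  "('x, 'xt, 'y, 'z, 'k, 'l) compound_model \<Rightarrow> (nat \<Rightarrow> nat pmf) \<Rightarrow> ('xt \<Rightarrow> nat pmf) \<Rightarrow> 'k \<Rightarrow> 'l
     \<Rightarrow> ((nat \<times> nat) \<times> 'xt \<times> 'x \<times> 'y \<times> 'z) pmf" where
  "full_law M PV PU k l = adjoin (letter_law M k l) fst (aux_kernel PV PU)"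

lemma letter_law_eq:
  "letter_law M k l = P_X M \<bind> (\<lambda>x. P_Xt M x \<bind> (\<lambda>xt. map_pmf (\<lambda>yz. (xt, x, yz)) (P_YZ M k l x)))"
  unfolding letter_law_def map_pmf_def by (simp add: case_prod_unfold)

lemma full_law_eq:
  "full_law M PV PU k l = P_X M \<bind> (\<lambda>x. P_Xt M x \<bind> (\<lambda>xt. aux_kernel PV PU xt \<bind> (\<lambda>w. map_pmf (\<lambda>yz. (w, xt, x, yz)) (P_YZ M k l x))))"
  unfolding full_law_def adjoin_def letter_law_eq map_pmf_def
  by (simp add: bind_assoc_pmf bind_return_pmf) (intro bind_pmf_cong refl, rule bind_commute_pmf)

text \<open>Each single-letter quantity lives on its own \<open>aux_law\<close>. As images of one
  \<open>full_law\<close>, those for \<open>Y\<^sub>k\<close> and for \<open>Z\<^sub>l\<close> can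
  be compared on one probability space.\<close>

lemma aux_law_eq_map_full_law:
  assumes "\<And>x. Q x = map_pmf c (P_YZ M k l x)"
  shows "aux_law M PV PU Q = map_pmf (\<lambda>p. (fst (fst p), snd (fst p), fst (snd p), fst (snd (snd p)), c (snd (snd (snd p))))) (full_law M PV PU k l)"
  unfolding full_law_eq aux_law_def aux_kernel_def assms map_pmf_def
  by (simp add: bind_assoc_pmf bind_return_pmf)

text \<open>The Markov chain \<open>(V, U, Xt) - X - (Y, Z)\<close>.\<close>

lemma full_law_adjoin_source:
  "full_law M PV PU k l = map_pmf (\<lambda>((w, xt), x, yz). (w, xt, x, yz))
     (adjoin (P_X M \<bind> (\<lambda>x. map_pmf (\<lambda>yz. (x, yz)) (P_YZ M k l x))) fst (\<lambda>x. P_Xt M x \<bind> (\<lambda>xt. map_pmf (\<lambda>w. (w, xt)) (aux_kernel PV PU xt))))"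
  unfolding full_law_eq adjoin_def map_pmf_def
  apply (simp add: bind_assoc_pmf bind_return_pmf)
  apply (intro bind_pmf_cong refl)
  apply (subst (2) bind_commute_pmf)
  apply (intro bind_pmf_cong refl)
  apply (subst (2) bind_commute_pmf)
  apply (rule refl)
  done

lemma finite_set_aux_kernel:
  assumes "aux_kernels cV cU PV PU"
  shows "finite (set_pmf (aux_kernel PV PU xt))"
proof -
  from assms[unfolded aux_kernels_def] obtain \<V> \<U> where *: "finite \<V> \<and> card \<V> \<le> cV \<and> finite \<U> \<and> card \<U> \<le> cU \<and>
        (\<forall>xt. set_pmf (PU xt) \<subseteq> \<U>) \<and> (\<forall>u\<in>\<U>. set_pmf (PV u) \<subseteq> \<V>)" by (elim exE)
  then have a: "finite \<V>" "finite \<U>" "\<And>xt. set_pmf (PU xt) \<subseteq> \<U>" "\<And>u. u \<in> \<U> \<Longrightarrow> set_pmf (PV u) \<subseteq> \<V>"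
    by auto
  have "set_pmf (aux_kernel PV PU xt) \<subseteq> \<V> \<times> \<U>"
  proof
    fix w assume "w \<in> set_pmf (aux_kernel PV PU xt)"
    then obtain u v where w: "u \<in> set_pmf (PU xt)" "v \<in> set_pmf (PV u)" "w = (v, u)"
      unfolding aux_kernel_def by auto
    have "u \<in> \<U>" using a(3) w(1) by blast
    then show "w \<in> \<V> \<times> \<U>" using a(4) w by blast
  qed
  then show ?thesis using a by (meson finite_SigmaI finite_subset)
qed

context
  fixes M :: "('x::finite, 'xt::finite, 'y::finite, 'z::finite, 'k::finite, 'l::finite) compound_model"
    and PV :: "nat \<Rightarrow> nat pmf" and PU :: "'xt \<Rightarrow> nat pmf"
  assumes finK: "\<And>xt. finite (set_pmf (aux_kernel PV PU xt))"
begin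

lemma finite_set_full_law: "finite (set_pmf (full_law M PV PU k l))"
  unfolding full_law_def by (rule finite_set_adjoin) (auto simp: finK)

lemma full_law_markov_Xt:
  "shc (full_law M PV PU k l) (\<lambda>p. h (fst p)) (\<lambda>p. (fst (snd p), Ob (snd p))) = shc (full_law M PV PU k l) (\<lambda>p. h (fst p)) (\<lambda>p. fst (snd p))"
  unfolding full_law_def by (rule shc_adjoin_markov) (auto simp: finK)

lemma full_law_markov_X:
  "shc (full_law M PV PU k l) (\<lambda>p. h (fst p, fst (snd p))) (\<lambda>p. (fst (snd (snd p)), Ob (snd (snd p))))
     = shc (full_law M PV PU k l) (\<lambda>p. h (fst p, fst (snd p))) (\<lambda>p. fst (snd (snd p)))"
  unfolding full_law_adjoin_source shc_map case_prod_unfold fst_conv snd_conv prod.collapse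
  by (rule shc_adjoin_markov) (auto simp: finK)

end

text \<open>For the chain \<open>V - T - C\<close> both sides equal \<open>I(T; V)\<close>, and
  \<open>C\<close> is gone from the right. The left side is therefore the same for
  \<open>Y\<^sub>k\<close> and for \<open>Z\<^sub>l\<close>, which lets a bound for one be exchanged
  for a bound for the other.\<close>

lemma common_information_identity:
  assumes "shc F V (\<lambda>p. (T p, C p)) = shc F V T"
  shows "(shc F T C - shc F T (\<lambda>p. (V p, C p))) + (sh F C - shc F C V) = sh F V + sh F T - sh F (\<lambda>p. (V p, T p))"
proof -
  have e: "sh F (\<lambda>p. (T p, V p, C p)) = sh F (\<lambda>p. (V p, T p, C p))" "sh F (\<lambda>p. (C p, V p)) = sh F (\<lambda>p. (V p, C p))"
    by (rule sh_kernel_eq; auto)+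
  show ?thesis using assms unfolding shc_def e by linarith
qed

text \<open>The same exchange given \<open>V\<close>: both sides are
  \<open>I(T; U | V)\<close>.\<close>

lemma common_conditional_information_identity:
  assumes "shc F V (\<lambda>p. (T p, C p)) = shc F V T" "shc F (\<lambda>p. (V p, U p)) (\<lambda>p. (T p, C p)) = shc F (\<lambda>p. (V p, U p)) T"
  shows "(shc F T (\<lambda>p. (V p, C p)) - shc F T (\<lambda>p. ((V p, U p), C p))) + (shc F C V - shc F C (\<lambda>p. (U p, V p)))
     = sh F (\<lambda>p. (V p, T p)) - sh F (\<lambda>p. ((V p, U p), T p)) - sh F V + sh F (\<lambda>p. (V p, U p))"
proof -
  have e: "sh F (\<lambda>p. (T p, V p, C p)) = sh F (\<lambda>p. (V p, T p, C p))" "sh F (\<lambda>p. (C p, V p)) = sh F (\<lambda>p. (V p, C p))"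
     "sh F (\<lambda>p. (T p, (V p, U p), C p)) = sh F (\<lambda>p. ((V p, U p), T p, C p))" "sh F (\<lambda>p. (C p, U p, V p)) = sh F (\<lambda>p. ((V p, U p), C p))"
     "sh F (\<lambda>p. (U p, V p)) = sh F (\<lambda>p. (V p, U p))"
    by (rule sh_kernel_eq; auto)+
  show ?thesis using assms unfolding shc_def e by linarith
qed

text \<open>By the Markov chains \<open>I(T; V | C) = H(V | C) - H(V | T)\<close>, so the more
  informative observation has the smaller value. \<open>G\<close> is more informative than
  \<open>Y\<close> because it is worth as much as \<open>(X, Y)\<close>. The sum type lets one
  hypothesis speak of two observations of different types.\<close>

lemma stronger_observation:
  assumes fin: "finite (set_pmf F)"
    and T: "\<And>C. C \<in> {(\<lambda>p. Inl (Y p)), (\<lambda>p. Inr (G p))} \<Longrightarrow> shc F V (\<lambda>p. (T p, C p :: 'y + 'g)) = shc F V T \<and> shc F W (\<lambda>p. (T p, C p)) = shc F W T"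
    and X: "shc F V G = shc F V (\<lambda>p. (X p, Y p))" "shc F W G = shc F W (\<lambda>p. (X p, Y p))"
    and VW: "\<And>p. V p = f (W p)"
  shows "shc F T G - shc F T (\<lambda>p. (V p, G p)) \<le> shc F T Y - shc F T (\<lambda>p. (V p, Y p))"
    and "shc F T (\<lambda>p. (V p, G p)) - shc F T (\<lambda>p. (W p, G p)) \<le> shc F T (\<lambda>p. (V p, Y p)) - shc F T (\<lambda>p. (W p, Y p))"
proof -
  have k: "shc F V (\<lambda>p. (T p, Inl (Y p) :: 'y + 'g)) = shc F V (\<lambda>p. (T p, Y p))" "shc F W (\<lambda>p. (T p, Inl (Y p) :: 'y + 'g)) = shc F W (\<lambda>p. (T p, Y p))"
    "shc F V (\<lambda>p. (T p, Inr (G p) :: 'y + 'g)) = shc F V (\<lambda>p. (T p, G p))" "shc F W (\<lambda>p. (T p, Inr (G p) :: 'y + 'g)) = shc F W (\<lambda>p. (T p, G p))"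
    by (rule shc_kernel_eq; simp)+
  have TT: "shc F V (\<lambda>p. (T p, Y p)) = shc F V T" "shc F W (\<lambda>p. (T p, Y p)) = shc F W T"
     "shc F V (\<lambda>p. (T p, G p)) = shc F V T" "shc F W (\<lambda>p. (T p, G p)) = shc F W T"
    using T[of "\<lambda>p. Inl (Y p)"] T[of "\<lambda>p. Inr (G p)"] unfolding k by auto
  have p: "sh F (\<lambda>p. (T p, V p, G p)) = sh F (\<lambda>p. (V p, T p, G p))" "sh F (\<lambda>p. (T p, V p, Y p)) = sh F (\<lambda>p. (V p, T p, Y p))"
    "sh F (\<lambda>p. (T p, W p, G p)) = sh F (\<lambda>p. (W p, T p, G p))" "sh F (\<lambda>p. (T p, W p, Y p)) = sh F (\<lambda>p. (W p, T p, Y p))"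
    by (rule sh_kernel_eq; auto)+
  have m1: "shc F V (\<lambda>p. (X p, Y p)) \<le> shc F V Y" by (rule shc_mono_det[OF fin]) auto
  show "shc F T G - shc F T (\<lambda>p. (V p, G p)) \<le> shc F T Y - shc F T (\<lambda>p. (V p, Y p))"
    using m1 X(1) TT(1,3) unfolding shc_def p by linarith
  have m2: "shc F W (\<lambda>p. (V p, X p, Y p)) \<le> shc F W (\<lambda>p. (V p, Y p))" by (rule shc_mono_det[OF fin]) auto
  have r: "sh F (\<lambda>p. (W p, V p, X p, Y p)) = sh F (\<lambda>p. (W p, X p, Y p))" "sh F (\<lambda>p. (W p, V p, Y p)) = sh F (\<lambda>p. (W p, Y p))"
    by (rule sh_kernel_eq; auto simp: VW)+
  show "shc F T (\<lambda>p. (V p, G p)) - shc F T (\<lambda>p. (W p, G p)) \<le> shc F T (\<lambda>p. (V p, Y p)) - shc F T (\<lambda>p. (W p, Y p))"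
    using m2 X TT unfolding shc_def p r by linarith
qed

text \<open>Three observations with a common type of values, so that block codes can treat them uniformly.\<close>

definition obs_Y :: "'xt \<times> 'x \<times> 'y \<times> 'z \<Rightarrow> 'x option \<times> 'y option \<times> 'z option" where
  "obs_Y = (\<lambda>(xt, x, y, z). (None, Some y, None))"

definition obs_Z :: "'xt \<times> 'x \<times> 'y \<times> 'z \<Rightarrow> 'x option \<times> 'y option \<times> 'z option" where
  "obs_Z = (\<lambda>(xt, x, y, z). (None, None, Some z))"

definition obs_XZ :: "'xt \<times> 'x \<times> 'y \<times> 'z \<Rightarrow> 'x option \<times> 'y option \<times> 'z option" where
  "obs_XZ = (\<lambda>(xt, x, y, z). (Some x, None, Some z))"

text \<open>\<open>I(Xt; V | O)\<close>, the rate of a hash of \<open>A\<^sup>N\<close> for a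
  decoder that observes \<open>O\<close>.\<close>

definition outer_information :: "((nat \<times> nat) \<times> 'xt \<times> 'w) pmf \<Rightarrow> ('xt \<times> 'w \<Rightarrow> 'o) \<Rightarrow> real" where
  "outer_information F Ob = shc F (\<lambda>p. fst (snd p)) (\<lambda>p. Ob (snd p)) - shc F (\<lambda>p. fst (snd p)) (\<lambda>p. (fst (fst p), Ob (snd p)))"

text \<open>\<open>I(Xt; V, U | O)\<close>; it exceeds \<open>outer_information\<close> by
  \<open>I(Xt; U | V, O)\<close>, the rate of a hash of \<open>B\<^sup>N\<close> once
  \<open>A\<^sup>N\<close> is known.\<close>

definition total_information :: "((nat \<times> nat) \<times> 'xt \<times> 'w) pmf \<Rightarrow> ('xt \<times> 'w \<Rightarrow> 'o) \<Rightarrow> real" where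
  "total_information F Ob = shc F (\<lambda>p. fst (snd p)) (\<lambda>p. Ob (snd p)) - shc F (\<lambda>p. fst (snd p)) (\<lambda>p. (fst p, Ob (snd p)))"

text \<open>This and \<open>max_inner_rate\<close> are the two summands of
  \<open>helper_rate\<close>, named because each sizes a hash of its own.\<close>

definition max_outer_rate :: "('x, 'xt, 'y, 'z, 'k::finite, 'l::finite) compound_model \<Rightarrow> (nat \<Rightarrow> nat pmf) \<Rightarrow> ('xt \<Rightarrow> nat pmf) \<Rightarrow> real" where
  "max_outer_rate M PV PU = (MAX k. I[aux_law M PV PU (P_Y M k)](rv_Xt ; rv_V | rv_O))"

definition max_inner_rate :: "('x, 'xt, 'y, 'z, 'k::finite, 'l::finite) compound_model \<Rightarrow> (nat \<Rightarrow> nat pmf) \<Rightarrow> ('xt \<Rightarrow> nat pmf) \<Rightarrow> real" where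
  "max_inner_rate M PV PU = (MAX k. I[aux_law M PV PU (P_Y M k)](rv_Xt ; rv_U | (\<lambda>\<omega>. (rv_V \<omega>, rv_O \<omega>))))"

section \<open>Rate inequalities in each state\<close>

context
  fixes M :: "('x::finite, 'xt::finite, 'y::finite, 'z::finite, 'k::finite, 'l::finite) compound_model"
    and PV :: "nat \<Rightarrow> nat pmf" and PU :: "'xt \<Rightarrow> nat pmf"
  assumes finK: "\<And>xt. finite (set_pmf (aux_kernel PV PU xt))" and src: "compound_source M"
begin

abbreviation "Fl \<equiv> full_law M PV PU"

lemma aux_informations:
  fixes Q :: "'x \<Rightarrow> 'o::finite pmf"
  assumes Q: "\<And>x. Q x = map_pmf c (P_YZ M k l x)"
  shows "I[aux_law M PV PU Q](rv_Xt ; rv_V | rv_O) =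
      shc (Fl k l) (\<lambda>p. fst (snd p)) (\<lambda>p. c (snd (snd (snd p)))) - shc (Fl k l) (\<lambda>p. fst (snd p)) (\<lambda>p. (fst (fst p), c (snd (snd (snd p)))))"
    and "I[aux_law M PV PU Q](rv_Xt ; rv_U | (\<lambda>\<omega>. (rv_V \<omega>, rv_O \<omega>))) =
      shc (Fl k l) (\<lambda>p. fst (snd p)) (\<lambda>p. (fst (fst p), c (snd (snd (snd p))))) - shc (Fl k l) (\<lambda>p. fst (snd p)) (\<lambda>p. (fst p, c (snd (snd (snd p)))))"
    and "I[aux_law M PV PU Q](rv_O ; rv_U | rv_V) =
      shc (Fl k l) (\<lambda>p. c (snd (snd (snd p)))) (\<lambda>p. fst (fst p)) - shc (Fl k l) (\<lambda>p. c (snd (snd (snd p)))) (\<lambda>p. (snd (fst p), fst (fst p)))"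
    and "I[aux_law M PV PU Q](rv_O ; rv_V) =
      sh (Fl k l) (\<lambda>p. c (snd (snd (snd p)))) - shc (Fl k l) (\<lambda>p. c (snd (snd (snd p)))) (\<lambda>p. fst (fst p))"
    and "I[aux_law M PV PU Q](rv_Xt ; rv_U | rv_X) =
      shc (Fl k l) (\<lambda>p. fst (snd p)) (\<lambda>p. fst (snd (snd p))) - shc (Fl k l) (\<lambda>p. fst (snd p)) (\<lambda>p. (snd (fst p), fst (snd (snd p))))"
proof -
  note eq = aux_law_eq_map_full_law[of Q c M k l PV PU, OF Q]
  have fin: "finite (set_pmf (aux_law M PV PU Q))"
    unfolding eq using finite_set_full_law[OF finK, of M k l] by simp
  note rv = rv_Xt_def rv_V_def rv_U_def rv_O_def rv_X_def
  show "I[aux_law M PV PU Q](rv_Xt ; rv_V | rv_O) =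
      shc (Fl k l) (\<lambda>p. fst (snd p)) (\<lambda>p. c (snd (snd (snd p)))) - shc (Fl k l) (\<lambda>p. fst (snd p)) (\<lambda>p. (fst (fst p), c (snd (snd (snd p)))))"
    unfolding cond_mut_inf_eq_shc[OF fin] unfolding eq shc_map rv by simp
  have "shc (Fl k l) (\<lambda>p. fst (snd p)) (\<lambda>p. (snd (fst p), fst (fst p), c (snd (snd (snd p))))) = shc (Fl k l) (\<lambda>p. fst (snd p)) (\<lambda>p. (fst p, c (snd (snd (snd p)))))"
    by (rule shc_kernel_eq) (auto simp: prod_eq_iff)
  then show "I[aux_law M PV PU Q](rv_Xt ; rv_U | (\<lambda>\<omega>. (rv_V \<omega>, rv_O \<omega>))) =
      shc (Fl k l) (\<lambda>p. fst (snd p)) (\<lambda>p. (fst (fst p), c (snd (snd (snd p))))) - shc (Fl k l) (\<lambda>p. fst (snd p)) (\<lambda>p. (fst p, c (snd (snd (snd p)))))"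
    unfolding cond_mut_inf_eq_shc[OF fin] unfolding eq shc_map rv by simp
  show "I[aux_law M PV PU Q](rv_O ; rv_U | rv_V) =
      shc (Fl k l) (\<lambda>p. c (snd (snd (snd p)))) (\<lambda>p. fst (fst p)) - shc (Fl k l) (\<lambda>p. c (snd (snd (snd p)))) (\<lambda>p. (snd (fst p), fst (fst p)))"
    unfolding cond_mut_inf_eq_shc[OF fin] unfolding eq shc_map rv by simp
  show "I[aux_law M PV PU Q](rv_O ; rv_V) =
      sh (Fl k l) (\<lambda>p. c (snd (snd (snd p)))) - shc (Fl k l) (\<lambda>p. c (snd (snd (snd p)))) (\<lambda>p. fst (fst p))"
    unfolding mut_inf_eq_sh[OF fin] unfolding eq shc_map sh_map rv by simp
  show "I[aux_law M PV PU Q](rv_Xt ; rv_U | rv_X) =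
      shc (Fl k l) (\<lambda>p. fst (snd p)) (\<lambda>p. fst (snd (snd p))) - shc (Fl k l) (\<lambda>p. fst (snd p)) (\<lambda>p. (snd (fst p), fst (snd (snd p))))"
    unfolding cond_mut_inf_eq_shc[OF fin] unfolding eq shc_map rv by simp
qed

lemma P_Y_eq: "P_Y M k x = map_pmf fst (P_YZ M k l x)" and P_Z_eq: "P_Z M l x = map_pmf snd (P_YZ M k l x)"
  using src by (auto simp: compound_source_def)

lemmas info_Y = aux_informations[OF P_Y_eq] and info_Z = aux_informations[OF P_Z_eq]

lemma shc_obs:
  "shc (Fl k l) A (\<lambda>p. obs_Y (snd p)) = shc (Fl k l) A (\<lambda>p. fst (snd (snd (snd p))))"
  "shc (Fl k l) A (\<lambda>p. (B p, obs_Y (snd p))) = shc (Fl k l) A (\<lambda>p. (B p, fst (snd (snd (snd p)))))"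
  "shc (Fl k l) A (\<lambda>p. obs_Z (snd p)) = shc (Fl k l) A (\<lambda>p. snd (snd (snd (snd p))))"
  "shc (Fl k l) A (\<lambda>p. (B p, obs_Z (snd p))) = shc (Fl k l) A (\<lambda>p. (B p, snd (snd (snd (snd p)))))"
  "shc (Fl k l) A (\<lambda>p. obs_XZ (snd p)) = shc (Fl k l) A (\<lambda>p. (fst (snd (snd p)), snd (snd (snd (snd p)))))"
  "shc (Fl k l) A (\<lambda>p. (B p, obs_XZ (snd p))) = shc (Fl k l) A (\<lambda>p. (B p, fst (snd (snd p)), snd (snd (snd (snd p)))))"
  by (rule shc_kernel_eq; auto simp: obs_Y_def obs_Z_def obs_XZ_def)+

lemma informations_obs:
  "outer_information (Fl k l) obs_Y = I[aux_law M PV PU (P_Y M k)](rv_Xt ; rv_V | rv_O)"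
  "outer_information (Fl k l) obs_Z = I[aux_law M PV PU (P_Z M l)](rv_Xt ; rv_V | rv_O)"
  "total_information (Fl k l) obs_Y - outer_information (Fl k l) obs_Y
     = I[aux_law M PV PU (P_Y M k)](rv_Xt ; rv_U | (\<lambda>\<omega>. (rv_V \<omega>, rv_O \<omega>)))"
  "total_information (Fl k l) obs_Z - outer_information (Fl k l) obs_Z
     = I[aux_law M PV PU (P_Z M l)](rv_Xt ; rv_U | (\<lambda>\<omega>. (rv_V \<omega>, rv_O \<omega>)))"
  unfolding info_Y(1,2)[of k l] info_Z(1,2)[of l k] outer_information_def total_information_def shc_obs by simp_all

text \<open>Given \<open>X\<close>, neither \<open>Y\<close> nor \<open>Z\<close> says more about
  the auxiliary letters, so \<open>(X, Z)\<close> is worth as much as \<open>(X, Y)\<close> and at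
  least as much as \<open>Y\<close>. Hashes long enough for the decoder are then long enough for the
  leakage bound.\<close>

lemma obs_XZ_le_obs_Y:
  "outer_information (Fl k l) obs_XZ \<le> outer_information (Fl k l) obs_Y"
  "total_information (Fl k l) obs_XZ - outer_information (Fl k l) obs_XZ
      \<le> total_information (Fl k l) obs_Y - outer_information (Fl k l) obs_Y"
proof -
  let ?F = "Fl k l"
  let ?X = "\<lambda>p :: (nat \<times> nat) \<times> 'xt \<times> 'x \<times> 'y \<times> 'z. fst (snd (snd p))"
  let ?Y = "\<lambda>p :: (nat \<times> nat) \<times> 'xt \<times> 'x \<times> 'y \<times> 'z. fst (snd (snd (snd p)))"
  let ?Z = "\<lambda>p :: (nat \<times> nat) \<times> 'xt \<times> 'x \<times> 'y \<times> 'z. snd (snd (snd (snd p)))"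
  let ?T = "\<lambda>p :: (nat \<times> nat) \<times> 'xt \<times> 'x \<times> 'y \<times> 'z. fst (snd p)"
  have mk: "shc ?F (\<lambda>p. h (fst p)) (\<lambda>p. (?X p, ?Z p)) = shc ?F (\<lambda>p. h (fst p)) (\<lambda>p. (?X p, ?Y p))" for h :: "nat \<times> nat \<Rightarrow> 'q"
    using full_law_markov_X[OF finK, of M k l "\<lambda>q. h (fst q)" "\<lambda>q. snd (snd q)"]
      full_law_markov_X[OF finK, of M k l "\<lambda>q. h (fst q)" "\<lambda>q. fst (snd q)"] by simp
  have mT: "shc ?F (\<lambda>p. h (fst p)) (\<lambda>p. (?T p, C p)) = shc ?F (\<lambda>p. h (fst p)) ?T"
    if "C \<in> {\<lambda>p. Inl (?Y p), \<lambda>p. Inr (?X p, ?Z p)}" for h :: "nat \<times> nat \<Rightarrow> 'q" and C :: "_ \<Rightarrow> 'y + 'x \<times> 'z"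
    using that full_law_markov_Xt[OF finK, of M k l h "\<lambda>q. Inl (fst (snd (snd q)))"]
      full_law_markov_Xt[OF finK, of M k l h "\<lambda>q. Inr (fst (snd q), snd (snd (snd q)))"] by auto
  note st = stronger_observation[OF finite_set_full_law[OF finK, of M k l], where Y = ?Y and G = "\<lambda>p. (?X p, ?Z p)"
      and V = "\<lambda>p. fst (fst p)" and T = ?T and W = "\<lambda>p. fst p" and X = ?X and f = fst]
  have 1: "shc ?F (\<lambda>p. fst (fst p)) (\<lambda>p. (?T p, C p)) = shc ?F (\<lambda>p. fst (fst p)) ?T \<and> shc ?F fst (\<lambda>p. (?T p, C p)) = shc ?F fst ?T"
    if "C \<in> {\<lambda>p. Inl (?Y p), \<lambda>p. Inr (?X p, ?Z p)}" for C :: "_ \<Rightarrow> 'y + 'x \<times> 'z"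
    using mT[OF that, of fst] mT[OF that, of "\<lambda>w. w"] by simp
  note st' = st[OF 1 mk[of fst] mk[of "\<lambda>w. w"] refl]
  show "outer_information ?F obs_XZ \<le> outer_information ?F obs_Y"
    using st'(1) unfolding outer_information_def shc_obs by simp
  show "total_information ?F obs_XZ - outer_information ?F obs_XZ \<le> total_information ?F obs_Y - outer_information ?F obs_Y"
    using st'(2) unfolding outer_information_def total_information_def shc_obs by simp
qed

lemma rate_Y:
  "outer_information (Fl k l) obs_Y \<le> max_outer_rate M PV PU"
  "total_information (Fl k l) obs_Y - outer_information (Fl k l) obs_Y \<le> max_inner_rate M PV PU"
proof -
  show "outer_information (Fl k l) obs_Y \<le> max_outer_rate M PV PU"
    unfolding informations_obs(1) max_outer_rate_def by (rule Max_ge) auto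
  show "total_information (Fl k l) obs_Y - outer_information (Fl k l) obs_Y \<le> max_inner_rate M PV PU"
    unfolding informations_obs(3) max_inner_rate_def by (rule Max_ge) auto
qed

lemma rate_XZ:
  "outer_information (Fl k l) obs_XZ \<le> max_outer_rate M PV PU"
  "total_information (Fl k l) obs_XZ - outer_information (Fl k l) obs_XZ \<le> max_inner_rate M PV PU"
  using obs_XZ_le_obs_Y[of k l] rate_Y[of k l] by linarith+

text \<open>At the state \<open>k0\<close> with the largest inner rate, the exchange identity gives
  \<open>I(Xt; U | V, Z) = I(Xt; U | V, Y) + I(Y; U | V) - I(Z; U | V)\<close>; the minimum and the
  maximum in \<open>key_rate\<close> only lower the right side.\<close>

lemma rate_Z:
  "max_inner_rate M PV PU + key_rate M PV PU \<le> total_information (Fl k l) obs_Z - outer_information (Fl k l) obs_Z"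
proof -
  let ?f = "\<lambda>k. I[aux_law M PV PU (P_Y M k)](rv_Xt ; rv_U | (\<lambda>\<omega>. (rv_V \<omega>, rv_O \<omega>)))"
  have "max_inner_rate M PV PU \<in> range ?f" unfolding max_inner_rate_def by (rule Max_in) auto
  then obtain k0 where k0: "max_inner_rate M PV PU = ?f k0" by (rule rangeE)
  have "(MIN k. I[aux_law M PV PU (P_Y M k)](rv_O ; rv_U | rv_V)) \<le> I[aux_law M PV PU (P_Y M k0)](rv_O ; rv_U | rv_V)"
    by (rule Min_le) auto
  moreover have "I[aux_law M PV PU (P_Z M l)](rv_O ; rv_U | rv_V) \<le> (MAX l. I[aux_law M PV PU (P_Z M l)](rv_O ; rv_U | rv_V))"
    by (rule Max_ge) auto
  moreover have "?f k0 + I[aux_law M PV PU (P_Y M k0)](rv_O ; rv_U | rv_V)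
     = I[aux_law M PV PU (P_Z M l)](rv_Xt ; rv_U | (\<lambda>\<omega>. (rv_V \<omega>, rv_O \<omega>))) + I[aux_law M PV PU (P_Z M l)](rv_O ; rv_U | rv_V)"
  proof -
    let ?F = "Fl k0 l"
    have id: "(shc ?F (\<lambda>p. fst (snd p)) (\<lambda>p. (fst (fst p), C (snd p))) - shc ?F (\<lambda>p. fst (snd p)) (\<lambda>p. (fst p, C (snd p)))) + (shc ?F (\<lambda>p. C (snd p)) (\<lambda>p. fst (fst p)) - shc ?F (\<lambda>p. C (snd p)) (\<lambda>p. (snd (fst p), fst (fst p))))
     = sh ?F (\<lambda>p. (fst (fst p), fst (snd p))) - sh ?F (\<lambda>p. (fst p, fst (snd p))) - sh ?F (\<lambda>p. fst (fst p)) + sh ?F fst" for C :: "'xt \<times> 'x \<times> 'y \<times> 'z \<Rightarrow> 'q"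
      using common_conditional_information_identity[of ?F "\<lambda>p. fst (fst p)" "\<lambda>p. fst (snd p)" "\<lambda>p. C (snd p)" "\<lambda>p. snd (fst p)"]
        full_law_markov_Xt[OF finK, of M k0 l fst C] full_law_markov_Xt[OF finK, of M k0 l "\<lambda>w. w" C] by simp
    show ?thesis
      unfolding info_Y(2,3)[of k0 l] info_Z(2,3)[of l k0]
      using id[of "\<lambda>q. fst (snd (snd q))"] id[of "\<lambda>q. snd (snd (snd q))"] by simp
  qed
  ultimately show ?thesis unfolding informations_obs(4) k0 key_rate_def by linarith
qed

text \<open>Here \<open>k0\<close> attains the minimum of \<open>I(Y\<^sub>k; V)\<close>, and the
  exchange identity replaces \<open>I(Xt; V | Y) + I(Y; V)\<close> by the same sum for
  \<open>Z\<close>. The subtracted \<open>I(Xt; U | X)\<close> is at most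
  \<open>I(Xt; V, U | X, Z)\<close> by the Markov chain.\<close>

lemma rate_leakage:
  "max_inner_rate M PV PU + outer_information (Fl k l) obs_Z - total_information (Fl k l) obs_XZ \<le> leakage_rate M PV PU"
proof -
  let ?g = "\<lambda>k. I[aux_law M PV PU (P_Y M k)](rv_O ; rv_V)"
  have "(MIN k. ?g k) \<in> range ?g" by (rule Min_in) auto
  then obtain k0 where k0: "(MIN k. ?g k) = ?g k0" by (rule rangeE)
  have "I[aux_law M PV PU (P_Y M k0)](rv_Xt ; rv_V | rv_O) \<le> max_outer_rate M PV PU"
    unfolding max_outer_rate_def by (rule Max_ge) auto
  moreover have "(MIN l. I[aux_law M PV PU (P_Z M l)](rv_O ; rv_V)) \<le> I[aux_law M PV PU (P_Z M l)](rv_O ; rv_V)"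
    by (rule Min_le) auto
  moreover have "I[aux_law M PV PU (P_Y M k0)](rv_Xt ; rv_V | rv_O) + ?g k0
     = I[aux_law M PV PU (P_Z M l)](rv_Xt ; rv_V | rv_O) + I[aux_law M PV PU (P_Z M l)](rv_O ; rv_V)"
  proof -
    let ?F = "Fl k0 l"
    have id: "(shc ?F (\<lambda>p. fst (snd p)) (\<lambda>p. C (snd p)) - shc ?F (\<lambda>p. fst (snd p)) (\<lambda>p. (fst (fst p), C (snd p)))) + (sh ?F (\<lambda>p. C (snd p)) - shc ?F (\<lambda>p. C (snd p)) (\<lambda>p. fst (fst p)))
     = sh ?F (\<lambda>p. fst (fst p)) + sh ?F (\<lambda>p. fst (snd p)) - sh ?F (\<lambda>p. (fst (fst p), fst (snd p)))" for C :: "'xt \<times> 'x \<times> 'y \<times> 'z \<Rightarrow> 'q"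
      using common_information_identity[of ?F "\<lambda>p. fst (fst p)" "\<lambda>p. fst (snd p)" "\<lambda>p. C (snd p)"]
        full_law_markov_Xt[OF finK, of M k0 l fst C] by simp
    show ?thesis
      unfolding info_Y(1,4)[of k0 l] info_Z(1,4)[of l k0]
      using id[of "\<lambda>q. fst (snd (snd q))"] id[of "\<lambda>q. snd (snd (snd q))"] by simp
  qed
  moreover have "I[aux_law M PV PU (\<lambda>x. return_pmf ())](rv_Xt ; rv_U | rv_X) \<le> total_information (Fl k l) obs_XZ"
  proof -
    let ?F = "Fl k l"
    have "return_pmf () = map_pmf (\<lambda>_. ()) (P_YZ M k l x)" for x by (simp add: map_pmf_const)
    note u = aux_informations(5)[of "\<lambda>x. return_pmf ()" "\<lambda>_. ()" k l, OF this]
    have "shc ?F (\<lambda>p. fst (snd p)) (\<lambda>p. (fst (snd (snd p)), snd (snd (snd (snd p))))) = shc ?F (\<lambda>p. fst (snd p)) (\<lambda>p. fst (snd (snd p)))"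
      using full_law_markov_X[OF finK, of M k l snd "\<lambda>q. snd (snd q)"] by simp
    moreover have "shc ?F (\<lambda>p. fst (snd p)) (\<lambda>p. (fst p, fst (snd (snd p)), snd (snd (snd (snd p))))) \<le> shc ?F (\<lambda>p. fst (snd p)) (\<lambda>p. (snd (fst p), fst (snd (snd p))))"
      by (rule shc_mono_det[OF finite_set_full_law[OF finK]]) auto
    ultimately show ?thesis unfolding u total_information_def shc_obs by simp
  qed
  ultimately show ?thesis
    unfolding informations_obs leakage_rate_def helper_rate_def k0
      max_outer_rate_def[symmetric] max_inner_rate_def[symmetric] by linarith
qed

lemma helper_rate_eq: "helper_rate M PV PU = max_inner_rate M PV PU + max_outer_rate M PV PU"
  unfolding helper_rate_def max_inner_rate_def max_outer_rate_def ..

end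

section \<open>Codes of arbitrary length\<close>

text \<open>Letters beyond the first \<open>N * m\<close> are ignored by the code but seen by the
  eavesdropper, whence \<open>shc_tail\<close>.\<close>

definition blocks :: "nat \<Rightarrow> nat \<Rightarrow> 'a list \<Rightarrow> 'a list list" where
  "blocks N m ws = map (\<lambda>j. take m (drop (j * m) ws)) [0..<N]"

lemma blocks_map: "blocks N m (map f ws) = map (map f) (blocks N m ws)"
  by (simp add: blocks_def take_map drop_map)

lemma blocks_0: "blocks 0 m ws = []"
  by (simp add: blocks_def)

lemma blocks_Suc: "blocks (Suc N) m ws = take m ws # blocks N m (drop m ws)"
  by (simp add: blocks_def upt_conv_Cons map_Suc_upt[symmetric] add.commute del: upt_Suc)

lemma blocks_concat:
  "length ss = N \<Longrightarrow> \<forall>s\<in>set ss. length s = m \<Longrightarrow> blocks N m (concat ss @ rs) = ss"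
proof (induction ss arbitrary: N)
  case (Cons s ss)
  then show ?case by (cases N) (auto simp: blocks_Suc)
qed (simp add: blocks_0)

lemma concat_blocks: "N * m \<le> length ws \<Longrightarrow> concat (blocks N m ws) = take (N * m) ws"
proof (induction N arbitrary: ws)
  case (Suc N)
  then show ?case by (simp add: blocks_Suc take_add)
qed (simp add: blocks_0)

lemma map_blocks_replicate_pmf:
  assumes "N * m \<le> n"
  shows "map_pmf (blocks N m) (replicate_pmf n p) = replicate_pmf N (replicate_pmf m p)"
proof -
  have n: "n = N * m + (n - N * m)" using assms by simp
  have "map_pmf (blocks N m) (replicate_pmf n p) =
    replicate_pmf N (replicate_pmf m p) \<bind> (\<lambda>ss. replicate_pmf (n - N * m) p \<bind> (\<lambda>rs. return_pmf (blocks N m (concat ss @ rs))))"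
    by (subst n, subst replicate_pmf_distrib, subst concat_replicate_pmf[symmetric]) (simp add: map_bind_pmf bind_map_pmf)
  also have "\<dots> = replicate_pmf N (replicate_pmf m p) \<bind> return_pmf"
  proof (rule bind_pmf_cong[OF refl])
    fix ss assume "ss \<in> set_pmf (replicate_pmf N (replicate_pmf m p))"
    then have "length ss = N" "\<forall>s\<in>set ss. length s = m" by (auto simp: set_replicate_pmf)
    then show "replicate_pmf (n - N * m) p \<bind> (\<lambda>rs. return_pmf (blocks N m (concat ss @ rs))) = return_pmf ss"
      by (simp add: blocks_concat)
  qed
  finally show ?thesis by (simp add: bind_return_pmf')
qed

text \<open>\<open>C\<close> amounts to \<open>D\<close> together with a tail \<open>E\<close>, and
  a tail changes a conditional entropy by no more than its own entropy.\<close>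

lemma shc_tail:
  assumes fin: "finite (set_pmf p)" and DC: "det_by p D C" and CED: "det_by p C (\<lambda>\<omega>. (E \<omega>, D \<omega>))"
    and T: "finite T" "E ` set_pmf p \<subseteq> T"
  shows "shc p A C \<le> shc p A D" "shc p A D - log 2 (card T) \<le> shc p A C"
proof -
  show "shc p A C \<le> shc p A D" by (rule shc_mono_cond[OF fin DC])
  have "sh p C \<le> sh p (\<lambda>\<omega>. (E \<omega>, D \<omega>))" by (rule sh_mono[OF fin CED])
  also have "\<dots> \<le> sh p D + log 2 (card T)" by (rule sh_pair_le[OF fin T])
  finally have "sh p C \<le> sh p D + log 2 (card T)" .
  moreover have "sh p (\<lambda>\<omega>. (A \<omega>, D \<omega>)) \<le> sh p (\<lambda>\<omega>. (A \<omega>, C \<omega>))"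
    by (rule sh_mono[OF fin]) (use DC in \<open>unfold det_by_def prod.inject, blast\<close>)
  ultimately show "shc p A D - log 2 (card T) \<le> shc p A C" unfolding shc_def by linarith
qed

lemma log_card_lists_le:
  assumes "r \<le> m"
  shows "log 2 (card {fs :: 'f::finite list. set fs \<subseteq> UNIV \<and> length fs = r}) \<le> real m * log 2 (real CARD('f))"
proof -
  have "log 2 (card {fs :: 'f list. set fs \<subseteq> UNIV \<and> length fs = r}) = real r * log 2 (real CARD('f))"
    by (simp only: card_lists_length_eq[OF finite_class.finite_UNIV]) (simp add: log_nat_power)
  also have "\<dots> \<le> real m * log 2 (real CARD('f))"
    by (rule mult_right_mono) (use assms in \<open>auto simp: Suc_le_eq\<close>)
  finally show ?thesis .
qed

text \<open>At most \<open>m\<close> letters are left over, so \<open>c\<close> need not grow with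
  \<open>N\<close>. The functions \<open>az\<close>, \<open>bz\<close>, \<open>ag\<close>,
  \<open>bg\<close> recode between the true letters and the observations \<open>oz\<close>,
  \<open>og\<close> used by the block code.\<close>

lemma code_ok_blocks:
  fixes zz :: "'w \<Rightarrow> 'z::finite" and gg :: "'w \<Rightarrow> 'g::finite"
  assumes fin: "finite (set_pmf p)" and nm: "N * m \<le> n" "n \<le> N * m + m"
    and ok: "code_ok er KS s l (replicate_pmf N (replicate_pmf m p)) S S' J (map (map oz)) (map (map og))"
    and oz: "\<And>\<omega>. oz \<omega> = az (zz \<omega>)" "\<And>\<omega>. zz \<omega> = bz (oz \<omega>)"
    and og: "\<And>\<omega>. og \<omega> = ag (gg \<omega>)" "\<And>\<omega>. gg \<omega> = bg (og \<omega>)"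
    and c: "real m * log 2 (real CARD('z)) \<le> c" "real m * log 2 (real CARD('g)) \<le> c"
  shows "code_ok er KS (s + c) (l + c) (replicate_pmf n p) (\<lambda>ws. S (blocks N m ws)) (\<lambda>ws. S' (blocks N m ws))
     (\<lambda>ws. J (blocks N m ws)) (map zz) (map gg)"
proof -
  let ?R = "replicate_pmf n p" and ?b = "blocks N m"
  have finR: "finite (set_pmf ?R)" by (simp add: fin finite_set_replicate_pmf)
  have R': "replicate_pmf N (replicate_pmf m p) = map_pmf ?b ?R" by (rule map_blocks_replicate_pmf[OF nm(1), symmetric])
  have dets: "det_by ?R (\<lambda>ws. map (map o') (?b ws)) (map f)"
      "det_by ?R (map f) (\<lambda>ws. (map f (drop (N * m) ws), map (map o') (?b ws)))"
    if "\<And>\<omega>. o' \<omega> = a (f \<omega>)" "\<And>\<omega>. f \<omega> = b (o' \<omega>)" for o' :: "'w \<Rightarrow> 'o2" and f :: "'w \<Rightarrow> 'f" and a b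
  proof -
    have o': "map o' ws = map a (map f ws)" for ws by (simp add: that(1))
    have bl: "map (map o') (?b ws) = ?b (map a (map f ws))" for ws unfolding blocks_map[of N m o' ws, symmetric] o' ..
    show "det_by ?R (\<lambda>ws. map (map o') (?b ws)) (map f)"
      unfolding det_by_def bl by simp
    have fb: "map f ws = map b (map o' ws)" for ws using that(2) by simp
    have rec: "map f ws = map b (concat (map (map o') (?b ws))) @ map f (drop (N * m) ws)" if "ws \<in> set_pmf ?R" for ws
    proof -
      have l: "N * m \<le> length ws" using that nm by (simp add: set_replicate_pmf)
      have "concat (map (map o') (?b ws)) = take (N * m) (map o' ws)"
        using concat_blocks[of N m "map o' ws"] l by (simp add: blocks_map)
      then have "map b (concat (map (map o') (?b ws))) = take (N * m) (map f ws)" by (simp add: take_map fb del: map_map)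
      then show ?thesis by (metis append_take_drop_id drop_map)
    qed
    show "det_by ?R (map f) (\<lambda>ws. (map f (drop (N * m) ws), map (map o') (?b ws)))"
      unfolding det_by_def
    proof (intro ballI impI)
      fix ws ws' assume w: "ws \<in> set_pmf ?R" "ws' \<in> set_pmf ?R"
        and "(map f (drop (N * m) ws), map (map o') (?b ws)) = (map f (drop (N * m) ws'), map (map o') (?b ws'))"
      then have e: "map f (drop (N * m) ws) = map f (drop (N * m) ws')" "map (map o') (?b ws) = map (map o') (?b ws')" by auto
      show "map f ws = map f ws'" unfolding rec[OF w(1)] rec[OF w(2)] e ..
    qed
  qed
  have tail: "(\<lambda>ws. map f (drop (N * m) ws)) ` set_pmf ?R \<subseteq> {fs. set fs \<subseteq> UNIV \<and> length fs = n - N * m}" for f :: "'w \<Rightarrow> 'f"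
    by (auto simp: set_replicate_pmf)
  have rm: "n - N * m \<le> m" using nm by simp
  have tz: "finite {fs :: 'z list. set fs \<subseteq> UNIV \<and> length fs = n - N * m}" and tg: "finite {fs :: 'g list. set fs \<subseteq> UNIV \<and> length fs = n - N * m}"
    by (rule finite_lists_length_eq, simp)+
  note dz = dets[of oz az zz bz, OF oz] and dg = dets[of og ag gg bg, OF og]
  have dz': "det_by ?R (\<lambda>ws. (J (?b ws), map (map oz) (?b ws))) (\<lambda>ws. (J (?b ws), map zz ws))"
      "det_by ?R (\<lambda>ws. (J (?b ws), map zz ws)) (\<lambda>ws. (map zz (drop (N * m) ws), (J (?b ws), map (map oz) (?b ws))))"
    using dz unfolding det_by_def prod.inject by blast+
  have 1: "measure_pmf.prob ?R {ws. S' (?b ws) \<noteq> S (?b ws)} \<le> er"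
    using ok unfolding code_ok_def R' by (simp add: vimage_def)
  have 2: "log 2 (real KS) - (s + c) \<le> shc ?R (\<lambda>ws. S (?b ws)) (\<lambda>ws. (J (?b ws), map zz ws))"
  proof -
    have "log 2 (real KS) - s \<le> shc ?R (\<lambda>ws. S (?b ws)) (\<lambda>ws. (J (?b ws), map (map oz) (?b ws)))"
      using ok unfolding code_ok_def R' shc_map by simp
    then show ?thesis
      using shc_tail(2)[OF finR dz' tz tail[of zz], of "\<lambda>ws. S (?b ws)"] log_card_lists_le[OF rm, where 'f = 'z] c(1) by simp
  qed
  have 3: "shc ?R (\<lambda>ws. J (?b ws)) (map zz) - shc ?R (\<lambda>ws. J (?b ws)) (map gg) \<le> l + c"
  proof -
    have "shc ?R (\<lambda>ws. J (?b ws)) (\<lambda>ws. map (map oz) (?b ws)) - shc ?R (\<lambda>ws. J (?b ws)) (\<lambda>ws. map (map og) (?b ws)) \<le> l"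
      using ok unfolding code_ok_def R' shc_map by simp
    then show ?thesis
      using shc_tail(1)[OF finR dz tz tail[of zz], of "\<lambda>ws. J (?b ws)"]
        shc_tail(2)[OF finR dg tg tail[of gg], of "\<lambda>ws. J (?b ws)"] log_card_lists_le[OF rm, where 'f = 'g] c(2) by simp
  qed
  show ?thesis unfolding code_ok_def using 1 2 3 by blast
qed

lemma card_idx_set: "card (idx_set n R) = nat \<lceil>2 powr (real n * R)\<rceil>"
  by (simp add: idx_set_def)

lemma card_idx_set_bounds:
  assumes "R \<ge> 0"
  shows "card (idx_set n R) > 0" "real n * R \<le> log 2 (card (idx_set n R))" "log 2 (card (idx_set n R)) \<le> real n * R + 1"
    "2 powr (real n * R) \<le> real (card (idx_set n R))"
proof -
  have p: "2 powr (real n * R) > 0" by simp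
  note b = log_nat_ceiling_le[OF p]
  show pos: "card (idx_set n R) > 0" unfolding card_idx_set by (rule b(2))
  show ge: "2 powr (real n * R) \<le> real (card (idx_set n R))" unfolding card_idx_set by (rule b(3))
  have "log 2 (2 powr (real n * R)) \<le> log 2 (card (idx_set n R))" using ge pos by (subst log_le_cancel_iff) auto
  then show "real n * R \<le> log 2 (card (idx_set n R))" by simp
  show "log 2 (card (idx_set n R)) \<le> real n * R + 1" using b(1) assms unfolding card_idx_set by (simp add: max_def mult_nonneg_nonneg)
qed

lemma map_fst_letter_law: "map_pmf fst (letter_law M k l) = P_X M \<bind> P_Xt M"
  unfolding letter_law_eq by (simp add: map_bind_pmf pmf.map_comp o_def map_pmf_const bind_return_pmf')

lemma code_ok_cong:
  assumes "code_ok er KS s l R S S' J Z G" and "\<And>\<omega>. \<omega> \<in> set_pmf R \<Longrightarrow> S' \<omega> = S'' \<omega>"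
    and "\<And>\<omega> \<omega>'. J \<omega> = J \<omega>' \<longleftrightarrow> J' \<omega> = J' \<omega>'" and "s \<le> s'" "l \<le> l'"
  shows "code_ok er KS s' l' R S S'' J' Z G"
proof -
  have k: "shc R S (\<lambda>\<omega>. (J \<omega>, Z \<omega>)) = shc R S (\<lambda>\<omega>. (J' \<omega>, Z \<omega>))"
    by (rule shc_kernel_eq) (simp add: assms(3))
  have "sh R (\<lambda>\<omega>. (J \<omega>, Z \<omega>)) = sh R (\<lambda>\<omega>. (J' \<omega>, Z \<omega>))" "sh R (\<lambda>\<omega>. (J \<omega>, G \<omega>)) = sh R (\<lambda>\<omega>. (J' \<omega>, G \<omega>))"
    by (rule sh_kernel_eq; simp add: assms(3))+
  then have "shc R J Z - shc R J G = shc R J' Z - shc R J' G" unfolding shc_def by simp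
  moreover have "measure_pmf.prob R {\<omega>. S'' \<omega> \<noteq> S \<omega>} \<le> measure_pmf.prob R {\<omega>. S' \<omega> \<noteq> S \<omega>}"
    by (rule prob_mono_supp) (simp add: assms(2))
  ultimately show ?thesis using assms(1,4,5) unfolding code_ok_def k by linarith
qed

text \<open>Order of limits: the precision \<open>e\<close> fixes the block length \<open>m\<close>
  and the block code, and then only \<open>N\<close> grows. A length that is no multiple of
  \<open>m\<close> leaves a tail whose cost is bounded for fixed \<open>m\<close>.\<close>

theorem compound_code:
  fixes M :: "('x::finite, 'xt::finite, 'y::finite, 'z::finite, 'k::finite, 'l::finite) compound_model"
  assumes finK: "\<And>xt. finite (set_pmf (aux_kernel PV PU xt))" and src: "compound_source M"
    and RS: "0 \<le> R_S" "R_S \<le> key_rate M PV PU" and RL: "0 \<le> R_L" "leakage_rate M PV PU \<le> R_L"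
    and \<delta>: "\<delta> > 0" and \<eta>: "\<eta> > 0"
  shows "\<forall>\<^sub>F n in sequentially. \<exists>KJ eJ eS dec. real KJ \<le> 2 powr (real n * (helper_rate M PV PU + \<eta>)) \<and>
     (\<forall>xt. eJ xt < KJ) \<and> (\<forall>xt. eS xt < card (idx_set n R_S)) \<and> (\<forall>j y. dec j y < card (idx_set n R_S)) \<and>
     (\<forall>k l. code_ok \<delta> (card (idx_set n R_S)) (real n * \<delta>) (real n * (R_L + \<delta>)) (replicate_pmf n (letter_law M k l))
        (\<lambda>ws. eS (map (\<lambda>(xt, x, y, z). xt) ws)) (\<lambda>ws. dec (eJ (map (\<lambda>(xt, x, y, z). xt) ws)) (map (\<lambda>(xt, x, y, z). y) ws))
        (\<lambda>ws. eJ (map (\<lambda>(xt, x, y, z). xt) ws) :: nat) (map (\<lambda>(xt, x, y, z). z)) (map (\<lambda>(xt, x, y, z). (x, z))))"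
proof -
  \<comment> \<open>The losses per letter are at most \<open>37 * e\<close> for the key,
    \<open>41 * e\<close> for the leakage and \<open>27 * e\<close> for the helper data.\<close>
  define e where "e = min \<delta> \<eta> / 100"
  have e: "e > 0" "100 * e \<le> \<delta>" "100 * e \<le> \<eta>" unfolding e_def using \<delta> \<eta> by auto
  define L where "L = letter_law M"
  define K where "K = aux_kernel PV PU"
  have finL: "finite (set_pmf (L k l))" for k l by simp
  define \<O> :: "(('xt \<times> 'x \<times> 'y \<times> 'z) pmf \<times> ('xt \<times> 'x \<times> 'y \<times> 'z \<Rightarrow> 'x option \<times> 'y option \<times> 'z option)) set"
    where "\<O> = (\<Union>k. \<Union>l. {(L k l, obs_Y), (L k l, obs_Z), (L k l, obs_XZ)})"
  define good where "good = (\<lambda>m (B :: 'xt list \<Rightarrow> (nat \<times> nat) option) (La :: ('xt \<times> 'x \<times> 'y \<times> 'z) pmf) (Ob :: 'xt \<times> 'x \<times> 'y \<times> 'z \<Rightarrow> 'x option \<times> 'y option \<times> 'z option).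
        \<bar>shc (replicate_pmf m La) (\<lambda>ws. map_option fst (B (map fst ws))) (map Ob)
          - real m * (shc La fst Ob - shc (adjoin La fst K) (\<lambda>p. fst (snd p)) (\<lambda>p. (fst (fst p), Ob (snd p))))\<bar> \<le> real m * e \<and>
        \<bar>shc (replicate_pmf m La) (\<lambda>ws. B (map fst ws)) (map Ob)
          - real m * (shc La fst Ob - shc (adjoin La fst K) (\<lambda>p. fst (snd p)) (\<lambda>p. (fst p, Ob (snd p))))\<bar> \<le> real m * e)"
  have ev: "\<forall>\<^sub>F m in sequentially. \<exists>B. finite (range B) \<and> (\<forall>(La, Ob) \<in> \<O>. good m B La Ob)"
    unfolding good_def
  proof (rule block_index[where PX = "P_X M \<bind> P_Xt M"])
    show "finite \<O>" unfolding \<O>_def by auto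
    show "\<And>La Ob. (La, Ob) \<in> \<O> \<Longrightarrow> finite (set_pmf La) \<and> map_pmf fst La = P_X M \<bind> P_Xt M"
      unfolding \<O>_def by (auto simp: L_def map_fst_letter_law)
  qed (use finK e in \<open>auto simp: K_def\<close>)
  obtain m where m: "m > 0" and "\<exists>B. finite (range B) \<and> (\<forall>(La, Ob) \<in> \<O>. good m B La Ob)"
    using eventually_happens'[OF sequentially_bot eventually_conj[OF ev eventually_gt_at_top[of 0]]] by blast
  then obtain B where B: "\<And>La Ob. (La, Ob) \<in> \<O> \<Longrightarrow> good m B La Ob" by blast
  define q where "q = (\<lambda>(k, l). replicate_pmf m (L k l))"
  have finq: "finite (set_pmf (q i))" for i unfolding q_def by (auto split: prod.split intro!: finite_set_replicate_pmf finL)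
  define Bs where "Bs = (\<lambda>s :: ('xt \<times> 'x \<times> 'y \<times> 'z) list. B (map fst s))"
  define As where "As = (\<lambda>s :: ('xt \<times> 'x \<times> 'y \<times> 'z) list. map_option fst (B (map fst s)))"
  have bound: "shc (q (k, l)) As (map Ob) \<le> real m * (outer_information (full_law M PV PU k l) Ob + e)"
      "real m * (outer_information (full_law M PV PU k l) Ob - e) \<le> shc (q (k, l)) As (map Ob)"
      "shc (q (k, l)) Bs (map Ob) \<le> real m * (total_information (full_law M PV PU k l) Ob + e)"
      "real m * (total_information (full_law M PV PU k l) Ob - e) \<le> shc (q (k, l)) Bs (map Ob)"
    if Ob: "Ob \<in> {obs_Y, obs_Z, obs_XZ}" for k l Ob
  proof -
    have "(L k l, Ob) \<in> \<O>" using Ob unfolding \<O>_def by auto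
    note b = B[OF this, unfolded good_def]
    have s: "shc (L k l) fst Ob = shc (full_law M PV PU k l) (\<lambda>p. fst (snd p)) (\<lambda>p. Ob (snd p))"
      unfolding full_law_def L_def by (rule shc_adjoin_snd[symmetric])
    have f: "adjoin (L k l) fst K = full_law M PV PU k l" unfolding full_law_def L_def K_def ..
    have "\<bar>shc (q (k, l)) As (map Ob) - real m * outer_information (full_law M PV PU k l) Ob\<bar> \<le> real m * e"
      using conjunct1[OF b] unfolding s f outer_information_def q_def As_def by simp
    moreover have "\<bar>shc (q (k, l)) Bs (map Ob) - real m * total_information (full_law M PV PU k l) Ob\<bar> \<le> real m * e"
      using conjunct2[OF b] unfolding s f total_information_def q_def Bs_def by simp
    ultimately show "shc (q (k, l)) As (map Ob) \<le> real m * (outer_information (full_law M PV PU k l) Ob + e)"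
      "real m * (outer_information (full_law M PV PU k l) Ob - e) \<le> shc (q (k, l)) As (map Ob)"
      "shc (q (k, l)) Bs (map Ob) \<le> real m * (total_information (full_law M PV PU k l) Ob + e)"
      "real m * (total_information (full_law M PV PU k l) Ob - e) \<le> shc (q (k, l)) Bs (map Ob)"
      by (auto simp: abs_le_iff algebra_simps)
  qed
  have BA: "shc (q i) Bs (\<lambda>s. (As s, C s)) = shc (q i) Bs C - shc (q i) As C" for i and C :: "('xt \<times> 'x \<times> 'y \<times> 'z) list \<Rightarrow> 'c"
  proof -
    have "sh (q i) (\<lambda>s. (Bs s, As s, C s)) = sh (q i) (\<lambda>s. (Bs s, C s))"
      by (rule sh_kernel_eq) (auto simp: As_def Bs_def)
    then show ?thesis unfolding shc_def by simp
  qed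
  define RV where "RV = max_outer_rate M PV PU"
  define RU where "RU = max_inner_rate M PV PU"
  define \<kappa> where "\<kappa> = key_rate M PV PU"
  define rV where "rV = real m * (RV + e)"
  define rU where "rU = real m * (RU + 2 * e)"
  define hz where "hz = real m * (RU + \<kappa> - 2 * e)"
  define lk where "lk = real m * (R_L + 4 * e)"
  note rates = rate_Y[OF finK src] rate_XZ[OF finK src] rate_Z[OF finK src] rate_leakage[OF finK src]
  have mm: "real m * a \<le> real m * b" if "a \<le> b" for a b using that by (simp add: mult_left_mono)
  have h1: "shc (q i) As (map obs_Y) \<le> rV" "shc (q i) As (map obs_XZ) \<le> rV" for i
  proof -
    obtain k l where i: "i = (k, l)" by force
    show "shc (q i) As (map obs_Y) \<le> rV" "shc (q i) As (map obs_XZ) \<le> rV"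
      unfolding i rV_def RV_def by (rule order_trans[OF bound(1) mm]; use rates(1,3)[of k l] in simp)+
  qed
  have h2: "shc (q i) Bs (\<lambda>s. (As s, map obs_Y s)) \<le> rU" "shc (q i) Bs (\<lambda>s. (As s, map obs_XZ s)) \<le> rU" for i
  proof -
    obtain k l where i: "i = (k, l)" by force
    have "shc (q (k, l)) Bs (map Ob) - shc (q (k, l)) As (map Ob) \<le> real m * (RU + 2 * e)"
      if Ob: "Ob \<in> {obs_Y, obs_Z, obs_XZ}" and le: "total_information (full_law M PV PU k l) Ob - outer_information (full_law M PV PU k l) Ob \<le> RU" for Ob
      using bound(2,3)[OF Ob, of k l] mm[OF le] by (simp add: algebra_simps)
    then show "shc (q i) Bs (\<lambda>s. (As s, map obs_Y s)) \<le> rU" "shc (q i) Bs (\<lambda>s. (As s, map obs_XZ s)) \<le> rU"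
      unfolding i BA rU_def RU_def using rates(2,4)[of k l] by auto
  qed
  have h3: "hz \<le> shc (q i) Bs (\<lambda>s. (As s, map obs_Z s))" for i
  proof -
    obtain k l where i: "i = (k, l)" by force
    show ?thesis
      unfolding i BA hz_def RU_def \<kappa>_def
      using bound(1,4)[of obs_Z k l] mm[OF rates(5)[of k l]] by (simp add: algebra_simps)
  qed
  have h4: "rU + shc (q i) As (map obs_Z) - shc (q i) Bs (map obs_XZ) \<le> lk" for i
  proof -
    obtain k l where i: "i = (k, l)" by force
    show ?thesis
      unfolding i lk_def rU_def RU_def
      using bound(1)[of obs_Z k l] bound(4)[of obs_XZ k l] mm[OF order_trans[OF rates(6)[of k l] RL(2)]] by (simp add: algebra_simps)
  qed
  \<comment> \<open>\<open>hz - rU\<close> is \<open>4 * m * e\<close> short of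
    \<open>m * \<kappa>\<close>. The tolerance \<open>6 * m * e\<close> per superletter makes this
    up and leaves \<open>2 * m * e\<close> for the rounding and the tail of the key.\<close>
  have me: "6 * (real m * e) > 0" using m e by simp
  have rv0: "rV \<ge> 0" using h1(1)[of undefined] shc_nonneg[OF finq, of undefined As "map obs_Y"] by linarith
  have ru0: "rU \<ge> 0" using h2(1)[of undefined] shc_nonneg[OF finq, of undefined Bs "\<lambda>s. (As s, map obs_Y s)"] by linarith
  have ABs: "As s = map_option fst (Bs s)" for s by (simp add: As_def Bs_def)
  define coded where "coded = (\<lambda>N KS. \<exists>KV KU hV hU key dec. real KV * real KU \<le> 2 powr (real N * (rV + rU + 4 * (6 * (real m * e)))) \<and>
       (\<forall>as. hV as < KV) \<and> (\<forall>bs. hU bs < KU) \<and> (\<forall>bs. key bs < KS) \<and> (\<forall>j os. dec j os < KS) \<and>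
       (\<forall>i. code_ok \<delta> KS (6 * (real N * (6 * (real m * e)))) (real N * (lk + 6 * (6 * (real m * e)))) (replicate_pmf N (q i))
           (\<lambda>ss. key (map Bs ss)) (\<lambda>ss. dec (hV (map As ss) :: nat, hU (map Bs ss) :: nat) (map (map obs_Y) ss))
           (\<lambda>ss. (hV (map As ss), hU (map Bs ss))) (map (map obs_Z)) (map (map obs_XZ))))"
  have "\<forall>\<^sub>F N in sequentially. \<forall>KS>0. log 2 (real KS) \<le> real N * (hz - rU + 6 * (real m * e)) \<longrightarrow> coded N KS"
    unfolding coded_def
    by (rule superletter_code[where q = q and B = Bs and A = As and f = "map_option fst" and Y = "map obs_Y" and G = "map obs_XZ" and Z = "map obs_Z",
      OF finq ABs h1 h2 h3 h4 me \<delta>])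
  then obtain N0 where N0: "\<And>N KS. N \<ge> N0 \<Longrightarrow> KS > 0 \<Longrightarrow> log 2 (real KS) \<le> real N * (hz - rU + 6 * (real m * e)) \<Longrightarrow> coded N KS"
    unfolding eventually_sequentially by auto
  define c where "c = real m * log 2 (real CARD('x \<times> 'z)) + real m * log 2 (real CARD('z))"
  have "CARD('x \<times> 'z) \<ge> 1" "CARD('z) \<ge> 1" by (simp_all add: Suc_le_eq card_gt_0_iff del: card_prod)
  then have card1: "0 \<le> log 2 (real CARD('x \<times> 'z))" "0 \<le> log 2 (real CARD('z))"
    by (simp_all del: card_prod)
  have c: "real m * log 2 (real CARD('z)) \<le> c" "real m * log 2 (real CARD('x \<times> 'z)) \<le> c" "c \<ge> 0"
    unfolding c_def using card1 by auto
  \<comment> \<open>From there on the bits of the tail, its share \<open>m * R_S\<close> of the key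
    length and the rounding of the key size are together at most \<open>N * m * e\<close>.\<close>
  obtain N1 :: nat where N1: "(c + real m * R_S + 1) / (real m * e) \<le> real N1" using real_arch_simple by blast
  show ?thesis
  proof (rule eventually_sequentiallyI[of "(N0 + N1) * m"])
    fix n assume n: "(N0 + N1) * m \<le> n"
    define N where "N = n div m"
    have NN: "N \<ge> N0 + N1" unfolding N_def using n m by (simp add: less_eq_div_iff_mult_less_eq)
    have nm: "N * m \<le> n" "n \<le> N * m + m"
      unfolding N_def using div_mult_mod_eq[of n m] mod_less_divisor[OF m, of n] by linarith+
    have rnm: "real N * real m \<le> real n" "real n \<le> real N * real m + real m"
      using nm by (metis of_nat_le_iff of_nat_mult, metis of_nat_add of_nat_le_iff of_nat_mult)
    have "(c + real m * R_S + 1) / (real m * e) \<le> real N" using N1 NN by linarith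
    then have big: "c + real m * R_S + 1 \<le> real N * (real m * e)" using m e by (subst (asm) divide_le_eq) auto
    have mR: "real m * R_S \<ge> 0" using RS by simp
    let ?KS = "card (idx_set n R_S)"
    have logKS: "log 2 (real ?KS) \<le> real N * (hz - rU + 6 * (real m * e))"
    proof -
      have "log 2 (real ?KS) \<le> real n * R_S + 1" by (rule card_idx_set_bounds(3)[OF RS(1)])
      also have "real n * R_S \<le> (real N * real m + real m) * R_S" by (rule mult_right_mono[OF rnm(2) RS(1)])
      also have "\<dots> = real N * real m * R_S + real m * R_S" by (simp add: algebra_simps)
      also have "real N * real m * R_S \<le> real N * real m * \<kappa>" unfolding \<kappa>_def by (rule mult_left_mono[OF RS(2)]) simp
      finally have "log 2 (real ?KS) \<le> real N * real m * \<kappa> + real N * (real m * e)" using big c(3) by linarith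
      also have "\<dots> \<le> real N * (hz - rU + 6 * (real m * e))"
        unfolding hz_def rU_def using e m by (simp add: algebra_simps)
      finally show ?thesis .
    qed
    have "coded N ?KS" using N0[OF _ card_idx_set_bounds(1)[OF RS(1)] logKS] NN by simp
    then obtain KV KU hV hU key dec where KVU: "real KV * real KU \<le> 2 powr (real N * (rV + rU + 4 * (6 * (real m * e))))"
      and lt: "\<And>as. hV as < KV" "\<And>bs. hU bs < KU" "\<And>bs. key bs < ?KS" "\<And>j os. dec j os < ?KS"
      and ok: "\<And>i. code_ok \<delta> ?KS (6 * (real N * (6 * (real m * e)))) (real N * (lk + 6 * (6 * (real m * e)))) (replicate_pmf N (q i))
           (\<lambda>ss. key (map Bs ss)) (\<lambda>ss. dec (hV (map As ss) :: nat, hU (map Bs ss) :: nat) (map (map obs_Y) ss))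
           (\<lambda>ss. (hV (map As ss), hU (map Bs ss))) (map (map obs_Z)) (map (map obs_XZ))"
      unfolding coded_def by blast
    define oy where "oy = (\<lambda>y :: 'y. (None :: 'x option, Some y, None :: 'z option))"
    \<comment> \<open>Both hashes are packed into one number, with \<open>hU\<close> as the digit
      below \<open>KU\<close>.\<close>
    define eJ where "eJ = (\<lambda>xts :: 'xt list. hV (map (\<lambda>b. map_option fst (B b)) (blocks N m xts)) * KU + hU (map B (blocks N m xts)))"
    define eS where "eS = (\<lambda>xts :: 'xt list. key (map B (blocks N m xts)))"
    define de where "de = (\<lambda>j ys. dec (j div KU, j mod KU) (blocks N m (map oy ys)))"
    have KU: "KU > 0" using lt(2)[of undefined] by simp
    have eJlt: "eJ xts < KV * KU" for xts
    proof -
      have "eJ xts < hV (map (\<lambda>b. map_option fst (B b)) (blocks N m xts)) * KU + KU" unfolding eJ_def using lt(2) by simp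
      also have "\<dots> = Suc (hV (map (\<lambda>b. map_option fst (B b)) (blocks N m xts))) * KU" by simp
      also have "\<dots> \<le> KV * KU" by (rule mult_le_mono1) (use lt(1) in \<open>simp add: Suc_le_eq\<close>)
      finally show ?thesis .
    qed
    have xt: "(\<lambda>(xt, x, y, z). xt) = (fst :: 'xt \<times> 'x \<times> 'y \<times> 'z \<Rightarrow> 'xt)" by auto
    have Ae: "map As (blocks N m ws) = map (\<lambda>b. map_option fst (B b)) (blocks N m (map (\<lambda>(xt, x, y, z). xt) ws))" for ws
      unfolding blocks_map xt by (simp add: As_def)
    have Be: "map Bs (blocks N m ws) = map B (blocks N m (map (\<lambda>(xt, x, y, z). xt) ws))" for ws
      unfolding blocks_map xt by (simp add: Bs_def)
    have "(obs_Y :: 'xt \<times> 'x \<times> 'y \<times> 'z \<Rightarrow> _) = oy \<circ> (\<lambda>(xt, x, y, z). y)" by (auto simp: obs_Y_def oy_def fun_eq_iff)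
    then have Ye: "map (map obs_Y) (blocks N m ws) = blocks N m (map oy (map (\<lambda>(xt, x, y, z). y) ws))" for ws :: "('xt \<times> 'x \<times> 'y \<times> 'z) list"
      unfolding blocks_map by (simp only: map_map o_def)
    have main: "code_ok \<delta> ?KS (real n * \<delta>) (real n * (R_L + \<delta>)) (replicate_pmf n (letter_law M k l))
        (\<lambda>ws. eS (map (\<lambda>(xt, x, y, z). xt) ws)) (\<lambda>ws. de (eJ (map (\<lambda>(xt, x, y, z). xt) ws)) (map (\<lambda>(xt, x, y, z). y) ws))
        (\<lambda>ws. eJ (map (\<lambda>(xt, x, y, z). xt) ws)) (map (\<lambda>(xt, x, y, z). z)) (map (\<lambda>(xt, x, y, z). (x, z)))" for k l
    proof -
      have ok': "code_ok \<delta> ?KS (6 * (real N * (6 * (real m * e)))) (real N * (lk + 6 * (6 * (real m * e)))) (replicate_pmf N (replicate_pmf m (letter_law M k l)))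
           (\<lambda>ss. key (map Bs ss)) (\<lambda>ss. dec (hV (map As ss), hU (map Bs ss)) (map (map obs_Y) ss))
           (\<lambda>ss. (hV (map As ss), hU (map Bs ss))) (map (map obs_Z)) (map (map obs_XZ))"
        using ok[of "(k, l)"] by (simp add: q_def L_def)
      have okb: "code_ok \<delta> ?KS (6 * (real N * (6 * (real m * e))) + c) (real N * (lk + 6 * (6 * (real m * e))) + c) (replicate_pmf n (letter_law M k l))
         (\<lambda>ws. key (map Bs (blocks N m ws))) (\<lambda>ws. dec (hV (map As (blocks N m ws)), hU (map Bs (blocks N m ws))) (map (map obs_Y) (blocks N m ws)))
         (\<lambda>ws. (hV (map As (blocks N m ws)), hU (map Bs (blocks N m ws)))) (map (\<lambda>(xt, x, y, z). z)) (map (\<lambda>(xt, x, y, z). (x, z)))"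
        by (rule code_ok_blocks[OF _ nm ok', where az = "\<lambda>z. (None, None, Some z)" and bz = "\<lambda>(x, y, z). the z"
              and ag = "\<lambda>(x, z). (Some x, None, Some z)" and bg = "\<lambda>(x, y, z). (the x, the z)"])
           (use c in \<open>auto simp: obs_Z_def obs_XZ_def\<close>)
      have fS: "(\<lambda>ws. eS (map (\<lambda>(xt, x, y, z). xt) ws)) = (\<lambda>ws. key (map Bs (blocks N m ws)))" unfolding eS_def Be ..
      have k1: "6 * (real N * (6 * (real m * e))) + c \<le> real n * \<delta>"
      proof -
        have "6 * (real N * (6 * (real m * e))) + c \<le> 37 * (real N * real m * e)" using big mR by (simp add: algebra_simps)
        also have "\<dots> \<le> 37 * (real n * e)" using rnm(1) e by (simp add: mult_right_mono)
        also have "\<dots> = real n * (37 * e)" by simp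
        also have "\<dots> \<le> real n * \<delta>" by (rule mult_left_mono) (use e in auto)
        finally show ?thesis .
      qed
      have k2: "real N * (lk + 6 * (6 * (real m * e))) + c \<le> real n * (R_L + \<delta>)"
      proof -
        have "real N * (lk + 6 * (6 * (real m * e))) + c \<le> real N * real m * (R_L + 41 * e)"
          unfolding lk_def using big mR by (simp add: algebra_simps)
        also have "\<dots> \<le> real n * (R_L + 41 * e)" by (rule mult_right_mono[OF rnm(1)]) (use RL e in simp)
        also have "\<dots> \<le> real n * (R_L + \<delta>)" by (rule mult_left_mono) (use e in auto)
        finally show ?thesis .
      qed
      show ?thesis unfolding fS
      proof (rule code_ok_cong[OF okb _ _ k1 k2])
        fix ws
        have dm: "eJ (map (\<lambda>(xt, x, y, z). xt) ws) div KU = hV (map As (blocks N m ws))" "eJ (map (\<lambda>(xt, x, y, z). xt) ws) mod KU = hU (map Bs (blocks N m ws))"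
          for ws :: "('xt \<times> 'x \<times> 'y \<times> 'z) list"
          unfolding eJ_def Ae Be using lt(2) KU by (simp_all)
        show "dec (hV (map As (blocks N m ws)), hU (map Bs (blocks N m ws))) (map (map obs_Y) (blocks N m ws)) = de (eJ (map (\<lambda>(xt, x, y, z). xt) ws)) (map (\<lambda>(xt, x, y, z). y) ws)"
          unfolding de_def dm Ye ..
        fix ws'
        show "((hV (map As (blocks N m ws)), hU (map Bs (blocks N m ws))) = (hV (map As (blocks N m ws')), hU (map Bs (blocks N m ws')))) \<longleftrightarrow>
            eJ (map (\<lambda>(xt, x, y, z). xt) ws) = eJ (map (\<lambda>(xt, x, y, z). xt) ws')"
        proof
          assume "(hV (map As (blocks N m ws)), hU (map Bs (blocks N m ws))) = (hV (map As (blocks N m ws')), hU (map Bs (blocks N m ws')))"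
          then show "eJ (map (\<lambda>(xt, x, y, z). xt) ws) = eJ (map (\<lambda>(xt, x, y, z). xt) ws')" unfolding eJ_def Ae Be by simp
        next
          assume "eJ (map (\<lambda>(xt, x, y, z). xt) ws) = eJ (map (\<lambda>(xt, x, y, z). xt) ws')"
          then show "(hV (map As (blocks N m ws)), hU (map Bs (blocks N m ws))) = (hV (map As (blocks N m ws')), hU (map Bs (blocks N m ws')))"
            unfolding dm[symmetric] by simp
        qed
      qed
    qed
    have KJ: "real (KV * KU) \<le> 2 powr (real n * (helper_rate M PV PU + \<eta>))"
    proof -
      have nn: "0 \<le> RU + RV + 27 * e"
      proof -
        have "0 \<le> real m * (RU + RV + 3 * e)" using rv0 ru0 unfolding rV_def rU_def by (simp add: algebra_simps)
        then have "0 \<le> RU + RV + 3 * e" using m by (simp add: zero_le_mult_iff)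
        then show ?thesis using e by simp
      qed
      have "real N * (rV + rU + 4 * (6 * (real m * e))) = real N * real m * (RU + RV + 27 * e)"
        unfolding rV_def rU_def by (simp add: algebra_simps)
      also have "\<dots> \<le> real n * (RU + RV + 27 * e)" by (rule mult_right_mono[OF rnm(1) nn])
      also have "\<dots> \<le> real n * (helper_rate M PV PU + \<eta>)"
        unfolding helper_rate_eq[OF finK src] RU_def RV_def by (rule mult_left_mono) (use e in auto)
      finally have "2 powr (real N * (rV + rU + 4 * (6 * (real m * e)))) \<le> 2 powr (real n * (helper_rate M PV PU + \<eta>))" by simp
      from order_trans[OF KVU this] show ?thesis by simp
    qed
    show "\<exists>KJ eJ eS dec. real KJ \<le> 2 powr (real n * (helper_rate M PV PU + \<eta>)) \<and>
     (\<forall>xt. eJ xt < KJ) \<and> (\<forall>xt. eS xt < card (idx_set n R_S)) \<and> (\<forall>j y. dec j y < card (idx_set n R_S)) \<and>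
     (\<forall>k l. code_ok \<delta> (card (idx_set n R_S)) (real n * \<delta>) (real n * (R_L + \<delta>)) (replicate_pmf n (letter_law M k l))
        (\<lambda>ws. eS (map (\<lambda>(xt, x, y, z). xt) ws)) (\<lambda>ws. dec (eJ (map (\<lambda>(xt, x, y, z). xt) ws)) (map (\<lambda>(xt, x, y, z). y) ws))
        (\<lambda>ws. eJ (map (\<lambda>(xt, x, y, z). xt) ws) :: nat) (map (\<lambda>(xt, x, y, z). z)) (map (\<lambda>(xt, x, y, z). (x, z))))"
    proof (intro exI conjI allI)
      show "real (KV * KU) \<le> 2 powr (real n * (helper_rate M PV PU + \<eta>))" by (rule KJ)
      show "eJ xt < KV * KU" for xt by (rule eJlt)
      show "eS xt < ?KS" for xt unfolding eS_def by (rule lt(3))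
      show "de j y < ?KS" for j y unfolding de_def by (rule lt(4))
    qed (rule main)
  qed
qed

section \<open>Achievability\<close>

lemma leakage_symmetry: "shc R X Z - shc R X (\<lambda>\<omega>. (J \<omega>, Z \<omega>)) = shc R J Z - shc R J (\<lambda>\<omega>. (X \<omega>, Z \<omega>))"
proof -
  have "sh R (\<lambda>\<omega>. (X \<omega>, J \<omega>, Z \<omega>)) = sh R (\<lambda>\<omega>. (J \<omega>, X \<omega>, Z \<omega>))" by (rule sh_kernel_eq) auto
  then show ?thesis unfolding shc_def by linarith
qed

lemma idx_set_eq: "idx_set n R = {1..card (idx_set n R)}"
  by (simp add: idx_set_def)

text \<open>Codes are built with values from 0 on; the shift by one moves them into
  \<open>idx_set\<close>, which begins at 1.\<close>

lemma gs_law_eq: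
  "gs_law M n (\<lambda>xt. (1 + eJ xt, 1 + eS xt)) d k l = map_pmf (\<lambda>ws.
      (1 + eS (map (\<lambda>(xt, x, y, z). xt) ws), d (map (\<lambda>(xt, x, y, z). y) ws, 1 + eJ (map (\<lambda>(xt, x, y, z). xt) ws)),
       1 + eJ (map (\<lambda>(xt, x, y, z). xt) ws), map (\<lambda>(xt, x, y, z). x) ws, map (\<lambda>(xt, x, y, z). z) ws))
     (replicate_pmf n (letter_law M k l))"
  unfolding gs_law_def seq_law_def map_pmf_def by (simp add: bind_assoc_pmf bind_return_pmf)

lemma cs_law_eq:
  "cs_law M n R_S e d k l = map_pmf (\<lambda>(s, ws).
      (s, d (map (\<lambda>(xt, x, y, z). y) ws, e (map (\<lambda>(xt, x, y, z). xt) ws, s)),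
       e (map (\<lambda>(xt, x, y, z). xt) ws, s), map (\<lambda>(xt, x, y, z). x) ws, map (\<lambda>(xt, x, y, z). z) ws))
     (pair_pmf (pmf_of_set (idx_set n R_S)) (replicate_pmf n (letter_law M k l)))"
  unfolding cs_law_def seq_law_def map_pmf_def pair_pmf_def by (simp add: bind_assoc_pmf bind_return_pmf Let_def)

lemma prob_map_pmf: "measure_pmf.prob (map_pmf f p) {x. Q x} = measure_pmf.prob p {\<omega>. Q (f \<omega>)}"
  by (simp add: vimage_def)

lemma map_pair_kernel:
  fixes ws ws' :: "('xt \<times> 'x \<times> 'y \<times> 'z) list"
  shows "map (\<lambda>(xt, x, y, z). (x, z)) ws = map (\<lambda>(xt, x, y, z). (x, z)) ws' \<longleftrightarrow>
   (map (\<lambda>(xt, x, y, z). x) ws, map (\<lambda>(xt, x, y, z). z) ws) = (map (\<lambda>(xt, x, y, z). x) ws', map (\<lambda>(xt, x, y, z). z) ws')"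
  using map_eq_map_iff_pair[of "\<lambda>(xt, x, y, z). x" "\<lambda>(xt, x, y, z). z" ws ws'] by (simp add: case_prod_unfold)

lemma code_size_le:
  assumes "real K \<le> 2 powr (real n * R)" "R \<ge> 0"
  shows "K \<le> card (idx_set n R)"
  using order_trans[OF assms(1) card_idx_set_bounds(4)[OF assms(2), of n]] by simp

theorem gs_achievable:
  fixes M :: "('x::finite, 'xt::finite, 'y::finite, 'z::finite, 'k::finite, 'l::finite) compound_model"
  assumes finK: "\<And>xt. finite (set_pmf (aux_kernel PV PU xt))" and src: "compound_source M"
    and RS: "0 \<le> R_S" "R_S \<le> key_rate M PV PU" and RL: "0 \<le> R_L" "leakage_rate M PV PU \<le> R_L"
    and RJ: "0 \<le> R_J" "helper_rate M PV PU + \<eta> \<le> R_J" and \<delta>: "\<delta> > 0" and \<eta>: "\<eta> > 0"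
  shows "\<forall>\<^sub>F n in sequentially. \<exists>e d. gs_code_ok M n \<delta> (R_S, R_J, R_L) e d"
proof -
  \<comment> \<open>One bit is then at most \<open>n * \<delta>\<close>, which pays for the ceiling
    in the size of \<open>idx_set n R_J\<close>.\<close>
  have ev: "\<forall>\<^sub>F n in sequentially. 1 / \<delta> \<le> real n"
    using filterlim_real_sequentially unfolding filterlim_at_top by blast
  show ?thesis using compound_code[OF finK src RS RL \<delta> \<eta>] ev
  proof eventually_elim
    case (elim n)
    let ?xt = "map (\<lambda>(xt :: 'xt, x :: 'x, y :: 'y, z :: 'z). xt)" and ?x = "map (\<lambda>(xt :: 'xt, x :: 'x, y :: 'y, z :: 'z). x)"
    let ?y = "map (\<lambda>(xt :: 'xt, x :: 'x, y :: 'y, z :: 'z). y)" and ?z = "map (\<lambda>(xt :: 'xt, x :: 'x, y :: 'y, z :: 'z). z)"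
    let ?KS = "card (idx_set n R_S)"
    from elim(1) obtain KJ eJ eS dec where KJ: "real KJ \<le> 2 powr (real n * (helper_rate M PV PU + \<eta>))"
      and lt: "\<And>xt. eJ xt < KJ" "\<And>xt. eS xt < ?KS" "\<And>j y. dec j y < ?KS"
      and ok: "\<And>k l. code_ok \<delta> ?KS (real n * \<delta>) (real n * (R_L + \<delta>)) (replicate_pmf n (letter_law M k l))
        (\<lambda>ws. eS (?xt ws)) (\<lambda>ws. dec (eJ (?xt ws)) (?y ws)) (\<lambda>ws. eJ (?xt ws) :: nat) ?z (map (\<lambda>(xt, x, y, z). (x, z)))"
      by blast
    define e where "e = (\<lambda>xt. (1 + eJ xt, 1 + eS xt))"
    define d where "d = (\<lambda>(y, j). 1 + dec (j - 1) y)"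
    have n\<delta>: "1 \<le> real n * \<delta>" using elim(2) \<delta> by (simp add: field_simps)
    have "real n * (helper_rate M PV PU + \<eta>) \<le> real n * R_J" by (rule mult_left_mono) (use RJ in auto)
    then have "2 powr (real n * (helper_rate M PV PU + \<eta>)) \<le> 2 powr (real n * R_J)" by simp
    from order_trans[OF KJ this] have KJ': "KJ \<le> card (idx_set n R_J)" by (rule code_size_le) (rule RJ(1))
    have enc: "gs_encoder n R_S R_J e"
      unfolding gs_encoder_def e_def using lt(1,2) KJ' idx_set_eq[of n R_J] idx_set_eq[of n R_S]
      by (metis SigmaI Suc_eq_plus1_left Suc_leI atLeastAtMost_iff le_add1 less_le_trans)
    have decd: "key_decoder n R_S R_J d"
      unfolding key_decoder_def d_def using lt(3) idx_set_eq[of n R_S] by (metis (mono_tags) Suc_eq_plus1_left Suc_leI atLeastAtMost_iff case_prod_conv le_add1)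
    have "let P = gs_law M n e d k l in
        measure_pmf.prob P {\<omega>. key_est \<omega> \<noteq> key \<omega>} \<le> \<delta> \<and>
        H[P](key) + real n * \<delta> \<ge> log 2 ?KS \<and>
        log 2 ?KS \<ge> real n * (R_S - \<delta>) \<and>
        log 2 (card (idx_set n R_J)) \<le> real n * (R_J + \<delta>) \<and>
        I[P](key ; (\<lambda>\<omega>. (helper \<omega>, eve_seq \<omega>))) \<le> real n * \<delta> \<and>
        I[P](src_seq ; helper | eve_seq) \<le> real n * (R_L + \<delta>)" for k l
    proof -
      let ?R = "replicate_pmf n (letter_law M k l)"
      have finR: "finite (set_pmf ?R)" by (rule finite_set_replicate_pmf) simp
      define P where "P = gs_law M n e d k l"
      have P: "P = map_pmf (\<lambda>ws. (1 + eS (?xt ws), 1 + dec (eJ (?xt ws)) (?y ws), 1 + eJ (?xt ws), ?x ws, ?z ws)) ?R"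
        unfolding P_def e_def gs_law_eq by (simp add: d_def)
      have finP: "finite (set_pmf P)" unfolding P using finR by simp
      note rv = key_def key_est_def helper_def src_seq_def eve_seq_def
      note okk = ok[of k l, unfolded code_ok_def]
      have 1: "measure_pmf.prob P {\<omega>. key_est \<omega> \<noteq> key \<omega>} \<le> \<delta>"
        using okk unfolding P prob_map_pmf rv by simp
      have shS: "sh P key = sh ?R (\<lambda>ws. eS (?xt ws))"
        unfolding P sh_map rv by (rule sh_kernel_eq) simp
      have s1: "shc P key (\<lambda>\<omega>. (helper \<omega>, eve_seq \<omega>)) = shc ?R (\<lambda>ws. eS (?xt ws)) (\<lambda>ws. (eJ (?xt ws), ?z ws))"
      proof -
        have "sh ?R (\<lambda>ws. (1 + eS (?xt ws), 1 + eJ (?xt ws), ?z ws)) = sh ?R (\<lambda>ws. (eS (?xt ws), eJ (?xt ws), ?z ws))"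
          "sh ?R (\<lambda>ws. (1 + eJ (?xt ws), ?z ws)) = sh ?R (\<lambda>ws. (eJ (?xt ws), ?z ws))"
          by (rule sh_kernel_eq; simp)+
        then show ?thesis unfolding P shc_map rv by (simp add: shc_def)
      qed
      \<comment> \<open>Since \<open>H(S | J, Z) \<le> H(S) \<le> log 2 ?KS\<close>, this one bound
        on the equivocation yields both the near uniformity of the key and its secrecy.\<close>
      have sec: "log 2 ?KS - real n * \<delta> \<le> shc P key (\<lambda>\<omega>. (helper \<omega>, eve_seq \<omega>))" using okk unfolding s1 by blast
      have shle: "sh P key \<le> log 2 ?KS"
      proof -
        have "sh ?R (\<lambda>ws. eS (?xt ws)) \<le> log 2 (card {..<?KS})"
          using shc_le_log_card[OF finR, of "{..<?KS}" "\<lambda>ws. eS (?xt ws)" "\<lambda>_. ()"] lt(2) by (simp add: shc_const finR image_subset_iff)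
        then show ?thesis unfolding shS by simp
      qed
      have 2: "H[P](key) + real n * \<delta> \<ge> log 2 ?KS"
        unfolding ent_eq_sh using sec shc_le_sh[OF finP, of key "\<lambda>\<omega>. (helper \<omega>, eve_seq \<omega>)"] by linarith
      have 3: "log 2 ?KS \<ge> real n * (R_S - \<delta>)"
        using card_idx_set_bounds(2)[OF RS(1), of n] n\<delta> by (simp add: algebra_simps)
      have 4: "log 2 (card (idx_set n R_J)) \<le> real n * (R_J + \<delta>)"
        using card_idx_set_bounds(3)[OF RJ(1), of n] n\<delta> by (simp add: algebra_simps)
      have 5: "I[P](key ; (\<lambda>\<omega>. (helper \<omega>, eve_seq \<omega>))) \<le> real n * \<delta>"
        unfolding mut_inf_eq_sh[OF finP] using sec shle by linarith
      have 6: "I[P](src_seq ; helper | eve_seq) \<le> real n * (R_L + \<delta>)"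
      proof -
        have "shc P helper eve_seq = shc ?R (\<lambda>ws. eJ (?xt ws)) ?z"
        proof -
          have "sh ?R (\<lambda>ws. (1 + eJ (?xt ws), ?z ws)) = sh ?R (\<lambda>ws. (eJ (?xt ws), ?z ws))"
            by (rule sh_kernel_eq) simp
          then show ?thesis unfolding P shc_map rv by (simp add: shc_def)
        qed
        moreover have "shc P helper (\<lambda>\<omega>. (src_seq \<omega>, eve_seq \<omega>)) = shc ?R (\<lambda>ws. eJ (?xt ws)) (map (\<lambda>(xt, x, y, z). (x, z)))"
        proof -
          have "sh ?R (\<lambda>ws. (1 + eJ (?xt ws), ?x ws, ?z ws)) = sh ?R (\<lambda>ws. (eJ (?xt ws), map (\<lambda>(xt, x, y, z). (x, z)) ws))"
            "sh ?R (\<lambda>ws. (?x ws, ?z ws)) = sh ?R (map (\<lambda>(xt, x, y, z). (x, z)))"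
            by (rule sh_kernel_eq; simp add: map_pair_kernel)+
          then show ?thesis unfolding P shc_map rv by (simp add: shc_def)
        qed
        ultimately show ?thesis
          unfolding cond_mut_inf_eq_shc[OF finP] leakage_symmetry[of P src_seq eve_seq helper] using okk by simp
      qed
      show ?thesis unfolding Let_def P_def[symmetric] using 1 2 3 4 5 6 by blast
    qed
    then show ?case unfolding gs_code_ok_def prod.case using enc decd by blast
  qed
qed

section \<open>Chosen keys by a one-time pad\<close>

lemma sh_pair_pmf_uniform:
  assumes S: "finite S" "S \<noteq> {}" and fin: "finite (set_pmf R)"
  shows "sh (pair_pmf (pmf_of_set S) R) (\<lambda>p. (fst p, T (snd p))) = log 2 (card S) + sh R T"
    and "sh (pair_pmf (pmf_of_set S) R) (\<lambda>p. T (snd p)) = sh R T"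
proof -
  let ?Q = "pair_pmf (pmf_of_set S) R"
  have finQ: "finite (set_pmf ?Q)" using S fin by simp
  have c: "card S > 0" using S by (simp add: card_gt_0_iff)
  show "sh ?Q (\<lambda>p. T (snd p)) = sh R T" using sh_map[of snd ?Q T] by (simp add: map_snd_pair_pmf)
  have "sh ?Q (\<lambda>p. (fst p, T (snd p))) = measure_pmf.expectation ?Q (\<lambda>p. log 2 (card S) + - log 2 (measure_pmf.prob R {\<omega>. T \<omega> = T (snd p)}))"
    unfolding sh_def
  proof (rule expectation_cong_supp)
    fix p assume p: "p \<in> set_pmf ?Q"
    have pos: "measure_pmf.prob R {\<omega>. T \<omega> = T (snd p)} > 0" using prob_level_pos[of "snd p" R T] p by auto
    have "measure_pmf.prob ?Q {p'. (fst p', T (snd p')) = (fst p, T (snd p))} = pmf (map_pmf (\<lambda>p. (fst p, T (snd p))) ?Q) (fst p, T (snd p))"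
      by (simp only: pmf_map_eq_prob)
    also have "map_pmf (\<lambda>p. (fst p, T (snd p))) ?Q = pair_pmf (pmf_of_set S) (map_pmf T R)"
      using pair_map_pmf2[of "pmf_of_set S" T R] by (simp add: apsnd_def map_prod_def case_prod_unfold)
    also have "pmf \<dots> (fst p, T (snd p)) = 1 / card S * measure_pmf.prob R {\<omega>. T \<omega> = T (snd p)}"
      using p S by (auto simp: pmf_pair pmf_map_eq_prob)
    finally show "- log 2 (measure_pmf.prob ?Q {p'. (fst p', T (snd p')) = (fst p, T (snd p))}) =
        log 2 (card S) + - log 2 (measure_pmf.prob R {\<omega>. T \<omega> = T (snd p)})"
      using pos c by (simp add: log_mult log_divide)
  qed
  also have "\<dots> = log 2 (card S) + measure_pmf.expectation (map_pmf snd ?Q) (\<lambda>w. - log 2 (measure_pmf.prob R {\<omega>. T \<omega> = T w}))"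
    by (subst Bochner_Integration.integral_add) (auto simp: integrable_measure_pmf_finite[OF finQ])
  finally show "sh ?Q (\<lambda>p. (fst p, T (snd p))) = log 2 (card S) + sh R T" by (simp add: sh_def map_snd_pair_pmf)
qed

text \<open>\<open>K\<close> is added before \<open>b\<close> is taken away, so that the subtraction
  of naturals never truncates.\<close>

lemma one_time_pad_inverse:
  fixes a b K :: nat
  assumes "a < K" "b < K"
  shows "((a + b) mod K + K - b) mod K = a"
proof (cases "a + b < K")
  case False
  then have "(a + b) mod K = a + b - K" using assms by (simp add: mod_if)
  then show ?thesis using False assms by simp
qed (use assms in simp)

text \<open>The chosen key and \<open>m\<close> give back the generated key \<open>S\<close>, while
  \<open>m\<close> costs at most \<open>log 2 K\<close> bits, which is what the uniform chosen key
  brings in; so the equivocation of \<open>S\<close> passes to the chosen key. For the leakage,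
  \<open>m\<close> is uniform even given \<open>S\<close>, \<open>J\<close> and \<open>G\<close>,
  hence it adds exactly \<open>log 2 K\<close> bits given \<open>G\<close> and at most that given
  \<open>Z\<close>.\<close>

lemma one_time_pad:
  fixes R :: "'w pmf" and S J :: "'w \<Rightarrow> nat" and K :: nat and m :: "nat \<times> 'w \<Rightarrow> nat" and Z :: "'w \<Rightarrow> 'c" and G :: "'w \<Rightarrow> 'g"
  assumes fin: "finite (set_pmf R)" and K: "K > 0" and S: "\<And>w. S w < K"
  defines "Q \<equiv> pair_pmf (pmf_of_set {1..K}) R" and "m \<equiv> \<lambda>p. (fst p - 1 + S (snd p)) mod K"
  shows "shc R S (\<lambda>w. (J w, Z w)) \<le> shc Q fst (\<lambda>p. ((J (snd p), m p), Z (snd p)))"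
    and "shc Q (\<lambda>p. (J (snd p), m p)) (\<lambda>p. Z (snd p)) - shc Q (\<lambda>p. (J (snd p), m p)) (\<lambda>p. G (snd p)) \<le> shc R J Z - shc R J G"
proof -
  have finQ: "finite (set_pmf Q)" unfolding Q_def using fin K by simp
  have u: "sh Q (\<lambda>p. (fst p, T (snd p))) = log 2 (real K) + sh R T" "sh Q (\<lambda>p. T (snd p)) = sh R T" for T :: "'w \<Rightarrow> 't"
    unfolding Q_def using sh_pair_pmf_uniform[of "{1..K}" R T] K fin by auto
  have fs: "1 \<le> fst p" "fst p - 1 < K" if "p \<in> set_pmf Q" for p using that K unfolding Q_def by auto
  have mK: "m p < K" for p unfolding m_def using K by simp
  have up: "sh Q (\<lambda>p. ((J (snd p), m p), C (snd p))) \<le> sh R (\<lambda>w. (J w, C w)) + log 2 (real K)" for C :: "'w \<Rightarrow> 't"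
  proof -
    have "sh Q (\<lambda>p. ((J (snd p), m p), C (snd p))) = sh Q (\<lambda>p. (m p, J (snd p), C (snd p)))" by (rule sh_kernel_eq) auto
    also have "\<dots> \<le> sh Q (\<lambda>p. (J (snd p), C (snd p))) + log 2 (card {..<K})"
      by (rule sh_pair_le[OF finQ]) (use mK in auto)
    finally show ?thesis using u(2)[of "\<lambda>w. (J w, C w)"] by simp
  qed
  have low1: "sh Q (\<lambda>p. (fst p, (J (snd p), m p), Z (snd p))) \<ge> log 2 (real K) + sh R (\<lambda>w. (S w, J w, Z w))"
  proof -
    have "S (snd p) = (m p + K - (fst p - 1)) mod K" if "p \<in> set_pmf Q" for p
      using one_time_pad_inverse[of "S (snd p)" K "fst p - 1"] fs[OF that] S unfolding m_def by (simp add: add.commute)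
    then have "det_by Q (\<lambda>p. (fst p, S (snd p), J (snd p), Z (snd p))) (\<lambda>p. (fst p, (J (snd p), m p), Z (snd p)))"
      unfolding det_by_def by simp
    then have "sh Q (\<lambda>p. (fst p, S (snd p), J (snd p), Z (snd p))) \<le> sh Q (\<lambda>p. (fst p, (J (snd p), m p), Z (snd p)))" by (rule sh_mono[OF finQ])
    then show ?thesis using u(1)[of "\<lambda>w. (S w, J w, Z w)"] by simp
  qed
  show "shc R S (\<lambda>w. (J w, Z w)) \<le> shc Q fst (\<lambda>p. ((J (snd p), m p), Z (snd p)))"
    using low1 up[of Z] unfolding shc_def by linarith
  have low2: "sh Q (\<lambda>p. ((J (snd p), m p), G (snd p))) \<ge> log 2 (real K) + sh R (\<lambda>w. (J w, G w))"
  proof -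
    have "fst p = 1 + (m p + K - S (snd p)) mod K" if "p \<in> set_pmf Q" for p
      using one_time_pad_inverse[of "fst p - 1" K "S (snd p)"] fs[OF that] S unfolding m_def by simp
    then have d: "det_by Q (\<lambda>p. (fst p, S (snd p), J (snd p), G (snd p))) (\<lambda>p. (m p, S (snd p), J (snd p), G (snd p)))"
      unfolding det_by_def by simp
    have "sh Q (\<lambda>p. (fst p, S (snd p), J (snd p), G (snd p))) \<le> sh Q (\<lambda>p. (m p, S (snd p), J (snd p), G (snd p)))" by (rule sh_mono[OF finQ d])
    moreover have "shc Q m (\<lambda>p. (S (snd p), J (snd p), G (snd p))) \<le> shc Q m (\<lambda>p. (J (snd p), G (snd p)))"
      by (rule shc_mono_det[OF finQ]) auto
    moreover have "sh Q (\<lambda>p. (m p, J (snd p), G (snd p))) = sh Q (\<lambda>p. ((J (snd p), m p), G (snd p)))" by (rule sh_kernel_eq) auto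
    ultimately show ?thesis
      using u(1)[of "\<lambda>w. (S w, J w, G w)"] u(2)[of "\<lambda>w. (S w, J w, G w)"] u(2)[of "\<lambda>w. (J w, G w)"]
      unfolding shc_def by simp
  qed
  show "shc Q (\<lambda>p. (J (snd p), m p)) (\<lambda>p. Z (snd p)) - shc Q (\<lambda>p. (J (snd p), m p)) (\<lambda>p. G (snd p)) \<le> shc R J Z - shc R J G"
    using low2 up[of Z] u(2)[of Z] u(2)[of G] unfolding shc_def by linarith
qed

theorem cs_achievable:
  fixes M :: "('x::finite, 'xt::finite, 'y::finite, 'z::finite, 'k::finite, 'l::finite) compound_model"
  assumes finK: "\<And>xt. finite (set_pmf (aux_kernel PV PU xt))" and src: "compound_source M"
    and RS: "0 \<le> R_S" "R_S \<le> key_rate M PV PU" and RL: "0 \<le> R_L" "leakage_rate M PV PU \<le> R_L"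
    and RJ: "0 \<le> R_J" "helper_rate M PV PU + key_rate M PV PU + 2 * \<eta> \<le> R_J" and \<delta>: "\<delta> > 0" and \<eta>: "\<eta> > 0"
  shows "\<forall>\<^sub>F n in sequentially. \<exists>e d. cs_code_ok M n \<delta> (R_S, R_J, R_L) e d"
proof -
  have ev: "\<forall>\<^sub>F n in sequentially. 1 / \<delta> \<le> real n" "\<forall>\<^sub>F n in sequentially. 1 / \<eta> \<le> real n"
    using filterlim_real_sequentially unfolding filterlim_at_top by blast+
  show ?thesis using compound_code[OF finK src RS RL \<delta> \<eta>] ev
  proof eventually_elim
    case (elim n)
    let ?xt = "map (\<lambda>(xt :: 'xt, x :: 'x, y :: 'y, z :: 'z). xt)" and ?x = "map (\<lambda>(xt :: 'xt, x :: 'x, y :: 'y, z :: 'z). x)"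
    let ?y = "map (\<lambda>(xt :: 'xt, x :: 'x, y :: 'y, z :: 'z). y)" and ?z = "map (\<lambda>(xt :: 'xt, x :: 'x, y :: 'y, z :: 'z). z)"
    define KS where "KS = card (idx_set n R_S)"
    from elim(1)[folded KS_def] obtain KJ eJ eS dec where KJ: "real KJ \<le> 2 powr (real n * (helper_rate M PV PU + \<eta>))"
      and lt: "\<And>xt. eJ xt < KJ" "\<And>xt. eS xt < KS" "\<And>j y. dec j y < KS"
      and ok: "\<And>k l. code_ok \<delta> KS (real n * \<delta>) (real n * (R_L + \<delta>)) (replicate_pmf n (letter_law M k l))
        (\<lambda>ws. eS (?xt ws)) (\<lambda>ws. dec (eJ (?xt ws)) (?y ws)) (\<lambda>ws. eJ (?xt ws) :: nat) ?z (map (\<lambda>(xt, x, y, z). (x, z)))"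
      by blast
    have KS: "KS > 0" unfolding KS_def by (rule card_idx_set_bounds(1)[OF RS(1)])
    have idS: "idx_set n R_S = {1..KS}" unfolding KS_def by (rule idx_set_eq)
    define e where "e = (\<lambda>(xt, s). 1 + (eJ xt * KS + (s - 1 + eS xt) mod KS))"
    define d where "d = (\<lambda>(y, j). 1 + ((j - 1) mod KS + KS - dec ((j - 1) div KS) y) mod KS)"
    have n\<delta>: "1 \<le> real n * \<delta>" using elim(2) \<delta> by (simp add: field_simps)
    have n\<eta>: "1 \<le> real n * \<eta>" using elim(3) \<eta> by (simp add: field_simps)
    \<comment> \<open>One \<open>\<eta>\<close> is spent by \<open>compound_code\<close>, the other
      on the bit by which the size of the key set may be rounded up.\<close>
    have size: "KJ * KS \<le> card (idx_set n R_J)"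
    proof (rule code_size_le[OF _ RJ(1)])
      have "log 2 (real KS) \<le> real n * R_S + 1" unfolding KS_def by (rule card_idx_set_bounds(3)[OF RS(1)])
      then have KS': "real KS \<le> 2 powr (real n * R_S + 1)" using KS by (simp add: log_le_iff)
      have "real (KJ * KS) \<le> 2 powr (real n * (helper_rate M PV PU + \<eta>)) * 2 powr (real n * R_S + 1)"
        unfolding of_nat_mult by (rule mult_mono[OF KJ KS']) auto
      also have "\<dots> = 2 powr (real n * (helper_rate M PV PU + \<eta> + R_S) + 1)" by (simp add: powr_add[symmetric] algebra_simps)
      also have "\<dots> \<le> 2 powr (real n * R_J)"
      proof -
        have "real n * (helper_rate M PV PU + \<eta> + R_S) + 1 \<le> real n * (helper_rate M PV PU + \<eta> + R_S) + real n * \<eta>" using n\<eta> by simp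
        also have "\<dots> = real n * (helper_rate M PV PU + R_S + 2 * \<eta>)" by (simp add: algebra_simps)
        also have "\<dots> \<le> real n * R_J" by (rule mult_left_mono) (use RJ RS in auto)
        finally show ?thesis by simp
      qed
      finally show "real (KJ * KS) \<le> 2 powr (real n * R_J)" .
    qed
    have elt: "eJ xt * KS + t mod KS < KJ * KS" for xt t
    proof -
      have "eJ xt * KS + t mod KS < Suc (eJ xt) * KS" using KS by simp
      also have "\<dots> \<le> KJ * KS" by (rule mult_le_mono1) (use lt(1) in \<open>simp add: Suc_le_eq\<close>)
      finally show ?thesis .
    qed
    have enc: "cs_encoder n R_S R_J e"
      unfolding cs_encoder_def e_def
    proof (intro allI impI)
      fix xt s
      have "1 + (eJ xt * KS + (s - 1 + eS xt) mod KS) \<le> card (idx_set n R_J)" using elt[of xt "s - 1 + eS xt"] size by simp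
      then show "(case (xt, s) of (xt, s) \<Rightarrow> 1 + (eJ xt * KS + (s - 1 + eS xt) mod KS)) \<in> idx_set n R_J"
        by (subst idx_set_eq) simp
    qed
    have decd: "key_decoder n R_S R_J d"
      unfolding key_decoder_def d_def idS using KS by (auto simp: Suc_le_eq)
    have "let P = cs_law M n R_S e d k l in
        measure_pmf.prob P {\<omega>. key_est \<omega> \<noteq> key \<omega>} \<le> \<delta> \<and>
        log 2 (card (idx_set n R_S)) \<ge> real n * (R_S - \<delta>) \<and>
        log 2 (card (idx_set n R_J)) \<le> real n * (R_J + \<delta>) \<and>
        I[P](key ; (\<lambda>\<omega>. (helper \<omega>, eve_seq \<omega>))) \<le> real n * \<delta> \<and>
        I[P](src_seq ; helper | eve_seq) \<le> real n * (R_L + \<delta>)" for k l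
    proof -
      let ?R = "replicate_pmf n (letter_law M k l)"
      let ?Q = "pair_pmf (pmf_of_set {1..KS}) ?R"
      let ?m = "\<lambda>p. (fst p - 1 + eS (?xt (snd p))) mod KS"
      let ?J = "\<lambda>ws. eJ (?xt ws)"
      have finR: "finite (set_pmf ?R)" by (rule finite_set_replicate_pmf) simp
      have finQ: "finite (set_pmf ?Q)" using finR KS by simp
      define P where "P = cs_law M n R_S e d k l"
      have P: "P = map_pmf (\<lambda>p. (fst p, d (?y (snd p), e (?xt (snd p), fst p)), e (?xt (snd p), fst p), ?x (snd p), ?z (snd p))) ?Q"
        unfolding P_def cs_law_eq idS by (simp add: case_prod_unfold)
      have finP: "finite (set_pmf P)" unfolding P using finQ by simp
      note rv = key_def key_est_def helper_def src_seq_def eve_seq_def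
      note okk = ok[of k l, unfolded code_ok_def]
      have ek: "e (?xt (snd p), fst p) = e (?xt (snd p'), fst p') \<longleftrightarrow> (?J (snd p), ?m p) = (?J (snd p'), ?m p')" for p p'
      proof -
        have "(e (?xt (snd p), fst p) - 1) div KS = ?J (snd p)" "(e (?xt (snd p), fst p) - 1) mod KS = ?m p" for p
          unfolding e_def using KS by simp_all
        moreover have "e (?xt (snd p), fst p) = 1 + (?J (snd p) * KS + ?m p)" for p unfolding e_def by simp
        ultimately show ?thesis by (metis prod.inject)
      qed
      have 1: "measure_pmf.prob P {\<omega>. key_est \<omega> \<noteq> key \<omega>} \<le> \<delta>"
      proof -
        have "measure_pmf.prob P {\<omega>. key_est \<omega> \<noteq> key \<omega>} = measure_pmf.prob ?Q {p. d (?y (snd p), e (?xt (snd p), fst p)) \<noteq> fst p}"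
          unfolding P prob_map_pmf rv by simp
        \<comment> \<open>The pad is undone whenever the generated key is decoded, so an error can
          only come from the generated key.\<close>
        also have "\<dots> \<le> measure_pmf.prob ?Q {p. dec (?J (snd p)) (?y (snd p)) \<noteq> eS (?xt (snd p))}"
        proof (rule prob_mono_supp)
          fix p assume p: "p \<in> set_pmf ?Q" "p \<in> {p. d (?y (snd p), e (?xt (snd p), fst p)) \<noteq> fst p}"
          have fp: "1 \<le> fst p" "fst p - 1 < KS" using p(1) KS by auto
          show "p \<in> {p. dec (?J (snd p)) (?y (snd p)) \<noteq> eS (?xt (snd p))}"
          proof (rule ccontr)
            assume "\<not> ?thesis"
            then have "d (?y (snd p), e (?xt (snd p), fst p)) = 1 + (?m p + KS - eS (?xt (snd p))) mod KS"
              unfolding d_def e_def using KS by simp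
            then show False using p(2) one_time_pad_inverse[OF fp(2) lt(2)] fp(1) by simp
          qed
        qed
        also have "\<dots> = measure_pmf.prob (map_pmf snd ?Q) {ws. dec (?J ws) (?y ws) \<noteq> eS (?xt ws)}"
          unfolding prob_map_pmf ..
        also have "\<dots> \<le> \<delta>" using okk by (simp add: map_snd_pair_pmf)
        finally show ?thesis .
      qed
      have 3: "log 2 (card (idx_set n R_S)) \<ge> real n * (R_S - \<delta>)"
        using card_idx_set_bounds(2)[OF RS(1), of n] n\<delta> by (simp add: algebra_simps)
      have 4: "log 2 (card (idx_set n R_J)) \<le> real n * (R_J + \<delta>)"
        using card_idx_set_bounds(3)[OF RJ(1), of n] n\<delta> by (simp add: algebra_simps)
      note pad = one_time_pad[OF finR KS, where S = "\<lambda>ws. eS (?xt ws)" and J = ?J, OF lt(2)]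
      have 5: "I[P](key ; (\<lambda>\<omega>. (helper \<omega>, eve_seq \<omega>))) \<le> real n * \<delta>"
      proof -
        have "sh ?Q (\<lambda>p. (fst p, e (?xt (snd p), fst p), ?z (snd p))) = sh ?Q (\<lambda>p. (fst p, (?J (snd p), ?m p), ?z (snd p)))"
          "sh ?Q (\<lambda>p. (e (?xt (snd p), fst p), ?z (snd p))) = sh ?Q (\<lambda>p. ((?J (snd p), ?m p), ?z (snd p)))"
          by (rule sh_kernel_eq; simp only: prod.inject ek)+
        then have "shc P key (\<lambda>\<omega>. (helper \<omega>, eve_seq \<omega>)) = shc ?Q fst (\<lambda>p. ((?J (snd p), ?m p), ?z (snd p)))"
          unfolding P shc_map rv by (simp add: shc_def)
        moreover have "log 2 (real KS) - real n * \<delta> \<le> shc ?R (\<lambda>ws. eS (?xt ws)) (\<lambda>ws. (?J ws, ?z ws))" using okk by blast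
        moreover have "sh P key \<le> log 2 (real KS)"
        proof -
          have "fst ` set_pmf ?Q \<subseteq> {1..KS}" using KS by auto
          from shc_le_log_card[OF finQ finite_atLeastAtMost this, of "\<lambda>_. ()"] have "sh ?Q fst \<le> log 2 (card {1..KS})"
            by (simp only: shc_const[OF finQ])
          then show ?thesis unfolding P sh_map rv by simp
        qed
        ultimately show ?thesis unfolding mut_inf_eq_sh[OF finP] using pad(1)[of ?z] by linarith
      qed
      have 6: "I[P](src_seq ; helper | eve_seq) \<le> real n * (R_L + \<delta>)"
      proof -
        have k: "sh ?Q (\<lambda>p. (e (?xt (snd p), fst p), ?z (snd p))) = sh ?Q (\<lambda>p. ((?J (snd p), ?m p), ?z (snd p)))"
          "sh ?Q (\<lambda>p. (e (?xt (snd p), fst p), ?x (snd p), ?z (snd p))) = sh ?Q (\<lambda>p. ((?J (snd p), ?m p), map (\<lambda>(xt, x, y, z). (x, z)) (snd p)))"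
          "sh ?Q (\<lambda>p. (?x (snd p), ?z (snd p))) = sh ?Q (\<lambda>p. map (\<lambda>(xt, x, y, z). (x, z)) (snd p))"
          by (rule sh_kernel_eq; simp only: prod.inject ek map_pair_kernel)+
        have "shc P helper eve_seq = shc ?Q (\<lambda>p. (?J (snd p), ?m p)) (\<lambda>p. ?z (snd p))"
          unfolding P shc_map rv using k(1) by (simp add: shc_def)
        moreover have "shc P helper (\<lambda>\<omega>. (src_seq \<omega>, eve_seq \<omega>)) = shc ?Q (\<lambda>p. (?J (snd p), ?m p)) (\<lambda>p. map (\<lambda>(xt, x, y, z). (x, z)) (snd p))"
          unfolding P shc_map rv using k(2,3) by (simp add: shc_def)
        moreover have "shc ?R ?J ?z - shc ?R ?J (map (\<lambda>(xt, x, y, z). (x, z))) \<le> real n * (R_L + \<delta>)" using okk by blast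
        ultimately show ?thesis
          unfolding cond_mut_inf_eq_shc[OF finP] leakage_symmetry[of P src_seq eve_seq helper]
          using pad(2)[of ?z "map (\<lambda>(xt, x, y, z). (x, z))"] by linarith
      qed
      show ?thesis unfolding Let_def P_def[symmetric] using 1 3 4 5 6 by blast
    qed
    then show ?case unfolding cs_code_ok_def prod.case using enc decd by blast
  qed
qed

text \<open>The helper data range over \<open>idx_set n R_J\<close>, whose size is dictated by
  \<open>R_J\<close>; the \<open>\<delta>\<close> in the rate condition does not enlarge it.
  Boundary rates are therefore reached as limits, in \<open>R_J\<close> alone.\<close>

lemma closure_helper_slack:
  assumes "\<And>\<eta>. \<eta> > 0 \<Longrightarrow> (R_S, R_J + \<eta>, R_L) \<in> A"
  shows "(R_S, R_J, R_L :: real) \<in> closure (A :: (real \<times> real \<times> real) set)"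
proof -
  have "(\<lambda>n. (R_S, R_J + inverse (real (Suc n)), R_L)) \<longlonglongrightarrow> (R_S, R_J + 0, R_L)"
    by (intro tendsto_intros LIMSEQ_inverse_real_of_nat)
  then show ?thesis unfolding closure_sequential using assms by (intro exI[of _ "\<lambda>n. (R_S, R_J + inverse (real (Suc n)), R_L)"]) simp
qed

theorem proposition1:
  fixes M :: "('x::finite, 'xt::finite, 'y::finite, 'z::finite, 'k::finite, 'l::finite) compound_model"
    and cV cU :: nat
  assumes "compound_source M"
    and "cV = CARD('xt) + 6"
    and "cU = (CARD('xt) + 2 * (CARD('k) + CARD('l)) + 1) * (CARD('xt) + CARD('k) + CARD('l) + 1)"
  shows "(\<Union>(PV, PU) \<in> {(PV, PU). aux_kernels cV cU PV (PU :: 'xt \<Rightarrow> nat pmf)}.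
            {(R_S, R_J, R_L) \<in> rate_triples.
               R_S \<le> key_rate M PV PU \<and>
               R_J \<ge> helper_rate M PV PU \<and>
               R_L \<ge> leakage_rate M PV PU})
         \<subseteq> gs_capacity_region M
       \<and>
         (\<Union>(PV, PU) \<in> {(PV, PU). aux_kernels cV cU PV (PU :: 'xt \<Rightarrow> nat pmf)}.
            {(R_S, R_J, R_L) \<in> rate_triples.
               R_S \<le> key_rate M PV PU \<and>
               R_J \<ge> helper_rate M PV PU + key_rate M PV PU \<and>
               R_L \<ge> leakage_rate M PV PU})
         \<subseteq> cs_capacity_region M"
proof -
  have pos: "\<forall>\<^sub>F \<delta> in at_right 0. (0::real) < \<delta>" by (rule eventually_at_right_less)
  have gs: "(R_S, R_J, R_L) \<in> gs_capacity_region M"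
    if "aux_kernels cV cU PV PU" "(R_S, R_J, R_L) \<in> rate_triples" "R_S \<le> key_rate M PV PU"
      "R_J \<ge> helper_rate M PV PU" "R_L \<ge> leakage_rate M PV PU" for PV and PU :: "'xt \<Rightarrow> nat pmf" and R_S R_J R_L
    unfolding gs_capacity_region_def
  proof (rule closure_helper_slack)
    fix \<eta> :: real assume \<eta>: "\<eta> > 0"
    have "\<forall>\<^sub>F \<delta> in at_right 0. \<forall>\<^sub>F n in sequentially. \<exists>e d. gs_code_ok M n \<delta> (R_S, R_J + \<eta>, R_L) e d"
      using pos
      by eventually_elim (rule gs_achievable[where \<eta> = \<eta>, OF finite_set_aux_kernel[OF that(1)] assms(1)],
        use that \<eta> in \<open>auto simp: rate_triples_def\<close>)
    then show "(R_S, R_J + \<eta>, R_L) \<in> {R \<in> rate_triples. \<forall>\<^sub>F \<delta> in at_right 0. \<forall>\<^sub>F n in sequentially. \<exists>e d. gs_code_ok M n \<delta> R e d}"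
      using that(2) \<eta> by (simp add: rate_triples_def)
  qed
  have cs: "(R_S, R_J, R_L) \<in> cs_capacity_region M"
    if "aux_kernels cV cU PV PU" "(R_S, R_J, R_L) \<in> rate_triples" "R_S \<le> key_rate M PV PU"
      "R_J \<ge> helper_rate M PV PU + key_rate M PV PU" "R_L \<ge> leakage_rate M PV PU" for PV and PU :: "'xt \<Rightarrow> nat pmf" and R_S R_J R_L
    unfolding cs_capacity_region_def
  proof (rule closure_helper_slack)
    fix \<eta> :: real assume \<eta>: "\<eta> > 0"
    \<comment> \<open>The slack is halved because \<open>cs_achievable\<close> asks for
      \<open>2 * \<eta>\<close>.\<close>
    have "\<forall>\<^sub>F \<delta> in at_right 0. \<forall>\<^sub>F n in sequentially. \<exists>e d. cs_code_ok M n \<delta> (R_S, R_J + \<eta>, R_L) e d"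
      using pos
      by eventually_elim (rule cs_achievable[where \<eta> = "\<eta> / 2", OF finite_set_aux_kernel[OF that(1)] assms(1)],
        use that \<eta> in \<open>auto simp: rate_triples_def\<close>)
    then show "(R_S, R_J + \<eta>, R_L) \<in> {R \<in> rate_triples. \<forall>\<^sub>F \<delta> in at_right 0. \<forall>\<^sub>F n in sequentially. \<exists>e d. cs_code_ok M n \<delta> R e d}"
      using that(2) \<eta> by (simp add: rate_triples_def)
  qed
  show ?thesis using gs cs by auto
qed

end
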